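(* Let $0<\beta\le n\in\mathbb{N}$ and let $\Omega\subseteq\mathbb{R}^n$ be an open set. There exists a constant $C=C(\beta,n)>0$ such that $$\|u\|_{BMO^\beta(\Omega)}\le C\,\|\nabla u\|_{L^{n,\infty}(\Omega;\mathbb{R}^n)}$$ for all $u\in W^{1,1}_{loc}(\Omega)$ such that $\nabla u\in L^{n,\infty}(\Omega;\mathbb{R}^n)$.
   Context: $L^{n,\infty}(\Omega)$ is the Marcinkiewicz space weak-$L^n$, with quasi-norm $\|f\|_{L^{n,\infty}(\Omega)}=\sup_{t>0}t\,|\{x\in\Omega:|f(x)|>t\}|^{1/n}$ (for vector-valued $f$, $|f|$ is the Euclidean norm). Hausdorff content: for $0<\beta\le n$ and $E\subseteq\mathbb{R}^n$, $\mathcal{H}^\beta_\infty(E)=\inf\{\sum_{i=1}^\infty\omega_\beta r_i^\beta: E\subset\bigcup_{i=1}^\infty B(x_i,r_i)\}$ with $\omega_\beta=\pi^{\beta/2}/\Gamma(\beta/2+1)$. Choquet integral: for $f:A\to[0,\infty]$, $\int_A f\,d\mathcal{H}^\beta_\infty=\int_0^\infty\mathcal{H}^\beta_\infty(\{x\in A:f(x)>t\})\,dt$. $$\|u\|_{BMO^\beta(\Omega)}=\sup_{2Q\subset\Omega}\ \inf_{c\in\mathbb{R}}\frac1{l(Q)^\beta}\int_Q|u-c|\,d\mathcal{H}^\beta_\infty,$$ where the supremum is over cubes $Q$ such that the concentric cube $2Q$ of twice the side length is contained in $\Omega$, and $l(Q)$ is the side length of $Q$. On the left-hand side $u$ is understood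 as its precise representative $u^*(x)=\lim_{r\to0}\frac1{|B(x,r)|}\int_{B(x,r)}u\,dy$ if $x$ is a Lebesgue point of $u$, and $u^*(x)=0$ otherwise.
   Formalization: The dimension is assumed to satisfy n ≥ 2; for n = 1 the inequality fails for every β and every nonempty open Ω, since functions with derivative of weak-L^1 norm at most 1 can have arbitrarily large oscillation on an interval. *)

theory Defs
  imports "HOL-Analysis.Analysis"
begin

section \<open>Weak Lebesgue spaces\<close>

text \<open>Real powers on \<open>[0,\<infinity>]\<close>; meaningful only for exponents \<open>p > 0\<close>.\<close>

definition ennreal_powr :: "ennreal \<Rightarrow> real \<Rightarrow> ennreal" where
  "ennreal_powr a p = (if a = top then top else ennreal (enn2real a powr p))"

definition weak_L_norm ::
    "real \<Rightarrow> (real ^ 'n) set \<Rightarrow> (real ^ 'n \<Rightarrow> 'b::real_normed_vector) \<Rightarrow> ennreal" where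
  "weak_L_norm p \<Omega> f =
     (SUP t\<in>{0<..}. ennreal t *
        ennreal_powr (emeasure lebesgue {x \<in> \<Omega>. norm (f x) > t}) (1 / p))"

definition weak_L ::
    "real \<Rightarrow> (real ^ 'n) set \<Rightarrow> (real ^ 'n \<Rightarrow> 'b::real_normed_vector) set" where
  "weak_L p \<Omega> = {f. set_borel_measurable lebesgue \<Omega> f \<and> weak_L_norm p \<Omega> f < top}"

section \<open>Sobolev functions\<close>

definition locally_integrable_on ::
    "(real ^ 'n \<Rightarrow> 'b::euclidean_space) \<Rightarrow> (real ^ 'n) set \<Rightarrow> bool" where
  "locally_integrable_on f \<Omega> \<longleftrightarrow>
     (\<forall>K. compact K \<and> K \<subseteq> \<Omega> \<longrightarrow> f absolutely_integrable_on K)"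

definition partial_deriv :: "'n \<Rightarrow> (real ^ 'n \<Rightarrow> real) \<Rightarrow> real ^ 'n \<Rightarrow> real" where
  "partial_deriv i \<phi> x = frechet_derivative \<phi> (at x) (axis i 1)"

primrec Ck :: "nat \<Rightarrow> (real ^ 'n \<Rightarrow> real) \<Rightarrow> bool" where
  "Ck 0 \<phi> \<longleftrightarrow> continuous_on UNIV \<phi>"
| "Ck (Suc k) \<phi> \<longleftrightarrow> (\<forall>x. \<phi> differentiable (at x)) \<and> (\<forall>i. Ck k (partial_deriv i \<phi>))"

text \<open>\<open>C\<^sub>c\<^sup>\<infinity>(\<Omega>)\<close>, its members being extended by zero to the whole space.\<close>

definition test_functions :: "(real ^ 'n) set \<Rightarrow> (real ^ 'n \<Rightarrow> real) set" where
  "test_functions \<Omega> =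
     {\<phi>. (\<forall>k. Ck k \<phi>) \<and> compact (closure {x. \<phi> x \<noteq> 0}) \<and> closure {x. \<phi> x \<noteq> 0} \<subseteq> \<Omega>}"

text \<open>
  A relation rather than a function: weak gradients are determined only up to
  Lebesgue null sets.
\<close>

definition has_weak_gradient ::
    "(real ^ 'n \<Rightarrow> real) \<Rightarrow> (real ^ 'n \<Rightarrow> real ^ 'n) \<Rightarrow> (real ^ 'n) set \<Rightarrow> bool" where
  "has_weak_gradient u G \<Omega> \<longleftrightarrow>
     locally_integrable_on G \<Omega> \<and>
     (\<forall>\<phi>\<in>test_functions \<Omega>. \<forall>i.
        (LINT x:\<Omega>|lebesgue. u x * partial_deriv i \<phi> x) = - (LINT x:\<Omega>|lebesgue. G x $ i * \<phi> x))"

definition W11_loc :: "(real ^ 'n) set \<Rightarrow> (real ^ 'n \<Rightarrow> real) set" where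
  "W11_loc \<Omega> = {u. locally_integrable_on u \<Omega> \<and> (\<exists>G. has_weak_gradient u G \<Omega>)}"

section \<open>Precise representative\<close>

definition ball_average :: "(real ^ 'n \<Rightarrow> real) \<Rightarrow> real ^ 'n \<Rightarrow> real \<Rightarrow> real" where
  "ball_average f x r = (LINT y:ball x r|lebesgue. f y) / measure lebesgue (ball x r)"

text \<open>
  The point value \<open>u x\<close> is deliberately not used, so that the notion depends only on the
  almost-everywhere class of \<open>u\<close>; the constant \<open>c\<close> is then the limit of the averages of \<open>u\<close>.
\<close>

definition lebesgue_point :: "(real ^ 'n \<Rightarrow> real) \<Rightarrow> real ^ 'n \<Rightarrow> bool" where
  "lebesgue_point u x \<longleftrightarrow>
     (\<exists>c. ((\<lambda>r. ball_average (\<lambda>y. \<bar>u y - c\<bar>) x r) \<longlongrightarrow> 0) (at_right 0))"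

definition precise_rep :: "(real ^ 'n \<Rightarrow> real) \<Rightarrow> real ^ 'n \<Rightarrow> real" where
  "precise_rep u x =
     (if lebesgue_point u x then Lim (at_right 0) (\<lambda>r. ball_average u x r) else 0)"

section \<open>Hausdorff content, Choquet integral and the BMO seminorm\<close>

text \<open>
  The library's \<^const>\<open>unit_ball_vol\<close> is \<open>\<beta> \<mapsto> \<pi>\<^bsup>\<beta>/2\<^esup> / \<Gamma>(\<beta>/2 + 1)\<close> for real \<open>\<beta>\<close>.
  A radius \<open>0\<close> gives an empty ball, so that finite covers are included.
\<close>

definition hausdorff_content :: "real \<Rightarrow> (real ^ 'n) set \<Rightarrow> ennreal" where
  "hausdorff_content \<beta> E =
     (INF (x, r)\<in>{(x :: nat \<Rightarrow> real ^ 'n, r :: nat \<Rightarrow> real).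
                    (\<forall>i. 0 \<le> r i) \<and> E \<subseteq> (\<Union>i. ball (x i) (r i))}.
        \<Sum>i. ennreal (unit_ball_vol \<beta> * r i powr \<beta>))"

definition choquet_integral ::
    "real \<Rightarrow> (real ^ 'n) set \<Rightarrow> (real ^ 'n \<Rightarrow> ennreal) \<Rightarrow> ennreal" where
  "choquet_integral \<beta> A f =
     (\<integral>\<^sup>+t\<in>{0<..}. hausdorff_content \<beta> {x \<in> A. f x > ennreal t} \<partial>lborel)"

text \<open>Closed, with sides parallel to the axes; \<open>a\<close> is the centre and \<open>l\<close> the side length.\<close>

definition cube :: "real ^ 'n \<Rightarrow> real \<Rightarrow> (real ^ 'n) set" where
  "cube a l = {x. \<forall>i. \<bar>x $ i - a $ i\<bar> \<le> l / 2}"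

definition BMO_norm :: "real \<Rightarrow> (real ^ 'n) set \<Rightarrow> (real ^ 'n \<Rightarrow> real) \<Rightarrow> ennreal" where
  "BMO_norm \<beta> \<Omega> u =
     (SUP (a, l)\<in>{(a, l). 0 < l \<and> cube a (2 * l) \<subseteq> \<Omega>}.
        INF c::real. choquet_integral \<beta> (cube a l) (\<lambda>x. ennreal \<bar>u x - c\<bar>) / ennreal (l powr \<beta>))"

end

theory Submission
  imports Defs
begin

text \<open>
  Let \<open>A\<close> bound the weak norm of the gradient and let \<open>r k = R / 2 ^ k\<close>, with \<open>R\<close> comparable to the side
  length of the cube. By the Poincare inequality the averages of \<open>u\<close> over the balls of radii \<open>r k\<close> and
  \<open>r (k + 1)\<close> about \<open>x\<close> differ by at most a constant times \<open>\<theta> k x\<close>, which is the integral of the norm of the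
  gradient over the ball of radius \<open>2 * r k\<close>, scaled by \<open>r k powr (1 - n)\<close>; always \<open>\<theta> k x \<le> C * A\<close>. Let the
  bad set \<open>E K\<close> consist of the points with \<open>\<theta> k x > A * q ^ (k - K)\<close> for some \<open>k \<ge> K\<close>, where \<open>q < 1\<close>. Off
  \<open>E K\<close> the sum of the \<open>\<theta> k x\<close> is at most \<open>C * A * (K + 1)\<close>, so \<open>x\<close> is a Lebesgue point and the precise
  representative differs from a fixed average by at most \<open>C * A * (K + 1)\<close>. On \<open>E K\<close> the gradient is
  concentrated: Hoelder's inequality with the exponent \<open>p = n - \<beta> / 2 < n\<close>, for which the power of the gradient
  is integrable, and Vitali's covering lemma bound the Hausdorff content of \<open>E K\<close> by
  \<open>C * 2 powr (- K * \<beta> / 2) * R powr \<beta>\<close>. Summing over \<open>K\<close> bounds the Choquet integral.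
\<close>

text \<open>The obstacle is that the gradient is only in weak L^n: its n-th power need not be
  integrable, so concentration has to be measured with an exponent \<open>p\<close> below n. On a
  ball of radius r whose scaled gradient exceeds s, Hoelder's inequality gives an integral of the
  p-th power of at least a constant times s^p r^(n-p), and n - p = \<beta>/2. Charging r^\<beta> to
  this integral leaves a spare factor r^(\<beta>/2), which for r = R / 2^k is R^(\<beta>/2)
  2^(-k\<beta>/2). The spare factor is spent twice: 2^(-K\<beta>/2) is the decay of the content of
  the bad set, and 2^(-(k-K)\<beta>/2) pays for a threshold that shrinks like
  \<open>q ^ (k - K)\<close>, whence the choice of \<open>q\<close> with
  \<open>q powr p = 2 powr (- (\<beta> / 2))\<close>. A constant threshold would bound the single
  terms but not their sum. Linear growth of the deviation in K against exponential decay of the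
  content is an estimate of John-Nirenberg type. For \<beta> < n the content sees Lebesgue null
  sets, so almost-everywhere bounds on u do not suffice, and values at points have to be reached as
  limits of averages.\<close>

section \<open>Smooth bump functions\<close>

text \<open>The functions \<open>s \<mapsto> s\<^sup>-\<^sup>m exp (- 1 / s)\<close>, extended by \<open>0\<close>: together they are closed under
  differentiation up to linear combinations, which gives smoothness without higher derivatives.\<close>

definition flat :: "nat \<Rightarrow> real \<Rightarrow> real" where
  "flat m s = (if s > 0 then exp (- 1 / s) / s ^ m else 0)"

lemma flat_nonneg: "0 \<le> flat m s"
  by (simp add: flat_def)

text \<open>From the right, substituting \<open>inverse s\<close> reduces the limit to the decay of
  \<open>y ^ m / exp y\<close> at infinity; from the left \<open>flat m\<close> is zero.\<close>

lemma flat_tendsto_0: "(flat m \<longlongrightarrow> 0) (at 0)"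
proof -
  have "((\<lambda>y::real. y ^ m / exp y) \<longlongrightarrow> 0) at_top"
    by (rule tendsto_power_div_exp_0)
  from filterlim_compose[OF this filterlim_inverse_at_top_right]
  have "((\<lambda>s::real. inverse s ^ m / exp (inverse s)) \<longlongrightarrow> 0) (at_right 0)" .
  moreover have "\<forall>\<^sub>F s in at_right 0. inverse s ^ m / exp (inverse s) = flat m (s::real)"
    by (rule eventually_at_right_less[THEN eventually_mono])
      (simp add: flat_def exp_minus field_simps)
  ultimately have "(flat m \<longlongrightarrow> 0) (at_right 0)"
    by (simp add: filterlim_cong)
  moreover have "(flat m \<longlongrightarrow> 0) (at_left 0)"
    by (rule tendsto_eventually, rule eventually_at_leftI[of "-1"]) (auto simp: flat_def)
  ultimately show ?thesis
    by (simp add: filterlim_split_at)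
qed

text \<open>The delicate point is 0: there the difference quotient \<open>flat m h / h\<close>
  equals \<open>flat (m + 1) h\<close>, so the limit for the next index gives derivative 0.\<close>

lemma has_real_derivative_flat:
  "(flat m has_real_derivative (flat (m + 2) s - real m * flat (m + 1) s)) (at s)"
proof -
  consider "s > 0" | "s < 0" | "s = 0" by linarith
  then show ?thesis
  proof cases
    case 1
    have "((\<lambda>s. exp (- 1 / s) / s ^ m) has_real_derivative
        (flat (m + 2) s - real m * flat (m + 1) s)) (at s)"
    proof -
      have "s ^ m = s * s ^ (m - 1)" if "m > 0"
        using that by (cases m) auto
      then show ?thesis
        using 1 by (cases "m = 0") (auto intro!: derivative_eq_intros
          simp: flat_def field_simps power2_eq_square power_add)
    qed
    then show ?thesis
      using 1 by (elim has_field_derivative_transform_within_open[where S = "{0<..}"]) (auto simp: flat_def)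
  next
    case 2
    have "((\<lambda>s. 0) has_real_derivative (flat (m + 2) s - real m * flat (m + 1) s)) (at s)"
      using 2 by (auto intro!: derivative_eq_intros simp: flat_def)
    then show ?thesis
      using 2 by (elim has_field_derivative_transform_within_open[where S = "{..<0}"]) (auto simp: flat_def)
  next
    case 3
    have "((\<lambda>h. flat m h / h) \<longlongrightarrow> 0) (at 0)"
    proof (rule tendsto_cong[THEN iffD2, OF _ flat_tendsto_0[of "m + 1"]])
      show "\<forall>\<^sub>F x in at 0. flat m x / x = flat (m + 1) x"
        by (auto simp: flat_def eventually_at_filter)
    qed
    then show ?thesis
      using 3 by (simp add: DERIV_def flat_def)
  qed
qed

lemmas has_derivative_flat =
  has_derivative_compose[OF _ has_real_derivative_flat[unfolded has_field_derivative_def]]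

text \<open>Constants and coordinates are generators because the chain rule applied to
  \<open>d\<^sup>2 - (y - w) \<bullet> (y - w)\<close> produces factors
  \<open>y $ i - w $ i\<close>.\<close>

inductive_set bump_algebra :: "real ^ 'n \<Rightarrow> real \<Rightarrow> (real ^ 'n \<Rightarrow> real) set" for w d where
  const: "(\<lambda>y. c) \<in> bump_algebra w d"
| coord: "(\<lambda>y. y $ i) \<in> bump_algebra w d"
| flat: "(\<lambda>y. flat m (d\<^sup>2 - (y - w) \<bullet> (y - w))) \<in> bump_algebra w d"
| add: "\<lbrakk>f \<in> bump_algebra w d; g \<in> bump_algebra w d\<rbrakk> \<Longrightarrow> (\<lambda>y. f y + g y) \<in> bump_algebra w d"
| mult: "\<lbrakk>f \<in> bump_algebra w d; g \<in> bump_algebra w d\<rbrakk> \<Longrightarrow> (\<lambda>y. f y * g y) \<in> bump_algebra w d"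

lemma partial_deriv_eq:
  assumes "(f has_derivative (\<lambda>h. \<Sum>i\<in>UNIV. f' i * h $ i)) (at x)"
  shows "partial_deriv i f x = f' i"
  using frechet_derivative_at[OF assms]
  by (auto simp: partial_deriv_def axis_def if_distrib cong: if_cong dest!: fun_cong[of _ _ "axis i 1"])

lemma has_derivative_bump:
  "((\<lambda>y. flat m (d\<^sup>2 - (y - w) \<bullet> (y - w))) has_derivative
     (\<lambda>h. (flat (m + 2) (d\<^sup>2 - (y - w) \<bullet> (y - w)) - real m * flat (m + 1) (d\<^sup>2 - (y - w) \<bullet> (y - w)))
         * (- 2 * ((y - w) \<bullet> h)))) (at y)"
  for w :: "real ^ 'n"
  by (rule has_derivative_eq_rhs, rule has_derivative_flat)
    (auto intro!: derivative_eq_intros simp: inner_commute)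

lemma bump_algebra_derivative:
  fixes f :: "real ^ 'n \<Rightarrow> real"
  assumes "f \<in> bump_algebra w d"
  shows "\<exists>f'. (\<forall>i. f' i \<in> bump_algebra w d) \<and>
      (\<forall>x. (f has_derivative (\<lambda>h. \<Sum>i\<in>UNIV. f' i x * h $ i)) (at x))"
  using assms
proof induction
  case (const c)
  show ?case
    by (rule exI[of _ "\<lambda>i x. 0"]) (auto intro: bump_algebra.const)
next
  case (coord i)
  have "((\<lambda>y. y $ i) has_derivative (\<lambda>h. \<Sum>j\<in>UNIV. (if j = i then 1 else 0) * h $ j)) (at x)"
    for x :: "real ^ 'n"
    by (rule has_derivative_eq_rhs, rule bounded_linear_imp_has_derivative, rule bounded_linear_vec_nth)
      (simp add: if_distrib[of "\<lambda>c. c * _"] cong: if_cong)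
  then show ?case
    by (intro exI[of _ "\<lambda>j x. if j = i then 1 else 0"]) (auto intro: bump_algebra.const)
next
  case (flat m)
  define q where "q y = d\<^sup>2 - (y - w) \<bullet> (y - w)" for y
  define f' where "f' i y = (flat (m + 2) (q y) + (- real m) * flat (m + 1) (q y)) *
      ((- 2) * (y $ i + (- w $ i)))" for i y
  have "((\<lambda>y. flat m (q y)) has_derivative (\<lambda>h. \<Sum>i\<in>UNIV. f' i x * h $ i)) (at x)" for x
    by (rule has_derivative_eq_rhs, rule has_derivative_bump[where w = w and d = d, folded q_def])
      (auto simp: f'_def inner_vec_def sum_distrib_left algebra_simps intro!: ext sum.cong)
  moreover have "f' i \<in> bump_algebra w d" for i
    unfolding f'_def q_def by (intro bump_algebra.intros)
  ultimately show ?case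
    unfolding q_def by blast
next
  case (add f g)
  then obtain f' g' where *: "\<forall>i. f' i \<in> bump_algebra w d" "\<forall>i. g' i \<in> bump_algebra w d"
    "\<forall>x. (f has_derivative (\<lambda>h. \<Sum>i\<in>UNIV. f' i x * h $ i)) (at x)"
    "\<forall>x. (g has_derivative (\<lambda>h. \<Sum>i\<in>UNIV. g' i x * h $ i)) (at x)"
    by blast
  have "((\<lambda>y. f y + g y) has_derivative (\<lambda>h. \<Sum>i\<in>UNIV. (f' i x + g' i x) * h $ i)) (at x)" for x
    by (rule has_derivative_eq_rhs, rule has_derivative_add[OF *(3,4)[rule_format]])
      (auto simp: algebra_simps sum.distrib)
  then show ?case
    using * by (intro exI[of _ "\<lambda>i x. f' i x + g' i x"]) (auto intro!: bump_algebra.intros)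
next
  case (mult f g)
  then obtain f' g' where *: "\<forall>i. f' i \<in> bump_algebra w d" "\<forall>i. g' i \<in> bump_algebra w d"
    "\<forall>x. (f has_derivative (\<lambda>h. \<Sum>i\<in>UNIV. f' i x * h $ i)) (at x)"
    "\<forall>x. (g has_derivative (\<lambda>h. \<Sum>i\<in>UNIV. g' i x * h $ i)) (at x)"
    by blast
  have "((\<lambda>y. f y * g y) has_derivative
      (\<lambda>h. \<Sum>i\<in>UNIV. (f x * g' i x + f' i x * g x) * h $ i)) (at x)" for x
    by (rule has_derivative_eq_rhs, rule has_derivative_mult[OF *(3,4)[rule_format]])
      (auto simp: algebra_simps sum.distrib sum_distrib_left)
  then show ?case
    using * mult.hyps
    by (intro exI[of _ "\<lambda>i x. f x * g' i x + f' i x * g x"]) (auto intro!: bump_algebra.intros)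
qed

lemma bump_algebra_Ck: "f \<in> bump_algebra w d \<Longrightarrow> Ck k f"
proof (induction k arbitrary: f)
  case 0
  then obtain f' where "\<And>x. (f has_derivative (\<lambda>h. \<Sum>i\<in>UNIV. f' i x * h $ i)) (at x)"
    using bump_algebra_derivative by blast
  then have "isCont f x" for x
    by (rule has_derivative_continuous)
  then show ?case
    by (simp add: continuous_at_imp_continuous_on)
next
  case (Suc k)
  obtain f' where f': "\<And>i. f' i \<in> bump_algebra w d"
    "\<And>x. (f has_derivative (\<lambda>h. \<Sum>i\<in>UNIV. f' i x * h $ i)) (at x)"
    using bump_algebra_derivative[OF Suc.prems] by blast
  have "partial_deriv i f = f' i" for i
    using partial_deriv_eq[OF f'(2)] by (intro ext) auto
  moreover have "f differentiable at x" for x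
    using f'(2) unfolding differentiable_def by blast
  ultimately show ?case
    using f'(1) Suc.IH by simp
qed

text \<open>A smooth kernel that, for d > 0, is positive exactly on the open ball of radius d. It is
  left unnormalised; its integral is divided out later as \<open>bump_mass\<close>.\<close>

definition bump :: "real \<Rightarrow> real ^ 'n \<Rightarrow> real" where
  "bump d v = flat 0 (d\<^sup>2 - v \<bullet> v)"

lemma bump_nonneg: "0 \<le> bump d v"
  by (simp add: bump_def flat_nonneg)

lemma bump_le_1: "bump d v \<le> 1"
  by (simp add: bump_def flat_def)

lemma bump_minus_commute: "bump d (x - y) = bump d (y - x)"
  by (simp add: bump_def inner_diff inner_commute add.commute)

lemma bump_pos_iff: "d > 0 \<Longrightarrow> 0 < bump d v \<longleftrightarrow> norm v < d"
  using power_mono_iff[of d "norm v" 2]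
  by (auto simp: bump_def flat_def not_less[symmetric] simp flip: power2_norm_eq_inner)

lemma bump_nonzero: "d > 0 \<Longrightarrow> bump d v \<noteq> 0 \<longleftrightarrow> norm v < d"
  using bump_pos_iff[of d v] bump_nonneg[of d v] by auto

lemma continuous_bump: "continuous_on UNIV (bump d)"
proof -
  have "(\<lambda>y. flat 0 (d\<^sup>2 - (y - 0) \<bullet> (y - 0))) \<in> bump_algebra 0 d"
    by (rule bump_algebra.flat)
  then show ?thesis
    using bump_algebra_Ck[of _ 0 d 0] by (simp add: bump_def[abs_def])
qed

lemma borel_measurable_bump [measurable]: "bump d \<in> borel_measurable borel"
  by (rule borel_measurable_continuous_onI[OF continuous_bump])

lemma bump_test_function:
  assumes "d > 0" "cball w d \<subseteq> W"
  shows "(\<lambda>y. bump d (y - w)) \<in> test_functions W"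
proof -
  have "{x. bump d (x - w) \<noteq> 0} = ball w d"
    by (simp add: set_eq_iff bump_nonzero[OF assms(1)] dist_norm norm_minus_commute[of w])
  moreover have "(\<lambda>y. bump d (y - w)) \<in> bump_algebra w d"
    unfolding bump_def by (rule bump_algebra.flat)
  ultimately show ?thesis
    unfolding test_functions_def mem_Collect_eq
    using assms bump_algebra_Ck[of "\<lambda>y. bump d (y - w)" w d] by auto
qed

text \<open>The gradient of \<open>bump d\<close>: for m = 0 the derivative of \<open>flat m\<close>
  is just \<open>flat 2\<close>, and the inner gradient is -2v.\<close>

definition bump_deriv :: "real \<Rightarrow> real ^ 'n \<Rightarrow> real ^ 'n" where
  "bump_deriv d v = (- 2 * flat 2 (d\<^sup>2 - v \<bullet> v)) *\<^sub>R v"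

lemma has_derivative_bump_shift:
  "((\<lambda>y. bump d (y - w)) has_derivative (\<lambda>h. bump_deriv d (y - w) \<bullet> h)) (at y)"
  unfolding bump_def
  by (rule has_derivative_eq_rhs, rule has_derivative_bump)
    (simp add: bump_deriv_def numeral_2_eq_2 algebra_simps)

lemma partial_deriv_bump: "partial_deriv i (\<lambda>y. bump d (y - w)) y = bump_deriv d (y - w) $ i"
  by (rule partial_deriv_eq[of _ "\<lambda>i. bump_deriv d (y - w) $ i"])
    (use has_derivative_bump_shift in \<open>auto simp: inner_vec_def\<close>)

lemma continuous_bump_deriv: "continuous_on UNIV (bump_deriv d)"
proof -
  have "(\<lambda>y. flat 2 (d\<^sup>2 - (y - 0) \<bullet> (y - 0))) \<in> bump_algebra 0 d"
    by (rule bump_algebra.flat)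
  then have "continuous_on UNIV (\<lambda>y :: real ^ 'a. flat 2 (d\<^sup>2 - y \<bullet> y))"
    using bump_algebra_Ck[of _ 0 d 0] by simp
  then show ?thesis
    unfolding bump_deriv_def by (intro continuous_intros)
qed

lemma borel_measurable_bump_deriv [measurable]: "bump_deriv d \<in> borel_measurable borel"
  by (rule borel_measurable_continuous_onI[OF continuous_bump_deriv])

lemma bounded_bump_deriv:
  assumes "d > 0"
  obtains M where "M \<ge> 0" "\<And>v :: real ^ 'a. norm (bump_deriv d v) \<le> M"
proof -
  have "compact (bump_deriv d ` cball (0 :: real ^ 'a) d)"
    by (intro compact_continuous_image continuous_on_subset[OF continuous_bump_deriv]) auto
  then obtain M where M: "\<And>v :: real ^ 'a. norm v \<le> d \<Longrightarrow> norm (bump_deriv d v) \<le> M"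
    using compact_imp_bounded[of "bump_deriv d ` cball (0 :: real ^ 'a) d"] unfolding bounded_iff
    by (metis imageI mem_cball_0)
  have "bump_deriv d v = 0" if "norm v > d" for v :: "real ^ 'a"
    using that assms power_mono_iff[of d "norm v" 2]
    by (simp add: bump_deriv_def flat_def not_less[symmetric] flip: power2_norm_eq_inner)
  with M have "norm (bump_deriv d v) \<le> max M 0" for v :: "real ^ 'a"
    by (cases "norm v \<le> d") (auto simp: le_max_iff_disj)
  then show ?thesis
    by (intro that[of "max M 0"]) auto
qed

section \<open>Mollification of weakly differentiable functions\<close>

lemma integrable_mult_bounded:
  fixes f :: "'a \<Rightarrow> real"
  assumes "integrable M f" "g \<in> borel_measurable M" "\<And>x. \<bar>g x\<bar> \<le> C"
  shows "integrable M (\<lambda>x. f x * g x)"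
proof (rule Bochner_Integration.integrable_bound)
  show "integrable M (\<lambda>x. C * f x)"
    using assms(1) by simp
  show "AE x in M. norm (f x * g x) \<le> norm (C * f x)"
  proof (rule AE_I2)
    fix x
    have "\<bar>g x\<bar> \<le> \<bar>C\<bar>"
      using assms(3)[of x] by linarith
    then show "norm (f x * g x) \<le> norm (C * f x)"
      using mult_left_mono[of "\<bar>g x\<bar>" "\<bar>C\<bar>" "\<bar>f x\<bar>"] by (simp add: abs_mult mult.commute)
  qed
qed (use assms in measurable)

text \<open>This is the possibly unbounded factor of the integrand in
  \<open>mollify_diff_le\<close>; multiplied there by a bounded one, it licenses Fubini's
  theorem.\<close>

lemma integrable_indicator_times_fst:
  fixes U :: "'b :: euclidean_space \<Rightarrow> real"
  assumes U: "integrable lborel U"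
  shows "integrable (lborel \<Otimes>\<^sub>M lborel) (\<lambda>(t :: real, y). indicator {0..1} t * U y)"
proof -
  have [measurable]: "U \<in> borel_measurable borel"
    using U by auto
  have I: "integrable lborel (\<lambda>t :: real. indicator {0..1} t * (\<integral>y. \<bar>U y\<bar> \<partial>lborel))"
    by (intro integrable_mult_left integrable_real_indicator) auto
  have "integrable lborel (\<lambda>t :: real. \<integral>y. norm (indicator {0..1} t * U y) \<partial>lborel)"
    by (subst Bochner_Integration.integrable_cong[OF refl _, of _ _ "\<lambda>t. indicator {0..1} t * (\<integral>y. \<bar>U y\<bar> \<partial>lborel)"])
      (auto simp: abs_mult I)
  then show ?thesis
    by (intro lborel_pair.Fubini_integrable) (use U in \<open>auto simp: case_prod_beta\<close>)
qed

lemma abs_bump_le_1: "\<bar>bump d v\<bar> \<le> 1"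
  using bump_nonneg[of d v] bump_le_1[of d v] by simp

text \<open>\<open>U\<close> and \<open>V\<close> are integrable on the whole space, while \<open>V\<close> is the gradient of \<open>U\<close> on \<open>W\<close> only:
  this is what truncating a local Sobolev function to a compact set gives.\<close>

locale weak_gradient_pair =
  fixes U :: "real ^ 'n \<Rightarrow> real" and V :: "real ^ 'n \<Rightarrow> real ^ 'n" and W :: "(real ^ 'n) set"
  assumes integrable_U: "integrable lborel U" and integrable_V: "integrable lborel V"
    and weak: "\<And>\<phi> i. \<phi> \<in> test_functions W \<Longrightarrow>
      (\<integral>y. U y * partial_deriv i \<phi> y \<partial>lborel) = - (\<integral>y. V y $ i * \<phi> y \<partial>lborel)"
begin

lemma borel_measurable_U [measurable]: "U \<in> borel_measurable borel"
  using integrable_U by auto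

lemma borel_measurable_V [measurable]: "V \<in> borel_measurable borel"
  using integrable_V by auto

definition mollify :: "real \<Rightarrow> real ^ 'n \<Rightarrow> real" where
  "mollify d x = (\<integral>y. U y * bump d (y - x) \<partial>lborel)"

text \<open>The norm is taken before averaging, so this dominates the norm of the averaged
  \<open>V\<close>; with values in \<open>ennreal\<close> it is open to Tonelli's theorem.\<close>

definition mollified_gradient :: "real \<Rightarrow> real ^ 'n \<Rightarrow> ennreal" where
  "mollified_gradient d x = (\<integral>\<^sup>+y. ennreal (norm (V y) * bump d (y - x)) \<partial>lborel)"

lemma borel_measurable_mollified_gradient [measurable]: "mollified_gradient d \<in> borel_measurable borel"
  unfolding mollified_gradient_def by measurable

lemma borel_measurable_mollify [measurable]: "mollify d \<in> borel_measurable borel"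
  unfolding mollify_def by measurable

lemma integrable_U_bump: "integrable lborel (\<lambda>y. U y * bump d (y - x))"
  by (rule integrable_mult_bounded[OF integrable_U _ abs_bump_le_1]) measurable

lemma integrable_V_bump: "integrable lborel (\<lambda>y. V y $ i * bump d (y - x))"
proof (rule integrable_mult_bounded[OF _ _ abs_bump_le_1])
  show "integrable lborel (\<lambda>y. V y $ i)"
    by (rule integrable_bounded_linear[OF bounded_linear_vec_nth integrable_V])
qed measurable

text \<open>The bump centred at w is a test function because \<open>cball w d\<close> lies in
  \<open>W\<close>. Testing the weak gradient with it trades the derivative of the bump for
  \<open>V\<close>, and Cauchy-Schwarz does the rest.\<close>

lemma integral_U_bump_deriv:
  assumes "d > 0" "cball w d \<subseteq> W"
  shows "norm (\<integral>y. U y * (bump_deriv d (y - w) \<bullet> v) \<partial>lborel) \<le> norm v * mollified_gradient d w"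
proof -
  obtain M where M: "\<And>v :: real ^ 'n. norm (bump_deriv d v) \<le> M"
    using bounded_bump_deriv[OF assms(1)] by blast
  have int: "integrable lborel (\<lambda>y. U y * bump_deriv d (y - w) $ i)" for i
    by (rule integrable_mult_bounded[OF integrable_U _ order.trans[OF component_le_norm_cart M]])
      (auto intro!: borel_measurable_continuous_onI continuous_intros continuous_on_compose2[OF continuous_bump_deriv])
  have "(\<integral>y. U y * (bump_deriv d (y - w) \<bullet> v) \<partial>lborel)
      = (\<integral>y. (\<Sum>i\<in>UNIV. v $ i * (U y * bump_deriv d (y - w) $ i)) \<partial>lborel)"
    by (simp add: inner_vec_def sum_distrib_left mult_ac)
  also have "\<dots> = (\<Sum>i\<in>UNIV. v $ i * (\<integral>y. U y * bump_deriv d (y - w) $ i \<partial>lborel))"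
    using int by (subst Bochner_Integration.integral_sum) auto
  also have "\<dots> = (\<Sum>i\<in>UNIV. - (v $ i * (\<integral>y. V y $ i * bump d (y - w) \<partial>lborel)))"
  proof (rule sum.cong[OF refl])
    fix i
    show "v $ i * (\<integral>y. U y * bump_deriv d (y - w) $ i \<partial>lborel)
        = - (v $ i * (\<integral>y. V y $ i * bump d (y - w) \<partial>lborel))"
      using weak[OF bump_test_function[OF assms], of i] by (simp add: partial_deriv_bump)
  qed
  also have "\<dots> = (\<integral>y. (\<Sum>i\<in>UNIV. - (v $ i * (V y $ i * bump d (y - w)))) \<partial>lborel)"
    using integrable_V_bump by (subst Bochner_Integration.integral_sum) auto
  also have "\<dots> = (\<integral>y. - (V y \<bullet> v) * bump d (y - w) \<partial>lborel)"
    by (simp add: inner_vec_def sum_distrib_left sum_negf mult_ac)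
  finally have eq: "(\<integral>y. U y * (bump_deriv d (y - w) \<bullet> v) \<partial>lborel)
      = (\<integral>y. - (V y \<bullet> v) * bump d (y - w) \<partial>lborel)" .
  have "integrable lborel (\<lambda>y. - (V y \<bullet> v) * bump d (y - w))"
    using integrable_V
    by (intro integrable_mult_bounded[OF _ _ abs_bump_le_1]) auto
  from integral_norm_bound_ennreal[OF this]
  have "norm (\<integral>y. U y * (bump_deriv d (y - w) \<bullet> v) \<partial>lborel)
      \<le> (\<integral>\<^sup>+y. norm (- (V y \<bullet> v) * bump d (y - w)) \<partial>lborel)"
    unfolding eq .
  also have "\<dots> \<le> (\<integral>\<^sup>+y. ennreal (norm v) * ennreal (norm (V y) * bump d (y - w)) \<partial>lborel)"
  proof (rule nn_integral_mono)
    fix y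
    show "ennreal (norm (- (V y \<bullet> v) * bump d (y - w))) \<le> ennreal (norm v) * ennreal (norm (V y) * bump d (y - w))"
      using mult_right_mono[OF Cauchy_Schwarz_ineq2[of "V y" v] bump_nonneg[of d "y - w"]]
      by (simp add: abs_mult bump_nonneg mult_ac flip: ennreal_mult)
  qed
  also have "\<dots> = norm v * mollified_gradient d w"
    unfolding mollified_gradient_def by (rule nn_integral_cmult) measurable
  finally show ?thesis .
qed

text \<open>With y fixed, the fundamental theorem of calculus is applied to the kernel along the
  segment, so \<open>mollify\<close> itself is never differentiated. Fubini's theorem then brings
  the y-integral inside, where \<open>integral_U_bump_deriv\<close> applies at each point of the
  segment.\<close>

lemma mollify_diff_le:
  assumes d: "d > 0" and seg: "\<And>t. 0 \<le> t \<Longrightarrow> t \<le> 1 \<Longrightarrow> cball (z + t *\<^sub>R (x - z)) d \<subseteq> W"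
  shows "ennreal \<bar>mollify d x - mollify d z\<bar>
    \<le> norm (x - z) * (\<integral>\<^sup>+t\<in>{0..1}. mollified_gradient d (z + t *\<^sub>R (x - z)) \<partial>lborel)"
proof -
  define w where "w t = z + t *\<^sub>R (x - z)" for t
  \<comment> \<open>The direction is \<open>z - x\<close> because the moving point
    \<open>w t\<close> enters the kernel with a minus sign.\<close>
  define k where "k t y = indicator {0..1} t * U y * (bump_deriv d (y - w t) \<bullet> (z - x))" for t :: real and y
  obtain M where M: "M \<ge> 0" "\<And>v :: real ^ 'n. norm (bump_deriv d v) \<le> M"
    using bounded_bump_deriv[OF d] by blast
  have bd: "\<bar>bump_deriv d v \<bullet> (z - x)\<bar> \<le> M * norm (z - x)" for v
    by (rule order.trans[OF Cauchy_Schwarz_ineq2]) (intro mult_right_mono M norm_ge_zero)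
  have "integrable (lborel \<Otimes>\<^sub>M lborel)
      (\<lambda>p. (\<lambda>(t, y). indicator {0..1} t * U y) p * (bump_deriv d (snd p - w (fst p)) \<bullet> (z - x)))"
    by (rule integrable_mult_bounded[OF integrable_indicator_times_fst[OF integrable_U] _ bd])
      (simp add: w_def)
  then have int: "integrable (lborel \<Otimes>\<^sub>M lborel) (case_prod k)"
    unfolding k_def case_prod_unfold by simp
  have inner: "(\<integral>t. k t y \<partial>lborel) = U y * bump d (y - x) - U y * bump d (y - z)" for y
  proof -
    have "(\<integral>t. indicator {0..1} t *\<^sub>R (bump_deriv d (y - w t) \<bullet> (z - x)) \<partial>lborel)
        = bump d (y - w 1) - bump d (y - w 0)"
    proof (rule integral_FTC_atLeastAtMost)
      show "((\<lambda>t. bump d (y - w t)) has_vector_derivative bump_deriv d (y - w t) \<bullet> (z - x)) (at t within {0..1})" for t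
      proof -
        have 1: "((\<lambda>t. y - w t) has_derivative (\<lambda>h. h *\<^sub>R (z - x))) (at t within {0..1})"
          unfolding w_def by (rule has_derivative_eq_rhs, (rule derivative_intros)+) (auto simp: algebra_simps)
        have "((\<lambda>v. bump d v) has_derivative (\<lambda>h. bump_deriv d (y - w t) \<bullet> h)) (at (y - w t))"
          using has_derivative_bump_shift[of d 0 "y - w t"] by simp
        from has_derivative_compose[OF 1 this]
        show ?thesis
          by (simp add: has_vector_derivative_def)
      qed
      show "continuous_on {0..1} (\<lambda>t. bump_deriv d (y - w t) \<bullet> (z - x))"
        unfolding w_def
        by (intro continuous_intros continuous_on_compose2[OF continuous_bump_deriv]) auto
    qed simp
    moreover have "(\<integral>t. k t y \<partial>lborel)
        = (\<integral>t. U y * (indicator {0..1} t *\<^sub>R (bump_deriv d (y - w t) \<bullet> (z - x))) \<partial>lborel)"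
      by (simp add: k_def mult_ac)
    ultimately show ?thesis
      by (simp add: w_def right_diff_distrib)
  qed
  have "mollify d x - mollify d z = (\<integral>y. (\<integral>t. k t y \<partial>lborel) \<partial>lborel)"
    unfolding inner mollify_def by (simp add: integrable_U_bump)
  also have "\<dots> = (\<integral>t. (\<integral>y. k t y \<partial>lborel) \<partial>lborel)"
    by (rule lborel_pair.Fubini_integral[OF int])
  finally have "ennreal \<bar>mollify d x - mollify d z\<bar> = ennreal (norm (\<integral>t. (\<integral>y. k t y \<partial>lborel) \<partial>lborel))"
    by simp
  also have "\<dots> \<le> (\<integral>\<^sup>+t. norm (\<integral>y. k t y \<partial>lborel) \<partial>lborel)"
    by (rule integral_norm_bound_ennreal, rule lborel_pair.integrable_fst[OF int])
  also have "\<dots> \<le> (\<integral>\<^sup>+t. norm (x - z) * (mollified_gradient d (w t) * indicator {0..1} t) \<partial>lborel)"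
  proof (rule nn_integral_mono)
    fix t
    show "ennreal (norm (\<integral>y. k t y \<partial>lborel)) \<le> norm (x - z) * (mollified_gradient d (w t) * indicator {0..1} t)"
    proof (cases "t \<in> {0..1}")
      case True
      then show ?thesis
        using integral_U_bump_deriv[OF d seg[of t], of "z - x"]
        by (simp add: k_def w_def norm_minus_commute)
    qed (simp add: k_def)
  qed
  also have "\<dots> = norm (x - z) * (\<integral>\<^sup>+t\<in>{0..1}. mollified_gradient d (w t) \<partial>lborel)"
    unfolding w_def by (rule nn_integral_cmult) measurable
  finally show ?thesis
    unfolding w_def .
qed

end

text \<open>For indicators, regularity of the measure gives a closed set inside and an open set
  outside with small gaps, and Urysohn's lemma interpolates between them. Sums add errors; limits
  use dominated convergence.\<close>

lemma integrable_approx_continuous: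
  fixes f :: "'a::euclidean_space \<Rightarrow> real"
  assumes "integrable lborel f" "e > 0"
  shows "\<exists>h. continuous_on UNIV h \<and> (\<integral>\<^sup>+x. ennreal \<bar>f x - h x\<bar> \<partial>lborel) \<le> ennreal e"
  using assms
proof (induction arbitrary: e rule: integrable_induct)
  case (base A c)
  \<comment> \<open>The summand 1 keeps the denominator positive when c = 0.\<close>
  define d where "d = e / (2 * (\<bar>c\<bar> + 1))"
  have d: "d > 0" "\<bar>c\<bar> * (2 * d) \<le> e"
    using base.prems by (auto simp: d_def field_simps)
  have A: "A \<in> lmeasurable"
    using base.hyps by (simp add: fmeasurable_def)
  obtain T where T: "open T" "A \<subseteq> T" "T \<in> lmeasurable" "emeasure lebesgue (T - A) < ennreal d"
    using sets_lebesgue_outer_open[of A d] A d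
    by (metis fmeasurableD fmeasurable.Un Diff_partition fmeasurable_def mem_Collect_eq)
  obtain K where K: "closed K" "K \<subseteq> A" "A - K \<in> lmeasurable" "emeasure lebesgue (A - K) < ennreal d"
    using sets_lebesgue_inner_closed[of A d] A d by (metis fmeasurableD)
  obtain h :: "'a \<Rightarrow> real" where h: "continuous_on UNIV h" "\<And>x. h x \<in> closed_segment 0 1"
    "\<And>x. x \<in> - T \<Longrightarrow> h x = 0" "\<And>x. x \<in> K \<Longrightarrow> h x = 1"
    by (rule Urysohn[of "- T" K 0 1]) (use K T in auto)
  have h01: "0 \<le> h x" "h x \<le> 1" for x
    using h(2)[of x] by (auto simp: closed_segment_eq_real_ivl split: if_splits)
  have [measurable]: "h \<in> borel_measurable borel"
    by (rule borel_measurable_continuous_onI[OF h(1)])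
  have [measurable]: "T \<in> sets borel" "K \<in> sets borel" "A \<in> sets borel"
    using T K base.hyps by auto
  have "(\<integral>\<^sup>+x. ennreal \<bar>indicator A x *\<^sub>R c - h x * c\<bar> \<partial>lborel)
      \<le> (\<integral>\<^sup>+x. ennreal \<bar>c\<bar> * (indicator (T - A) x + indicator (A - K) x) \<partial>lborel)"
  proof (rule nn_integral_mono)
    fix x
    have "\<bar>indicator A x - h x\<bar> \<le> indicator (T - A) x + indicator (A - K) x"
      using h01[of x] h(3,4)[of x] T(2) K(2) by (auto simp: indicator_def abs_if)
    from mult_left_mono[OF this, of "\<bar>c\<bar>"]
    have "\<bar>indicator A x *\<^sub>R c - h x * c\<bar> \<le> \<bar>c\<bar> * (indicator (T - A) x + indicator (A - K) x)"
      by (simp only: abs_mult[symmetric] right_diff_distrib) (simp add: mult.commute)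
    moreover have "ennreal (\<bar>c\<bar> * (indicator (T - A) x + indicator (A - K) x))
        = ennreal \<bar>c\<bar> * (indicator (T - A) x + indicator (A - K) x)"
      by (subst ennreal_mult) (auto simp: ennreal_indicator)
    ultimately show "ennreal \<bar>indicator A x *\<^sub>R c - h x * c\<bar>
        \<le> ennreal \<bar>c\<bar> * (indicator (T - A) x + indicator (A - K) x)"
      by (metis ennreal_leI)
  qed
  also have "\<dots> = ennreal \<bar>c\<bar> * (emeasure lborel (T - A) + emeasure lborel (A - K))"
    by (simp add: nn_integral_cmult nn_integral_add)
  also have "\<dots> \<le> ennreal \<bar>c\<bar> * (ennreal d + ennreal d)"
    using T(4) K(4) by (intro mult_left_mono add_mono) auto
  also have "\<dots> = ennreal (\<bar>c\<bar> * (2 * d))"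
    using d by (simp add: ennreal_mult flip: ennreal_plus)
  also have "\<dots> \<le> ennreal e"
    using d(2) by (rule ennreal_leI)
  finally show ?case
    using h(1) by (intro exI[of _ "\<lambda>x. h x * c"]) (auto intro: continuous_intros)
next
  case (add f g)
  obtain h k where h: "continuous_on UNIV h" "(\<integral>\<^sup>+x. ennreal \<bar>f x - h x\<bar> \<partial>lborel) \<le> ennreal (e / 2)"
    and k: "continuous_on UNIV k" "(\<integral>\<^sup>+x. ennreal \<bar>g x - k x\<bar> \<partial>lborel) \<le> ennreal (e / 2)"
    using add.IH[of "e / 2"] add.prems by auto
  have [measurable]: "h \<in> borel_measurable borel" "k \<in> borel_measurable borel"
    using h k by (auto intro: borel_measurable_continuous_onI)
  have [measurable]: "f \<in> borel_measurable borel" "g \<in> borel_measurable borel"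
    using add.hyps by auto
  have "(\<integral>\<^sup>+x. ennreal \<bar>f x + g x - (h x + k x)\<bar> \<partial>lborel)
      \<le> (\<integral>\<^sup>+x. ennreal \<bar>f x - h x\<bar> + ennreal \<bar>g x - k x\<bar> \<partial>lborel)"
    by (rule nn_integral_mono) (simp add: ennreal_leI flip: ennreal_plus)
  also have "\<dots> \<le> ennreal (e / 2) + ennreal (e / 2)"
    by (subst nn_integral_add) (auto intro: add_mono h k)
  also have "\<dots> = ennreal e"
    using add.prems by (simp flip: ennreal_plus)
  finally show ?case
    using h k by (intro exI[of _ "\<lambda>x. h x + k x"]) (auto intro: continuous_intros)
next
  case (lim f s)
  have [measurable]: "f \<in> borel_measurable borel" "\<And>i. s i \<in> borel_measurable borel"
    using lim.hyps by auto
  have "(\<lambda>i. \<integral>x. norm (f x - s i x) \<partial>lborel) \<longlonglongrightarrow> integral\<^sup>L lborel (\<lambda>x :: 'a. 0)"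
  \<comment> \<open>The factor 3 stems from
    \<open>\<bar>s i x\<bar> \<le> 2 * \<bar>f x\<bar>\<close>, which the induction rule
    supplies.\<close>
  proof (rule integral_dominated_convergence[where w = "\<lambda>x. 3 * norm (f x)"])
    show "AE x in lborel. (\<lambda>i. norm (f x - s i x)) \<longlonglongrightarrow> 0"
      using lim.hyps by (auto intro!: AE_I2 tendsto_eq_intros)
    show "AE x in lborel. norm (norm (f x - s i x)) \<le> 3 * norm (f x)" for i
    proof (rule AE_I2)
      fix x
      have "\<bar>s i x\<bar> \<le> 2 * \<bar>f x\<bar>" using lim.hyps(3)[of x i] by simp
      then show "norm (norm (f x - s i x)) \<le> 3 * norm (f x)" by simp
    qed
  qed (use lim.hyps in auto)
  then have "\<forall>\<^sub>F i in sequentially. (\<integral>x. norm (f x - s i x) \<partial>lborel) < e / 2"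
    using lim.prems by (intro order_tendstoD) auto
  then obtain i where i: "(\<integral>x. norm (f x - s i x) \<partial>lborel) < e / 2"
    by (auto simp: eventually_sequentially)
  obtain h where h: "continuous_on UNIV h" "(\<integral>\<^sup>+x. ennreal \<bar>s i x - h x\<bar> \<partial>lborel) \<le> ennreal (e / 2)"
    using lim.IH[of "e / 2"] lim.prems by auto
  have [measurable]: "h \<in> borel_measurable borel"
    using h by (auto intro: borel_measurable_continuous_onI)
  have "(\<integral>\<^sup>+x. ennreal \<bar>f x - h x\<bar> \<partial>lborel)
      \<le> (\<integral>\<^sup>+x. ennreal (norm (f x - s i x)) + ennreal \<bar>s i x - h x\<bar> \<partial>lborel)"
    by (rule nn_integral_mono) (simp add: ennreal_leI flip: ennreal_plus)
  also have "\<dots> = (\<integral>\<^sup>+x. ennreal (norm (f x - s i x)) \<partial>lborel) + (\<integral>\<^sup>+x. ennreal \<bar>s i x - h x\<bar> \<partial>lborel)"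
    by (rule nn_integral_add) measurable
  also have "\<dots> \<le> ennreal (e / 2) + ennreal (e / 2)"
  proof (intro add_mono h)
    have "integrable lborel (\<lambda>x. norm (f x - s i x))"
      using lim.hyps by auto
    from nn_integral_eq_integral[OF this]
    show "(\<integral>\<^sup>+x. ennreal (norm (f x - s i x)) \<partial>lborel) \<le> ennreal (e / 2)"
      using i by (auto intro!: ennreal_leI)
  qed
  also have "\<dots> = ennreal e"
    using lim.prems by (simp flip: ennreal_plus)
  finally show ?case
    using h by blast
qed

section \<open>Affine substitutions and averages over segments\<close>

lemma nn_integral_lborel_affine:
  fixes f :: "'a::euclidean_space \<Rightarrow> ennreal"
  assumes [measurable]: "f \<in> borel_measurable borel" and c: "c \<noteq> 0"
  shows "(\<integral>\<^sup>+x. f x \<partial>lborel) = ennreal (\<bar>c\<bar> ^ DIM('a)) * (\<integral>\<^sup>+x. f (t + c *\<^sub>R x) \<partial>lborel)"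
  by (subst lborel_affine[OF c, of t])
    (simp add: nn_integral_density nn_integral_distr nn_integral_cmult)

text \<open>The Jacobian is c to the power of the dimension, so for c at least 1/2 the substitution
  loses at most a power of 2, uniformly in c and t.\<close>

lemma nn_integral_lborel_affine_le:
  fixes f :: "'a::euclidean_space \<Rightarrow> ennreal"
  assumes [measurable]: "f \<in> borel_measurable borel" and c: "c \<ge> 1 / 2"
  shows "(\<integral>\<^sup>+x. f (t + c *\<^sub>R x) \<partial>lborel) \<le> 2 ^ DIM('a) * (\<integral>\<^sup>+x. f x \<partial>lborel)"
proof -
  have "1 \<le> (2 * c) ^ DIM('a)"
    using c by (intro one_le_power) auto
  then have "1 \<le> ennreal ((2 * c) ^ DIM('a))"
    by (metis ennreal_1 ennreal_leI)
  also have "\<dots> = 2 ^ DIM('a) * ennreal (\<bar>c\<bar> ^ DIM('a))"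
    using c by (simp add: power_mult_distrib ennreal_mult flip: ennreal_power)
  finally have "1 * (\<integral>\<^sup>+x. f (t + c *\<^sub>R x) \<partial>lborel)
      \<le> 2 ^ DIM('a) * ennreal (\<bar>c\<bar> ^ DIM('a)) * (\<integral>\<^sup>+x. f (t + c *\<^sub>R x) \<partial>lborel)"
    by (rule mult_right_mono) simp
  also have "\<dots> = 2 ^ DIM('a) * (\<integral>\<^sup>+x. f x \<partial>lborel)"
    using c by (simp add: nn_integral_lborel_affine[of f c t] mult.assoc)
  finally show ?thesis
    by simp
qed

text \<open>At the time \<open>t\<close> one of the weights \<open>t\<close>, \<open>1 - t\<close> is at least \<open>1/2\<close>, and the corresponding endpoint
  is used as the variable of substitution.\<close>

lemma nn_integral_convex_segments_le:
  fixes g :: "'a::euclidean_space \<Rightarrow> ennreal"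
  assumes [measurable]: "g \<in> borel_measurable borel" "B \<in> sets borel" and "convex B"
  shows "(\<integral>\<^sup>+x\<in>B. \<integral>\<^sup>+z\<in>B. \<integral>\<^sup>+t\<in>{0..1}. g (z + t *\<^sub>R (x - z)) \<partial>lborel \<partial>lborel \<partial>lborel)
    \<le> 2 ^ DIM('a) * emeasure lborel B * (\<integral>\<^sup>+x\<in>B. g x \<partial>lborel)"
proof -
  define C where "C = 2 ^ DIM('a) * (\<integral>\<^sup>+x\<in>B. g x \<partial>lborel)"
  define F where "F t x z = g (z + t *\<^sub>R (x - z)) * indicator B x * indicator B z" for t x z
  have [measurable]: "(\<lambda>(t, x, z). F t x z) \<in> borel_measurable (borel \<Otimes>\<^sub>M borel \<Otimes>\<^sub>M borel)"
    unfolding F_def by measurable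
  have F_swap: "F t x z = F (1 - t) z x" for t x z
    by (simp add: F_def algebra_simps)
  have half: "(\<integral>\<^sup>+x. F t x z \<partial>lborel) \<le> C * indicator B z" if t: "1 / 2 \<le> t" "t \<le> 1" for t z
  proof (cases "z \<in> B")
    case True
    have "(\<integral>\<^sup>+x. F t x z \<partial>lborel) \<le> (\<integral>\<^sup>+x. (\<lambda>w. g w * indicator B w) ((1 - t) *\<^sub>R z + t *\<^sub>R x) \<partial>lborel)"
    proof (rule nn_integral_mono)
      fix x
      have "z + t *\<^sub>R (x - z) = (1 - t) *\<^sub>R z + t *\<^sub>R x"
        by (simp add: algebra_simps)
      \<comment> \<open>Convexity moves the restriction to \<open>B\<close> from the endpoints to
        the intermediate point, so that only the integral of g over \<open>B\<close>
        appears.\<close>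
      moreover have "(1 - t) *\<^sub>R z + t *\<^sub>R x \<in> B" if "x \<in> B"
        using \<open>convex B\<close> True that t by (intro convexD) auto
      ultimately show "F t x z \<le> (\<lambda>w. g w * indicator B w) ((1 - t) *\<^sub>R z + t *\<^sub>R x)"
        by (auto simp: F_def indicator_def)
    qed
    also have "\<dots> \<le> C"
      unfolding C_def using t by (intro nn_integral_lborel_affine_le) auto
    finally show ?thesis using True by simp
  qed (simp add: F_def)
  have C: "(\<integral>\<^sup>+x. C * indicator B x \<partial>lborel) = C * emeasure lborel B"
    by (rule nn_integral_cmult_indicator) simp
  have slice: "(\<integral>\<^sup>+x. \<integral>\<^sup>+z. F t x z \<partial>lborel \<partial>lborel) \<le> C * emeasure lborel B" if t: "0 \<le> t" "t \<le> 1" for t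
  proof (cases "1 / 2 \<le> t")
    case True
    have "(\<integral>\<^sup>+x. \<integral>\<^sup>+z. F t x z \<partial>lborel \<partial>lborel) = (\<integral>\<^sup>+z. \<integral>\<^sup>+x. F t x z \<partial>lborel \<partial>lborel)"
      by (rule lborel_pair.Fubini') measurable
    also have "\<dots> \<le> (\<integral>\<^sup>+z. C * indicator B z \<partial>lborel)"
      using True t by (intro nn_integral_mono half)
    finally show ?thesis using C by simp
  next
    case False
    have "(\<integral>\<^sup>+x. \<integral>\<^sup>+z. F t x z \<partial>lborel \<partial>lborel) \<le> (\<integral>\<^sup>+z. C * indicator B z \<partial>lborel)"
      using False t by (subst F_swap, intro nn_integral_mono half) auto
    then show ?thesis using C by simp
  qed
  have "(\<integral>\<^sup>+x\<in>B. \<integral>\<^sup>+z\<in>B. \<integral>\<^sup>+t\<in>{0..1}. g (z + t *\<^sub>R (x - z)) \<partial>lborel \<partial>lborel \<partial>lborel)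
      = (\<integral>\<^sup>+x. \<integral>\<^sup>+z. \<integral>\<^sup>+t. F t x z * indicator {0..1} t \<partial>lborel \<partial>lborel \<partial>lborel)"
    by (simp add: F_def mult_ac nn_integral_cmult[symmetric] nn_integral_multc[symmetric])
  also have "\<dots> = (\<integral>\<^sup>+x. \<integral>\<^sup>+t. \<integral>\<^sup>+z. F t x z * indicator {0..1} t \<partial>lborel \<partial>lborel \<partial>lborel)"
    by (intro nn_integral_cong lborel_pair.Fubini') (simp add: F_def)
  also have "\<dots> = (\<integral>\<^sup>+t. \<integral>\<^sup>+x. \<integral>\<^sup>+z. F t x z * indicator {0..1} t \<partial>lborel \<partial>lborel \<partial>lborel)"
    by (rule lborel_pair.Fubini') (simp add: F_def)
  also have "\<dots> \<le> (\<integral>\<^sup>+t. C * emeasure lborel B * indicator {0..1} (t :: real) \<partial>lborel)"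
    using slice by (intro nn_integral_mono) (auto simp: indicator_def)
  also have "\<dots> = C * emeasure lborel B"
    by (simp add: nn_integral_cmult_indicator)
  finally show ?thesis
    by (simp add: C_def mult_ac)
qed

section \<open>The Poincare inequality\<close>

text \<open>The \<open>itself\<close> argument fixes the dimension, which the radius does not
  determine.\<close>

definition bump_mass :: "'n::finite itself \<Rightarrow> real \<Rightarrow> real" where
  "bump_mass _ d = integral\<^sup>L lborel (bump d :: real ^ 'n \<Rightarrow> real)"

lemma integrable_bump:
  assumes "d > 0"
  shows "integrable lborel (bump d :: real ^ 'n \<Rightarrow> real)"
proof (rule Bochner_Integration.integrable_bound)
  show "integrable lborel (indicator (cball (0 :: real ^ 'n) d) :: _ \<Rightarrow> real)"
    using emeasure_bounded_finite[of "cball (0 :: real ^ 'n) d"] by (intro integrable_real_indicator) auto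
  show "AE v in lborel. norm (bump d v) \<le> norm (indicator (cball (0 :: real ^ 'n) d) v :: real)"
  proof (rule AE_I2)
    fix v :: "real ^ 'n"
    show "norm (bump d v) \<le> norm (indicator (cball (0 :: real ^ 'n) d) v :: real)"
      using bump_nonzero[OF assms, of v] abs_bump_le_1[of d v] by (auto simp: indicator_def)
  qed
qed measurable

lemma nn_integral_bump: "d > 0 \<Longrightarrow> integral\<^sup>N lborel (\<lambda>v :: real ^ 'n. ennreal (bump d v)) = ennreal (bump_mass TYPE('n) d)"
  unfolding bump_mass_def by (rule nn_integral_eq_integral[OF integrable_bump]) (auto simp: bump_nonneg)

lemma bump_mass_pos:
  assumes "d > 0"
  shows "bump_mass TYPE('n::finite) d > 0"
proof -
  have "integral\<^sup>N lborel (\<lambda>v :: real ^ 'n. ennreal (bump d v)) \<noteq> 0"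
  proof
    assume "integral\<^sup>N lborel (\<lambda>v :: real ^ 'n. ennreal (bump d v)) = 0"
    then have "AE v :: real ^ 'n in lborel. ennreal (bump d v) = 0"
      by (subst (asm) nn_integral_0_iff_AE) auto
    then have "AE v :: real ^ 'n in lborel. v \<notin> ball 0 d"
      by (rule AE_mp) (use bump_pos_iff[OF assms] in \<open>auto intro!: AE_I2 simp: ennreal_eq_0_iff not_less[symmetric]\<close>)
    then have "emeasure lborel (ball (0 :: real ^ 'n) d) = 0"
      by (subst (asm) AE_iff_measurable[OF _ refl]) (auto simp: ball_def)
    then show False
      using assms content_ball_pos[of d "0 :: real ^ 'n"] by (simp add: measure_def)
  qed
  then show ?thesis
    using nn_integral_bump[OF assms, where 'n = 'n] by (metis ennreal_neg not_less)
qed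

lemma nn_integral_bump_shift:
  fixes x :: "real ^ 'n"
  assumes "d > 0"
  shows "(\<integral>\<^sup>+y. ennreal (bump d (y - x)) \<partial>lborel) = ennreal (bump_mass TYPE('n) d)"
  using nn_integral_lborel_affine[of "\<lambda>v :: real ^ 'n. ennreal (bump d v)" 1 "- x"]
    nn_integral_bump[OF assms, where 'n = 'n]
  by (simp add: add.commute)

context weak_gradient_pair
begin

text \<open>Since the mass times \<open>U x\<close> is the integral of \<open>U x\<close> against
  the bump, the error is an average of \<open>U y - U x\<close>. Keeping the mass on the left avoids
  division in \<open>ennreal\<close>.\<close>

lemma mollify_error_le:
  assumes "d > 0"
  shows "ennreal (bump_mass TYPE('n) d) * ennreal \<bar>mollify d x / bump_mass TYPE('n) d - U x\<bar>
    \<le> (\<integral>\<^sup>+y. ennreal (\<bar>U y - U x\<bar> * bump d (y - x)) \<partial>lborel)"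
proof -
  let ?m = "bump_mass TYPE('n) d"
  have m: "?m > 0" by (rule bump_mass_pos[OF assms])
  have bump: "(\<lambda>y. bump d (y - x)) \<in> borel_measurable lborel" "\<And>y. 0 \<le> bump d (y - x)"
    using bump_nonneg by auto
  have int: "integrable lborel (\<lambda>y. bump d (y - x))"
    by (rule integrableI_nn_integral_finite[OF bump(1) _ nn_integral_bump_shift[OF assms]])
      (use m bump(2) in auto)
  have "(\<integral>y. bump d (y - x) \<partial>lborel) = ?m"
    by (rule integral_eq_nn_integral[THEN trans]) (use m bump nn_integral_bump_shift[OF assms, of x] in auto)
  then have "mollify d x - ?m * U x = (\<integral>y. U y * bump d (y - x) - U x * bump d (y - x) \<partial>lborel)"
    using int integrable_U_bump by (simp add: mollify_def)
  then have eq: "?m * (mollify d x / ?m - U x) = (\<integral>y. (U y - U x) * bump d (y - x) \<partial>lborel)"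
    using m by (simp add: field_simps)
  have "integrable lborel (\<lambda>y. (U y - U x) * bump d (y - x))"
    using int integrable_U_bump by (simp add: left_diff_distrib)
  from integral_norm_bound_ennreal[OF this]
  have "ennreal \<bar>?m * (mollify d x / ?m - U x)\<bar> \<le> (\<integral>\<^sup>+y. ennreal (\<bar>U y - U x\<bar> * bump d (y - x)) \<partial>lborel)"
    unfolding eq by (simp add: abs_mult bump_nonneg)
  then show ?thesis
    using m by (simp add: abs_mult ennreal_mult)
qed

text \<open>A continuous h close to \<open>U\<close> in L^1 splits the error into thirds: the
  uniform continuity of h near \<open>B\<close>, the distance from \<open>U\<close> to h itself, and
  the same distance averaged by the bump.\<close>

lemma mollify_tendsto_L1:
  assumes B[measurable]: "B \<in> sets borel" and "bounded B" and "e > 0"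
  shows "\<exists>d0>0. \<forall>d. 0 < d \<and> d < d0 \<longrightarrow>
    (\<integral>\<^sup>+x\<in>B. ennreal \<bar>mollify d x / bump_mass TYPE('n) d - U x\<bar> \<partial>lborel) \<le> ennreal e"
proof -
  obtain h where h: "continuous_on UNIV h" "(\<integral>\<^sup>+x. ennreal \<bar>U x - h x\<bar> \<partial>lborel) \<le> ennreal (e / 3)"
    using integrable_approx_continuous[OF integrable_U, of "e / 3"] \<open>e > 0\<close> by auto
  have [measurable]: "h \<in> borel_measurable borel"
    using h by (auto intro: borel_measurable_continuous_onI)
  obtain R where R: "\<And>x. x \<in> B \<Longrightarrow> norm x \<le> R"
    using \<open>bounded B\<close> unfolding bounded_iff by blast
  define b where "b = measure lborel B"
  have B_fin: "emeasure lborel B = ennreal b"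
    unfolding b_def using emeasure_bounded_finite[OF \<open>bounded B\<close>] by (simp add: emeasure_eq_ennreal_measure)
  have b: "b \<ge> 0" by (simp add: b_def)
  define \<eta> where "\<eta> = e / (3 * (b + 1))"
  have \<eta>: "\<eta> > 0" "\<eta> * b \<le> e / 3"
    using \<open>e > 0\<close> b by (auto simp: \<eta>_def field_simps)
  \<comment> \<open>The extra 1 makes room for the bump: for d < 1 all points within d of
    \<open>B\<close> stay in this ball.\<close>
  have "uniformly_continuous_on (cball 0 (R + 1)) h"
    using h(1) by (intro compact_uniformly_continuous) (auto intro: continuous_on_subset)
  then obtain \<delta> where \<delta>: "\<delta> > 0"
    "\<And>x y. norm x \<le> R + 1 \<Longrightarrow> norm y \<le> R + 1 \<Longrightarrow> dist y x < \<delta> \<Longrightarrow> dist (h y) (h x) < \<eta>"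
    unfolding uniformly_continuous_on_def using \<eta>(1) by (metis mem_cball_0)
  have "(\<integral>\<^sup>+x\<in>B. ennreal \<bar>mollify d x / bump_mass TYPE('n) d - U x\<bar> \<partial>lborel) \<le> ennreal e"
    if d: "0 < d" "d < min 1 \<delta>" for d
  proof -
    let ?m = "bump_mass TYPE('n) d"
    have m: "?m > 0" by (rule bump_mass_pos[OF d(1)])
    have pt: "ennreal ?m * ennreal \<bar>mollify d x / ?m - U x\<bar>
        \<le> (\<integral>\<^sup>+y. ennreal \<bar>U y - h y\<bar> * ennreal (bump d (y - x)) \<partial>lborel) + (ennreal \<eta> + ennreal \<bar>U x - h x\<bar>) * ennreal ?m"
      if x: "x \<in> B" for x
    proof -
      have "ennreal ?m * ennreal \<bar>mollify d x / ?m - U x\<bar>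
          \<le> (\<integral>\<^sup>+y. ennreal (\<bar>U y - U x\<bar> * bump d (y - x)) \<partial>lborel)"
        by (rule mollify_error_le[OF d(1)])
      also have "\<dots> \<le> (\<integral>\<^sup>+y. ennreal \<bar>U y - h y\<bar> * ennreal (bump d (y - x))
          + (ennreal \<eta> + ennreal \<bar>U x - h x\<bar>) * ennreal (bump d (y - x)) \<partial>lborel)"
      proof (rule nn_integral_mono)
        fix y
        show "ennreal (\<bar>U y - U x\<bar> * bump d (y - x)) \<le> ennreal \<bar>U y - h y\<bar> * ennreal (bump d (y - x))
          + (ennreal \<eta> + ennreal \<bar>U x - h x\<bar>) * ennreal (bump d (y - x))"
        proof (cases "norm (y - x) < d")
          case True
          then have "norm y \<le> R + 1"
            using norm_triangle_sub[of y x] R[OF x] d by linarith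
          with True have "\<bar>h y - h x\<bar> < \<eta>"
            using \<delta>(2)[of x y] R[OF x] d by (simp add: dist_norm)
          then have "\<bar>U y - U x\<bar> \<le> \<bar>U y - h y\<bar> + (\<eta> + \<bar>U x - h x\<bar>)"
            by linarith
          from mult_right_mono[OF this bump_nonneg[of d "y - x"]]
          show ?thesis
            using \<eta>(1) bump_nonneg[of d "y - x"]
            by (simp add: ennreal_leI flip: ennreal_plus ennreal_mult distrib_right)
        next
          case False
          then have "bump d (y - x) = 0"
            using bump_nonzero[OF d(1)] by blast
          then show ?thesis by simp
        qed
      qed
      also have "\<dots> = (\<integral>\<^sup>+y. ennreal \<bar>U y - h y\<bar> * ennreal (bump d (y - x)) \<partial>lborel)
          + (ennreal \<eta> + ennreal \<bar>U x - h x\<bar>) * ennreal ?m"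
        by (simp add: nn_integral_add nn_integral_cmult nn_integral_bump_shift[OF d(1)])
      finally show ?thesis .
    qed
    have "ennreal ?m * (\<integral>\<^sup>+x\<in>B. ennreal \<bar>mollify d x / ?m - U x\<bar> \<partial>lborel)
        = (\<integral>\<^sup>+x\<in>B. ennreal ?m * ennreal \<bar>mollify d x / ?m - U x\<bar> \<partial>lborel)"
      by (subst nn_integral_cmult[symmetric]) (auto simp: mult_ac)
    also have "\<dots> \<le> (\<integral>\<^sup>+x. (\<integral>\<^sup>+y. ennreal \<bar>U y - h y\<bar> * ennreal (bump d (y - x)) \<partial>lborel)
        + (ennreal (\<eta> * ?m) * indicator B x + ennreal ?m * ennreal \<bar>U x - h x\<bar>) \<partial>lborel)"
    proof (rule nn_integral_mono)
      fix x
      show "ennreal ?m * ennreal \<bar>mollify d x / ?m - U x\<bar> * indicator B x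
        \<le> (\<integral>\<^sup>+y. ennreal \<bar>U y - h y\<bar> * ennreal (bump d (y - x)) \<partial>lborel)
        + (ennreal (\<eta> * ?m) * indicator B x + ennreal ?m * ennreal \<bar>U x - h x\<bar>)"
        using pt[of x] \<eta>(1) m by (cases "x \<in> B") (auto simp: ennreal_mult distrib_left mult_ac)
    qed
    also have "\<dots> = (\<integral>\<^sup>+x. \<integral>\<^sup>+y. ennreal \<bar>U y - h y\<bar> * ennreal (bump d (y - x)) \<partial>lborel \<partial>lborel)
        + (ennreal (\<eta> * ?m) * ennreal b + ennreal ?m * (\<integral>\<^sup>+x. ennreal \<bar>U x - h x\<bar> \<partial>lborel))"
      by (simp add: nn_integral_add nn_integral_cmult B_fin)
    \<comment> \<open>By Tonelli's theorem and the evenness of the bump, integrating in x first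
      replaces the kernel by its mass.\<close>
    also have "(\<integral>\<^sup>+x. \<integral>\<^sup>+y. ennreal \<bar>U y - h y\<bar> * ennreal (bump d (y - x)) \<partial>lborel \<partial>lborel)
        = (\<integral>\<^sup>+y. \<integral>\<^sup>+x. ennreal \<bar>U y - h y\<bar> * ennreal (bump d (x - y)) \<partial>lborel \<partial>lborel)"
      by (subst lborel_pair.Fubini') (simp_all add: bump_minus_commute[of d _ "_ :: real ^ 'n", symmetric])
    also have "\<dots> = ennreal ?m * (\<integral>\<^sup>+y. ennreal \<bar>U y - h y\<bar> \<partial>lborel)"
      by (simp add: nn_integral_cmult nn_integral_bump_shift[OF d(1)] nn_integral_multc mult.commute)
    also have "ennreal ?m * (\<integral>\<^sup>+y. ennreal \<bar>U y - h y\<bar> \<partial>lborel)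
        + (ennreal (\<eta> * ?m) * ennreal b + ennreal ?m * (\<integral>\<^sup>+x. ennreal \<bar>U x - h x\<bar> \<partial>lborel))
        \<le> ennreal ?m * ennreal (e / 3) + (ennreal ?m * ennreal (e / 3) + ennreal ?m * ennreal (e / 3))"
    proof (intro add_mono mult_left_mono h)
      have "\<eta> * ?m * b \<le> ?m * (e / 3)"
        using mult_left_mono[OF \<eta>(2), of ?m] m by (simp add: mult_ac)
      then show "ennreal (\<eta> * ?m) * ennreal b \<le> ennreal ?m * ennreal (e / 3)"
        using \<eta>(1) m b \<open>e > 0\<close> by (simp add: ennreal_leI flip: ennreal_mult)
    qed auto
    also have "\<dots> = ennreal ?m * ennreal e"
      using \<open>e > 0\<close> m by (simp flip: distrib_left ennreal_plus)
    finally show ?thesis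
      using m by (subst (asm) ennreal_mult_le_mult_iff) auto
  qed
  then show ?thesis
    using \<delta>(1) by (intro exI[of _ "min 1 \<delta>"]) auto
qed

text \<open>The L^1 bound for convolutions in local form: Tonelli's theorem integrates x out, and
  from points of \<open>B\<close> the bump reaches only points of \<open>B'\<close>.\<close>

lemma nn_integral_mollified_gradient_le:
  assumes [measurable]: "B \<in> sets borel" "B' \<in> sets borel" and d: "d > 0"
    and nbhd: "\<And>x. x \<in> B \<Longrightarrow> ball x d \<subseteq> B'"
  shows "(\<integral>\<^sup>+x\<in>B. mollified_gradient d x \<partial>lborel)
    \<le> ennreal (bump_mass TYPE('n) d) * (\<integral>\<^sup>+y\<in>B'. ennreal (norm (V y)) \<partial>lborel)"
proof -
  have "(\<integral>\<^sup>+x\<in>B. mollified_gradient d x \<partial>lborel)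
      = (\<integral>\<^sup>+x. \<integral>\<^sup>+y. ennreal (norm (V y) * bump d (y - x)) * indicator B x \<partial>lborel \<partial>lborel)"
    unfolding mollified_gradient_def by (simp add: nn_integral_multc)
  also have "\<dots> = (\<integral>\<^sup>+y. \<integral>\<^sup>+x. ennreal (norm (V y) * bump d (y - x)) * indicator B x \<partial>lborel \<partial>lborel)"
    by (rule lborel_pair.Fubini') measurable
  also have "\<dots> \<le> (\<integral>\<^sup>+y. \<integral>\<^sup>+x. (ennreal (norm (V y)) * indicator B' y) * ennreal (bump d (x - y)) \<partial>lborel \<partial>lborel)"
  proof (intro nn_integral_mono)
    fix x y :: "real ^ 'n"
    show "ennreal (norm (V y) * bump d (y - x)) * indicator B x
        \<le> (ennreal (norm (V y)) * indicator B' y) * ennreal (bump d (x - y))"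
    proof (cases "x \<in> B \<and> norm (y - x) < d")
      case True
      then have "y \<in> B'"
        using nbhd[of x] by (auto simp: dist_norm norm_minus_commute)
      then show ?thesis
        using True by (simp add: ennreal_mult bump_nonneg bump_minus_commute[of d y x])
    next
      case False
      then show ?thesis
        using bump_nonzero[OF d, of "y - x"] by auto
    qed
  qed
  also have "\<dots> = ennreal (bump_mass TYPE('n) d) * (\<integral>\<^sup>+y\<in>B'. ennreal (norm (V y)) \<partial>lborel)"
    by (simp add: nn_integral_cmult nn_integral_bump_shift[OF d] nn_integral_multc mult.commute)
  finally show ?thesis .
qed

text \<open>The segment bound is integrated over all pairs of points of \<open>B\<close>, and
  \<open>nn_integral_convex_segments_le\<close> removes the segments at the cost of a factor
  \<open>emeasure lborel B\<close>. The mass cancels, so the constant does not depend on the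
  mollification radius.\<close>

lemma mollify_poincare:
  assumes [measurable]: "B \<in> sets borel" "B' \<in> sets borel" and B: "convex B"
    and D: "\<And>x z. x \<in> B \<Longrightarrow> z \<in> B \<Longrightarrow> norm (x - z) \<le> D"
    and d: "d > 0" "\<And>x. x \<in> B \<Longrightarrow> cball x d \<subseteq> B'" and W: "B' \<subseteq> W"
  shows "(\<integral>\<^sup>+x\<in>B. \<integral>\<^sup>+z\<in>B. ennreal \<bar>mollify d x / bump_mass TYPE('n) d - mollify d z / bump_mass TYPE('n) d\<bar> \<partial>lborel \<partial>lborel)
    \<le> ennreal D * (2 ^ CARD('n) * emeasure lborel B) * (\<integral>\<^sup>+y\<in>B'. ennreal (norm (V y)) \<partial>lborel)"
proof -
  let ?m = "bump_mass TYPE('n) d"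
  have m: "?m > 0" by (rule bump_mass_pos[OF d(1)])
  define J where "J = (\<integral>\<^sup>+x\<in>B. \<integral>\<^sup>+z\<in>B. \<integral>\<^sup>+t\<in>{0..1}. mollified_gradient d (z + t *\<^sub>R (x - z)) \<partial>lborel \<partial>lborel \<partial>lborel)"
  have "ennreal ?m * (\<integral>\<^sup>+x\<in>B. \<integral>\<^sup>+z\<in>B. ennreal \<bar>mollify d x / ?m - mollify d z / ?m\<bar> \<partial>lborel \<partial>lborel)
      = (\<integral>\<^sup>+x. \<integral>\<^sup>+z. ennreal \<bar>mollify d x - mollify d z\<bar> * indicator B z * indicator B x \<partial>lborel \<partial>lborel)"
  proof -
    have "ennreal ?m * ennreal \<bar>mollify d x / ?m - mollify d z / ?m\<bar> = ennreal \<bar>mollify d x - mollify d z\<bar>" for x z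
      using m by (simp add: field_simps flip: ennreal_mult diff_divide_distrib)
    then show ?thesis
      by (simp add: nn_integral_cmult[symmetric] nn_integral_multc[symmetric] mult.assoc[symmetric])
  qed
  also have "\<dots> \<le> (\<integral>\<^sup>+x. \<integral>\<^sup>+z. ennreal D * ((\<integral>\<^sup>+t\<in>{0..1}. mollified_gradient d (z + t *\<^sub>R (x - z)) \<partial>lborel) * indicator B z * indicator B x) \<partial>lborel \<partial>lborel)"
  proof (intro nn_integral_mono)
    fix x z
    show "ennreal \<bar>mollify d x - mollify d z\<bar> * indicator B z * indicator B x
      \<le> ennreal D * ((\<integral>\<^sup>+t\<in>{0..1}. mollified_gradient d (z + t *\<^sub>R (x - z)) \<partial>lborel) * indicator B z * indicator B x)"
    proof (cases "x \<in> B \<and> z \<in> B")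
      case True
      have "z + t *\<^sub>R (x - z) \<in> B" if "0 \<le> t" "t \<le> 1" for t
      proof -
        have "z + t *\<^sub>R (x - z) = (1 - t) *\<^sub>R z + t *\<^sub>R x"
          by (simp add: algebra_simps)
        then show ?thesis
          using True that B by (auto intro: convexD)
      qed
      then have "ennreal \<bar>mollify d x - mollify d z\<bar>
          \<le> ennreal (norm (x - z)) * (\<integral>\<^sup>+t\<in>{0..1}. mollified_gradient d (z + t *\<^sub>R (x - z)) \<partial>lborel)"
        using d W by (intro mollify_diff_le) auto
      also have "\<dots> \<le> ennreal D * (\<integral>\<^sup>+t\<in>{0..1}. mollified_gradient d (z + t *\<^sub>R (x - z)) \<partial>lborel)"
        using True D by (intro mult_right_mono ennreal_leI) auto
      finally show ?thesis
        using True by simp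
    qed auto
  qed
  also have "\<dots> = ennreal D * J"
    unfolding J_def by (simp add: nn_integral_cmult nn_integral_multc)
  also have "\<dots> \<le> ennreal D * (2 ^ CARD('n) * emeasure lborel B * (ennreal ?m * (\<integral>\<^sup>+y\<in>B'. ennreal (norm (V y)) \<partial>lborel)))"
  proof (intro mult_left_mono)
    have "J \<le> 2 ^ CARD('n) * emeasure lborel B * (\<integral>\<^sup>+x\<in>B. mollified_gradient d x \<partial>lborel)"
      unfolding J_def using nn_integral_convex_segments_le[of "mollified_gradient d" B] B by simp
    also have "\<dots> \<le> 2 ^ CARD('n) * emeasure lborel B * (ennreal ?m * (\<integral>\<^sup>+y\<in>B'. ennreal (norm (V y)) \<partial>lborel))"
      using d by (intro mult_left_mono nn_integral_mollified_gradient_le) force+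
    finally show "J \<le> \<dots>" .
  qed simp
  finally have "ennreal ?m * (\<integral>\<^sup>+x\<in>B. \<integral>\<^sup>+z\<in>B. ennreal \<bar>mollify d x / ?m - mollify d z / ?m\<bar> \<partial>lborel \<partial>lborel)
    \<le> ennreal ?m * (ennreal D * (2 ^ CARD('n) * emeasure lborel B) * (\<integral>\<^sup>+y\<in>B'. ennreal (norm (V y)) \<partial>lborel))"
    by (simp add: mult_ac)
  then show ?thesis
    using m by (subst (asm) ennreal_mult_le_mult_iff) auto
qed

text \<open>Passage to the limit in \<open>mollify_poincare\<close>: replacing \<open>U\<close> by
  its normalised mollification costs \<open>\<eta> * b\<close> in each of the two variables, at most
  e in total.\<close>

lemma poincare_inequality:
  assumes [measurable]: "B \<in> sets borel" "B' \<in> sets borel" and B: "convex B" "bounded B"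
    and D: "\<And>x z. x \<in> B \<Longrightarrow> z \<in> B \<Longrightarrow> norm (x - z) \<le> D"
    and d: "d > 0" "\<And>x. x \<in> B \<Longrightarrow> cball x d \<subseteq> B'" and W: "B' \<subseteq> W"
  shows "(\<integral>\<^sup>+x\<in>B. \<integral>\<^sup>+z\<in>B. ennreal \<bar>U x - U z\<bar> \<partial>lborel \<partial>lborel)
    \<le> ennreal D * (2 ^ CARD('n) * emeasure lborel B) * (\<integral>\<^sup>+y\<in>B'. ennreal (norm (V y)) \<partial>lborel)"
proof (rule ennreal_le_epsilon)
  fix e :: real assume "e > 0"
  define b where "b = measure lborel B"
  have B_fin: "emeasure lborel B = ennreal b"
    unfolding b_def using emeasure_bounded_finite[OF \<open>bounded B\<close>] by (simp add: emeasure_eq_ennreal_measure)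
  have b: "b \<ge> 0" by (simp add: b_def)
  define \<eta> where "\<eta> = e / (2 * (b + 1))"
  have \<eta>: "\<eta> > 0" "2 * (\<eta> * b) \<le> e"
    using \<open>e > 0\<close> b by (auto simp: \<eta>_def field_simps)
  obtain d0 where d0: "d0 > 0" "\<And>d. 0 < d \<Longrightarrow> d < d0 \<Longrightarrow>
      (\<integral>\<^sup>+x\<in>B. ennreal \<bar>mollify d x / bump_mass TYPE('n) d - U x\<bar> \<partial>lborel) \<le> ennreal \<eta>"
    using mollify_tendsto_L1[OF assms(1) B(2) \<eta>(1)] by blast
  \<comment> \<open>The radius must respect both the margin d between \<open>B\<close> and
    \<open>B'\<close> and the accuracy guaranteed below d0.\<close>
  define d' where "d' = min d (d0 / 2)"
  have d': "0 < d'" "d' < d0" "d' \<le> d"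
    using d d0 by (auto simp: d'_def)
  define S where "S x = mollify d' x / bump_mass TYPE('n) d'" for x
  have [measurable]: "S \<in> borel_measurable borel"
    unfolding S_def by measurable
  have err: "(\<integral>\<^sup>+x\<in>B. ennreal \<bar>S x - U x\<bar> \<partial>lborel) \<le> ennreal \<eta>"
    unfolding S_def by (rule d0(2)[OF d'(1,2)])
  have "(\<integral>\<^sup>+x\<in>B. \<integral>\<^sup>+z\<in>B. ennreal \<bar>U x - U z\<bar> \<partial>lborel \<partial>lborel)
    \<le> (\<integral>\<^sup>+x. \<integral>\<^sup>+z. (ennreal \<bar>S x - S z\<bar> * indicator B z * indicator B x
       + (ennreal \<bar>S x - U x\<bar> * indicator B x * indicator B z + ennreal \<bar>S z - U z\<bar> * indicator B z * indicator B x)) \<partial>lborel \<partial>lborel)"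
  proof (subst nn_integral_multc[symmetric], measurable, intro nn_integral_mono)
    fix x z
    have "\<bar>U x - U z\<bar> \<le> \<bar>S x - S z\<bar> + (\<bar>S x - U x\<bar> + \<bar>S z - U z\<bar>)"
      by linarith
    then show "ennreal \<bar>U x - U z\<bar> * indicator B z * indicator B x
        \<le> ennreal \<bar>S x - S z\<bar> * indicator B z * indicator B x
       + (ennreal \<bar>S x - U x\<bar> * indicator B x * indicator B z + ennreal \<bar>S z - U z\<bar> * indicator B z * indicator B x)"
      by (auto simp: indicator_def ennreal_leI simp flip: ennreal_plus)
  qed
  also have "\<dots> = (\<integral>\<^sup>+x\<in>B. \<integral>\<^sup>+z\<in>B. ennreal \<bar>S x - S z\<bar> \<partial>lborel \<partial>lborel)
      + ((\<integral>\<^sup>+x\<in>B. ennreal \<bar>S x - U x\<bar> \<partial>lborel) * ennreal b + (\<integral>\<^sup>+z\<in>B. ennreal \<bar>S z - U z\<bar> \<partial>lborel) * ennreal b)"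
    by (simp add: nn_integral_add nn_integral_multc nn_integral_cmult B_fin)
  also have "\<dots> \<le> ennreal D * (2 ^ CARD('n) * emeasure lborel B) * (\<integral>\<^sup>+y\<in>B'. ennreal (norm (V y)) \<partial>lborel)
      + (ennreal \<eta> * ennreal b + ennreal \<eta> * ennreal b)"
  proof (intro add_mono mult_right_mono err)
    show "(\<integral>\<^sup>+x\<in>B. \<integral>\<^sup>+z\<in>B. ennreal \<bar>S x - S z\<bar> \<partial>lborel \<partial>lborel)
        \<le> ennreal D * (2 ^ CARD('n) * emeasure lborel B) * (\<integral>\<^sup>+y\<in>B'. ennreal (norm (V y)) \<partial>lborel)"
      unfolding S_def
    proof (rule mollify_poincare)
      show "cball x d' \<subseteq> B'" if "x \<in> B" for x
        using d(2)[OF that] d'(3) by auto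
    qed (use assms d' in auto)
  qed auto
  also have "ennreal \<eta> * ennreal b + ennreal \<eta> * ennreal b \<le> ennreal e"
    using \<eta> b by (simp add: ennreal_leI flip: ennreal_mult ennreal_plus)
  finally show "(\<integral>\<^sup>+x\<in>B. \<integral>\<^sup>+z\<in>B. ennreal \<bar>U x - U z\<bar> \<partial>lborel \<partial>lborel)
    \<le> ennreal D * (2 ^ CARD('n) * emeasure lborel B) * (\<integral>\<^sup>+y\<in>B'. ennreal (norm (V y)) \<partial>lborel) + ennreal e"
    by (simp add: add_left_mono)
qed

end

section \<open>Weak Lebesgue spaces and Hausdorff content\<close>

lemma weak_L_norm_tail:
  fixes G :: "real ^ 'n \<Rightarrow> 'b::real_normed_vector"
  assumes "weak_L_norm p \<Omega> G \<le> ennreal A" "p > 0" "A \<ge> 0" "t > 0"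
  shows "emeasure lebesgue {x \<in> \<Omega>. norm (G x) > t} \<le> ennreal ((A / t) powr p)"
proof -
  define m where "m = emeasure lebesgue {x \<in> \<Omega>. norm (G x) > t}"
  have "ennreal t * ennreal_powr m (1 / p) \<le> weak_L_norm p \<Omega> G"
    unfolding weak_L_norm_def m_def using \<open>t > 0\<close> by (intro SUP_upper) auto
  with assms(1) have le: "ennreal t * ennreal_powr m (1 / p) \<le> ennreal A"
    by (rule order.trans[rotated])
  show ?thesis
  proof (cases "m = top")
    case True
    then show ?thesis
      using le \<open>t > 0\<close> by (simp add: ennreal_powr_def ennreal_mult_top top_unique)
  next
    case False
    then obtain s where s: "m = ennreal s" "s \<ge> 0"
      by (cases m) auto
    then have "t * s powr (1 / p) \<le> A"
      using le assms by (simp add: ennreal_powr_def flip: ennreal_mult)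
    then have "s powr (1 / p) \<le> A / t"
      using \<open>t > 0\<close> by (simp add: field_simps)
    then have "(s powr (1 / p)) powr p \<le> (A / t) powr p"
      using \<open>p > 0\<close> by (intro powr_mono2) auto
    then have "s \<le> (A / t) powr p"
      using s \<open>p > 0\<close> by (simp add: powr_powr)
    then show ?thesis
      using s by (simp add: m_def[symmetric] ennreal_leI)
  qed
qed

text \<open>A discrete layer-cake bound: a value above T lies in one dyadic layer, found through the
  least k with \<open>s \<le> 2 ^ k * T\<close>. It reduces integrals of powers to measures of
  superlevel sets.\<close>

lemma powr_le_dyadic_sum:
  fixes s T p :: real
  assumes "T > 0" "s \<ge> 0" "p > 0"
  shows "ennreal (s powr p) \<le> ennreal (T powr p) + (\<Sum>k. ennreal ((2 ^ Suc k * T) powr p) * indicator {2 ^ k * T<..} s)"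
proof (cases "s \<le> T")
  case True
  then have "ennreal (s powr p) \<le> ennreal (T powr p)"
    using assms by (intro ennreal_leI powr_mono2) auto
  then show ?thesis
    by (rule order.trans) simp
next
  case False
  obtain n where "s / T < 2 ^ n"
    using real_arch_pow[of 2 "s / T"] by auto
  then have ex: "s \<le> 2 ^ n * T"
    using assms by (simp add: field_simps)
  define k where "k = (LEAST k. s \<le> 2 ^ k * T)"
  have k: "s \<le> 2 ^ k * T"
    unfolding k_def by (rule LeastI, rule ex)
  then obtain j where j: "k = Suc j"
    using False by (cases k) auto
  have "\<not> s \<le> 2 ^ j * T"
    using not_less_Least[of j "\<lambda>k. s \<le> 2 ^ k * T"] j by (simp add: k_def)
  then have "ennreal (s powr p) \<le> ennreal ((2 ^ Suc j * T) powr p) * indicator {2 ^ j * T<..} s"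
    using k j assms by (auto intro!: ennreal_leI powr_mono2)
  also have "\<dots> \<le> (\<Sum>k. ennreal ((2 ^ Suc k * T) powr p) * indicator {2 ^ k * T<..} s)"
  proof -
    define F :: "nat \<Rightarrow> ennreal" where "F k = ennreal ((2 ^ Suc k * T) powr p) * indicator {2 ^ k * T<..} s" for k
    have "sum F {j} \<le> suminf F"
      by (rule sum_le_suminf) auto
    also have "sum F {j} = F j"
      by simp
    finally show ?thesis
      by (simp only: F_def)
  qed
  finally show ?thesis
    by (rule order.trans) simp
qed

text \<open>The embedding of weak L^q into L^p on sets of finite measure. Below the level T the
  measure of \<open>S\<close> is used, above it the tail bound; the layers form a geometric series
  of ratio \<open>2 powr (p - q)\<close>, which converges because p < q.\<close>

lemma weak_Lp_bound:
  fixes f :: "'a::euclidean_space \<Rightarrow> real"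
  assumes [measurable]: "f \<in> borel_measurable borel" "S \<in> sets borel" and f: "\<And>x. f x \<ge> 0"
    and A: "A > 0" and p: "0 < p" "p < q" and r: "r > 0" and \<kappa>: "\<kappa> \<ge> 0"
    and tail: "\<And>t. t > 0 \<Longrightarrow> emeasure lborel {x. f x > t} \<le> ennreal ((A / t) powr q)"
    and S: "emeasure lborel S \<le> ennreal (\<kappa> * r powr q)"
  shows "(\<integral>\<^sup>+x\<in>S. ennreal (f x powr p) \<partial>lborel)
    \<le> ennreal ((\<kappa> + 2 powr p / (1 - 2 powr (p - q))) * (A powr p * r powr (q - p)))"
proof -
  \<comment> \<open>This level balances the two parts: both become multiples of
    \<open>A powr p * r powr (q - p)\<close>.\<close>
  define T where "T = A / r"
  have T: "T > 0" using A r by (simp add: T_def)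
  define c where "c k = (2 ^ Suc k * T) powr p" for k
  define \<rho> :: real where "\<rho> = 2 powr (p - q)"
  have \<rho>: "0 < \<rho>" "\<rho> < 1"
    using p by (auto simp: \<rho>_def powr_less_one)
  define D where "D = 2 powr p * (A powr p * r powr (q - p))"
  have D: "D \<ge> 0" by (simp add: D_def)
  have Tq: "T powr p * r powr q = A powr p * r powr (q - p)"
    using A r by (simp add: T_def powr_divide powr_diff)
  have coef: "c k * (A / (2 ^ k * T)) powr q = D * \<rho> ^ k" for k
  proof -
    have "c k = 2 powr p * (2 ^ k) powr p * T powr p"
      using T by (simp add: c_def powr_mult)
    moreover have "(A / (2 ^ k * T)) powr q = r powr q / (2 ^ k) powr q"
      using A r by (simp add: T_def powr_divide)
    moreover have "\<rho> ^ k = (2 ^ k) powr p / (2 ^ k) powr q"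
      by (simp add: \<rho>_def powr_power powr_powr powr_diff[symmetric] right_diff_distrib
          mult.commute[of _ "real k"] flip: powr_realpow)
    ultimately have "c k * (A / (2 ^ k * T)) powr q = 2 powr p * \<rho> ^ k * (T powr p * r powr q)"
      by simp
    then show ?thesis
      by (simp add: Tq D_def)
  qed
  have "(\<integral>\<^sup>+x\<in>S. ennreal (f x powr p) \<partial>lborel)
      \<le> (\<integral>\<^sup>+x. ennreal (T powr p) * indicator S x + (\<Sum>k. ennreal (c k) * indicator {x. f x > 2 ^ k * T} x) \<partial>lborel)"
  proof (rule nn_integral_mono)
    fix x
    show "ennreal (f x powr p) * indicator S x
      \<le> ennreal (T powr p) * indicator S x + (\<Sum>k. ennreal (c k) * indicator {x. f x > 2 ^ k * T} x)"
      using powr_le_dyadic_sum[OF T f p(1), of x] by (cases "x \<in> S") (auto simp: c_def indicator_def)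
  qed
  also have "\<dots> = ennreal (T powr p) * emeasure lborel S + (\<Sum>k. ennreal (c k) * emeasure lborel {x. f x > 2 ^ k * T})"
    by (simp add: nn_integral_add nn_integral_suminf nn_integral_cmult_indicator)
  also have "\<dots> \<le> ennreal (T powr p) * ennreal (\<kappa> * r powr q) + (\<Sum>k. ennreal (D * \<rho> ^ k))"
  proof (intro add_mono mult_left_mono S suminf_le)
    fix k
    have "ennreal (c k) * emeasure lborel {x. f x > 2 ^ k * T} \<le> ennreal (c k) * ennreal ((A / (2 ^ k * T)) powr q)"
      using T by (intro mult_left_mono tail) auto
    also have "\<dots> = ennreal (D * \<rho> ^ k)"
      by (simp add: coef[symmetric] ennreal_mult c_def)
    finally show "ennreal (c k) * emeasure lborel {x. f x > 2 ^ k * T} \<le> ennreal (D * \<rho> ^ k)" .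
  qed auto
  also have "(\<Sum>k. ennreal (D * \<rho> ^ k)) = ennreal (D / (1 - \<rho>))"
    using \<rho> D by (subst suminf_ennreal2)
      (auto intro!: summable_mult summable_geometric simp: suminf_mult suminf_geometric)
  also have "ennreal (T powr p) * ennreal (\<kappa> * r powr q) + ennreal (D / (1 - \<rho>))
      = ennreal (\<kappa> * (T powr p * r powr q) + D / (1 - \<rho>))"
    using \<kappa> D \<rho> by (simp add: mult_ac flip: ennreal_mult ennreal_plus)
  also have "\<kappa> * (T powr p * r powr q) + D / (1 - \<rho>) = (\<kappa> + 2 powr p / (1 - \<rho>)) * (A powr p * r powr (q - p))"
    unfolding Tq D_def by (simp add: distrib_right)
  finally show ?thesis
    by (simp add: \<rho>_def)
qed

text \<open>Hoelder's inequality read as a lower bound. With \<open>s = \<tau> / (2 * m)\<close>,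
  the points where f is at most s account for at most \<open>\<tau> / 2\<close>; the others supply
  the remaining half, and there f is at most \<open>s powr (1 - p) * f x powr p\<close>.\<close>

lemma power_integral_lower_bound:
  fixes f :: "'a::euclidean_space \<Rightarrow> real"
  assumes [measurable]: "f \<in> borel_measurable borel" "S \<in> sets borel" and f: "\<And>x. f x \<ge> 0"
    and p: "p \<ge> 1" and \<tau>: "\<tau> > 0" and m: "m > 0" "emeasure lborel S \<le> ennreal m"
    and large: "ennreal \<tau> < (\<integral>\<^sup>+x\<in>S. ennreal (f x) \<partial>lborel)"
  shows "ennreal (\<tau> / 2 * (\<tau> / (2 * m)) powr (p - 1)) \<le> (\<integral>\<^sup>+x\<in>S. ennreal (f x powr p) \<partial>lborel)"
proof -
  define s where "s = \<tau> / (2 * m)"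
  have s: "s > 0" using \<tau> m by (simp add: s_def)
  define I where "I = (\<integral>\<^sup>+x\<in>S. ennreal (f x powr p) \<partial>lborel)"
  have young: "f x \<le> s + s powr (1 - p) * f x powr p" for x
  proof (cases "f x \<le> s")
    case True
    moreover have "0 \<le> s powr (1 - p) * f x powr p" by simp
    ultimately show ?thesis by linarith
  next
    case False
    then have "f x powr (1 - p) \<le> s powr (1 - p)"
      using s p by (intro powr_mono2') auto
    then have "f x powr (1 - p) * f x powr p \<le> s powr (1 - p) * f x powr p"
      by (rule mult_right_mono) simp
    moreover have "f x powr (1 - p) * f x powr p = f x"
      using False s by (simp flip: powr_add)
    ultimately show ?thesis using s by linarith
  qed
  have "(\<integral>\<^sup>+x\<in>S. ennreal (f x) \<partial>lborel)
      \<le> (\<integral>\<^sup>+x. ennreal s * indicator S x + ennreal (s powr (1 - p)) * (ennreal (f x powr p) * indicator S x) \<partial>lborel)"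
  proof (rule nn_integral_mono)
    fix x
    show "ennreal (f x) * indicator S x
      \<le> ennreal s * indicator S x + ennreal (s powr (1 - p)) * (ennreal (f x powr p) * indicator S x)"
      using young[of x] s by (auto simp: indicator_def ennreal_leI simp flip: ennreal_plus ennreal_mult)
  qed
  also have "\<dots> = ennreal s * emeasure lborel S + ennreal (s powr (1 - p)) * I"
    by (simp add: nn_integral_add nn_integral_cmult I_def nn_integral_cmult_indicator)
  also have "\<dots> \<le> ennreal s * ennreal m + ennreal (s powr (1 - p)) * I"
    using m by (intro add_mono mult_left_mono) auto
  also have "ennreal s * ennreal m = ennreal (\<tau> / 2)"
    using m s by (simp add: s_def flip: ennreal_mult)
  finally have *: "ennreal \<tau> \<le> ennreal (\<tau> / 2) + ennreal (s powr (1 - p)) * I"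
    using large by simp
  show ?thesis
  proof (cases "I = top")
    case True
    then show ?thesis by (simp add: I_def)
  next
    case False
    then obtain i where i: "I = ennreal i" "i \<ge> 0"
      by (cases I) auto
    then have "\<tau> \<le> \<tau> / 2 + s powr (1 - p) * i"
      using * \<tau> by (simp flip: ennreal_mult ennreal_plus)
    then have "\<tau> / 2 * s powr (p - 1) \<le> s powr (1 - p) * i * s powr (p - 1)"
      by (intro mult_right_mono) auto
    also have "\<dots> = i"
      using s by (simp add: mult.commute mult.left_commute flip: powr_add)
    finally show ?thesis
      using i by (simp add: I_def[symmetric] s_def ennreal_leI)
  qed
qed

section \<open>Covers and a density criterion for Hausdorff content\<close>

lemma hausdorff_content_mono: "E \<subseteq> F \<Longrightarrow> hausdorff_content \<beta> E \<le> hausdorff_content \<beta> F"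
  unfolding hausdorff_content_def by (rule INF_superset_mono) auto

text \<open>The cover is reindexed by natural numbers; indices outside the range of
  \<open>to_nat_on\<close> get radius 0, hence an empty ball of cost 0.\<close>

lemma hausdorff_content_le_countable_cover:
  assumes C: "countable C" and r: "\<And>c. c \<in> C \<Longrightarrow> r c \<ge> 0" and E: "E \<subseteq> (\<Union>c\<in>C. ball (a c) (r c))"
  shows "hausdorff_content \<beta> E
    \<le> (\<Sum>i. if i \<in> to_nat_on C ` C then ennreal (unit_ball_vol \<beta> * r (from_nat_into C i) powr \<beta>) else 0)"
proof -
  define I where "I = to_nat_on C ` C"
  define x where "x i = a (from_nat_into C i)" for i
  define s where "s i = (if i \<in> I then r (from_nat_into C i) else 0)" for i
  have C_eq: "from_nat_into C (to_nat_on C c) = c" if "c \<in> C" for c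
    using C that by simp
  have "0 \<le> s i" for i
    using r C_eq by (auto simp: s_def I_def)
  moreover have "E \<subseteq> (\<Union>i. ball (x i) (s i))"
  proof
    fix y assume "y \<in> E"
    then obtain c where c: "c \<in> C" "y \<in> ball (a c) (r c)"
      using E by blast
    then have "y \<in> ball (x (to_nat_on C c)) (s (to_nat_on C c))"
      using C_eq by (simp add: x_def s_def I_def)
    then show "y \<in> (\<Union>i. ball (x i) (s i))" by blast
  qed
  ultimately have "hausdorff_content \<beta> E \<le> (\<Sum>i. ennreal (unit_ball_vol \<beta> * s i powr \<beta>))"
    unfolding hausdorff_content_def by (intro INF_lower2[of "(x, s)"]) auto
  also have "\<dots> = (\<Sum>i. if i \<in> I then ennreal (unit_ball_vol \<beta> * r (from_nat_into C i) powr \<beta>) else 0)"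
    by (intro suminf_cong) (auto simp: s_def)
  finally show ?thesis
    by (simp add: I_def)
qed

text \<open>Vitali's lemma, for which the radii must be bounded, selects disjoint balls whose
  fivefold enlargements cover \<open>E\<close>. Each selected radius is charged to the integral of g
  over its own ball, and by disjointness the charges add up to at most the whole integral.\<close>

lemma hausdorff_content_le_density:
  fixes E :: "(real ^ 'n) set"
  assumes [measurable]: "g \<in> borel_measurable borel" and \<beta>: "\<beta> \<ge> 0" and R: "\<And>x. x \<in> E \<Longrightarrow>
      \<exists>\<rho>>0. \<rho> \<le> R \<and> ennreal (\<rho> powr \<beta>) \<le> M * (\<integral>\<^sup>+y\<in>cball x \<rho>. g y \<partial>lborel)"
  shows "hausdorff_content \<beta> E \<le> ennreal (unit_ball_vol \<beta> * 5 powr \<beta>) * (M * (\<integral>\<^sup>+y. g y \<partial>lborel))"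
proof -
  obtain \<rho> where \<rho>: "\<And>x. x \<in> E \<Longrightarrow> 0 < \<rho> x \<and> \<rho> x \<le> R"
    "\<And>x. x \<in> E \<Longrightarrow> ennreal (\<rho> x powr \<beta>) \<le> M * (\<integral>\<^sup>+y\<in>cball x (\<rho> x). g y \<partial>lborel)"
    using R by metis
  obtain C where C: "countable C" "C \<subseteq> E"
    "pairwise (\<lambda>i j. disjnt (cball i (\<rho> i)) (cball j (\<rho> j))) C"
    "\<And>i. i \<in> E \<Longrightarrow> \<exists>j. j \<in> C \<and> \<not> disjnt (cball i (\<rho> i)) (cball j (\<rho> j)) \<and> cball i (\<rho> i) \<subseteq> ball j (5 * \<rho> j)"
    using Vitali_covering_lemma_cballs_balls[of E \<rho> R "\<lambda>x. x", OF \<rho>(1)] by blast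
  define I where "I = to_nat_on C ` C"
  \<comment> \<open>The empty set at the remaining indices keeps the family disjoint over all
    natural numbers.\<close>
  define D where "D i = (if i \<in> I then cball (from_nat_into C i) (\<rho> (from_nat_into C i)) else {})" for i
  have from_C: "from_nat_into C i \<in> C" "i = to_nat_on C (from_nat_into C i)" if "i \<in> I" for i
    using that C(1) by (auto simp: I_def)
  have [measurable]: "D i \<in> sets borel" for i
    by (simp add: D_def)
  have "disjoint_family D"
    unfolding disjoint_family_on_def
  proof (intro ballI impI)
    fix i j :: nat assume "i \<noteq> j"
    show "D i \<inter> D j = {}"
    proof (cases "i \<in> I \<and> j \<in> I")
      case True
      then have "from_nat_into C i \<noteq> from_nat_into C j"
        using \<open>i \<noteq> j\<close> from_C(2) by metis
      then show ?thesis
        using True from_C(1) pairwiseD[OF C(3)] by (auto simp: D_def disjnt_def)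
    qed (auto simp: D_def)
  qed
  have "E \<subseteq> (\<Union>c\<in>C. ball c (5 * \<rho> c))"
  proof
    fix x assume "x \<in> E"
    then obtain j where "j \<in> C" "cball x (\<rho> x) \<subseteq> ball j (5 * \<rho> j)"
      using C(4) by blast
    moreover have "x \<in> cball x (\<rho> x)"
      using \<rho>(1)[OF \<open>x \<in> E\<close>] by simp
    ultimately show "x \<in> (\<Union>c\<in>C. ball c (5 * \<rho> c))" by blast
  qed
  then have "hausdorff_content \<beta> E
      \<le> (\<Sum>i. if i \<in> I then ennreal (unit_ball_vol \<beta> * (5 * \<rho> (from_nat_into C i)) powr \<beta>) else 0)"
    unfolding I_def using C \<rho>(1)
    by (intro hausdorff_content_le_countable_cover[where r = "\<lambda>c. 5 * \<rho> c"]) (auto simp: less_imp_le subset_iff)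
  also have "\<dots> \<le> (\<Sum>i. ennreal (unit_ball_vol \<beta> * 5 powr \<beta>) * (M * (\<integral>\<^sup>+y\<in>D i. g y \<partial>lborel)))"
  proof (intro suminf_le)
    fix i
    show "(if i \<in> I then ennreal (unit_ball_vol \<beta> * (5 * \<rho> (from_nat_into C i)) powr \<beta>) else 0)
        \<le> ennreal (unit_ball_vol \<beta> * 5 powr \<beta>) * (M * (\<integral>\<^sup>+y\<in>D i. g y \<partial>lborel))"
    proof (cases "i \<in> I")
      case True
      define c where "c = from_nat_into C i"
      have c: "c \<in> E"
        using from_C(1)[OF True] C(2) by (auto simp: c_def)
      have "ennreal (unit_ball_vol \<beta> * (5 * \<rho> c) powr \<beta>)
          = ennreal (unit_ball_vol \<beta> * 5 powr \<beta>) * ennreal (\<rho> c powr \<beta>)"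
        using \<rho>(1)[OF c] \<beta> by (simp add: powr_mult mult.assoc flip: ennreal_mult)
      also have "\<dots> \<le> ennreal (unit_ball_vol \<beta> * 5 powr \<beta>) * (M * (\<integral>\<^sup>+y\<in>cball c (\<rho> c). g y \<partial>lborel))"
        by (intro mult_left_mono \<rho>(2)[OF c]) simp
      finally show ?thesis
        using True by (simp add: D_def c_def)
    qed simp
  qed auto
  also have "\<dots> = ennreal (unit_ball_vol \<beta> * 5 powr \<beta>) * (M * (\<Sum>i. \<integral>\<^sup>+y\<in>D i. g y \<partial>lborel))"
    by simp
  also have "(\<Sum>i. \<integral>\<^sup>+y\<in>D i. g y \<partial>lborel) = (\<integral>\<^sup>+y. g y * indicator (\<Union>i. D i) y \<partial>lborel)"
    by (subst nn_integral_suminf[symmetric]) (auto simp: suminf_indicator[OF \<open>disjoint_family D\<close>])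
  also have "\<dots> \<le> (\<integral>\<^sup>+y. g y \<partial>lborel)"
    by (intro nn_integral_mono) (auto simp: indicator_def)
  finally show ?thesis
    by (simp add: mult_left_mono)
qed

section \<open>Averages along shrinking balls\<close>

context weak_gradient_pair
begin

definition average :: "(real ^ 'n) set \<Rightarrow> real" where
  "average B = (LINT y:B|lborel. U y) / measure lborel B"

text \<open>Not divided by the measure of \<open>B\<close>, which makes it monotone in
  \<open>B\<close>.\<close>

definition oscillation :: "(real ^ 'n) set \<Rightarrow> real \<Rightarrow> real" where
  "oscillation B c = (LINT y:B|lborel. \<bar>U y - c\<bar>)"

lemma set_integrable_U [simp]: "B \<in> sets borel \<Longrightarrow> set_integrable lborel B U"
  unfolding set_integrable_def using integrable_U by (intro integrable_mult_indicator) auto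

lemma set_integrable_norm_V [simp]: "B \<in> sets borel \<Longrightarrow> set_integrable lborel B (\<lambda>y. norm (V y))"
  unfolding set_integrable_def using integrable_V by (intro integrable_mult_indicator) auto

lemma set_integrable_const_bounded:
  "B \<in> sets borel \<Longrightarrow> bounded B \<Longrightarrow> set_integrable lborel B (\<lambda>y. c :: real)"
  unfolding set_integrable_def using emeasure_bounded_finite[of B] by simp

lemma set_integrable_U_diff:
  "B \<in> sets borel \<Longrightarrow> bounded B \<Longrightarrow> set_integrable lborel B (\<lambda>y. \<bar>U y - c\<bar>)"
  by (intro set_integrable_abs set_integral_diff set_integrable_const_bounded set_integrable_U)

lemma oscillation_nonneg: "0 \<le> oscillation B c"
  unfolding oscillation_def set_lebesgue_integral_def by (rule Bochner_Integration.integral_nonneg) simp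

lemma oscillation_mono:
  assumes "B \<in> sets borel" "C \<in> sets borel" "bounded C" "B \<subseteq> C"
  shows "oscillation B c \<le> oscillation C c"
  unfolding oscillation_def set_lebesgue_integral_def
proof (rule integral_mono)
  have "bounded B" using assms bounded_subset by blast
  then show "integrable lborel (\<lambda>x. indicat_real B x *\<^sub>R \<bar>U x - c\<bar>)"
    "integrable lborel (\<lambda>x. indicat_real C x *\<^sub>R \<bar>U x - c\<bar>)"
    using set_integrable_U_diff[of B c] set_integrable_U_diff[of C c] assms by (auto simp: set_integrable_def)
qed (use assms in \<open>auto simp: indicator_def\<close>)

lemma oscillation_triangle:
  assumes "B \<in> sets borel" "bounded B"
  shows "oscillation B c \<le> oscillation B c' + measure lborel B * \<bar>c' - c\<bar>"
proof -
  have "oscillation B c \<le> (LINT y:B|lborel. \<bar>U y - c'\<bar> + \<bar>c' - c\<bar>)"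
    unfolding oscillation_def
    using assms by (intro set_integral_mono set_integral_add set_integrable_U_diff set_integrable_const_bounded) auto
  also have "\<dots> = oscillation B c' + measure lborel B * \<bar>c' - c\<bar>"
    unfolding oscillation_def using assms emeasure_bounded_finite[of B]
    by (subst set_integral_add) (auto intro: set_integrable_U_diff set_integrable_const_bounded simp: set_lebesgue_integral_def)
  finally show ?thesis .
qed

lemma average_diff_le:
  assumes B: "B \<in> sets borel" "bounded B" and pos: "measure lborel B > 0"
  shows "measure lborel B * \<bar>average B - c\<bar> \<le> oscillation B c"
proof -
  have "measure lborel B * (average B - c) = (LINT y:B|lborel. U y - c)"
    using B pos emeasure_bounded_finite[of B]
    by (subst set_integral_diff) (auto intro: set_integrable_const_bounded
        simp: average_def set_lebesgue_integral_def field_simps)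
  moreover have "\<bar>LINT y:B|lborel. U y - c\<bar> \<le> oscillation B c"
    unfolding oscillation_def set_lebesgue_integral_def
    by (rule order.trans[OF integral_abs_bound]) (simp add: abs_mult)
  ultimately show ?thesis
    using pos by (metis abs_mult abs_of_pos)
qed

text \<open>For fixed x, the integral of \<open>\<bar>U x - U z\<bar>\<close> over z dominates the
  measure of \<open>B\<close> times the distance from \<open>U x\<close> to the average. One factor
  \<open>measure lborel B\<close> therefore cancels from the pairwise inequality.\<close>

lemma poincare_average:
  assumes B[measurable]: "B \<in> sets borel" "B' \<in> sets borel" and "convex B" "bounded B" and pos: "measure lborel B > 0"
    and "D \<ge> 0" "\<And>x z. x \<in> B \<Longrightarrow> z \<in> B \<Longrightarrow> norm (x - z) \<le> D"
    and "d > 0" "\<And>x. x \<in> B \<Longrightarrow> cball x d \<subseteq> B'" and "B' \<subseteq> W"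
  shows "oscillation B (average B) \<le> D * 2 ^ CARD('n) * (LINT y:B'|lborel. norm (V y))"
proof -
  define b where "b = measure lborel B"
  have B_fin: "emeasure lborel B = ennreal b"
    unfolding b_def using emeasure_bounded_finite[OF \<open>bounded B\<close>] by (simp add: emeasure_eq_ennreal_measure)
  have b: "b > 0" using pos by (simp add: b_def)
  have pt: "ennreal b * ennreal \<bar>U x - average B\<bar> \<le> (\<integral>\<^sup>+z\<in>B. ennreal \<bar>U x - U z\<bar> \<partial>lborel)" for x
  proof -
    have "b * (U x - average B) = (LINT z:B|lborel. U x - U z)"
      using b \<open>bounded B\<close> emeasure_bounded_finite[of B]
      by (subst set_integral_diff) (auto intro: set_integrable_const_bounded
          simp: average_def set_lebesgue_integral_def b_def field_simps)
    then have "ennreal b * ennreal \<bar>U x - average B\<bar> = ennreal (norm (LINT z:B|lborel. U x - U z))"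
      using b by (metis abs_mult abs_of_pos ennreal_mult less_imp_le abs_ge_zero real_norm_def)
    also have "\<dots> \<le> (\<integral>\<^sup>+z. ennreal (norm (indicator B z *\<^sub>R (U x - U z))) \<partial>lborel)"
      unfolding set_lebesgue_integral_def
    proof (rule integral_norm_bound_ennreal)
      have "set_integrable lborel B (\<lambda>z. U x - U z)"
        using \<open>bounded B\<close> by (intro set_integral_diff set_integrable_const_bounded) auto
      then show "integrable lborel (\<lambda>z. indicat_real B z *\<^sub>R (U x - U z))"
        by (simp add: set_integrable_def)
    qed
    also have "\<dots> = (\<integral>\<^sup>+z\<in>B. ennreal \<bar>U x - U z\<bar> \<partial>lborel)"
      by (intro nn_integral_cong) (auto simp: indicator_def)
    finally show ?thesis .
  qed
  have osc: "ennreal (oscillation B (average B)) = (\<integral>\<^sup>+x\<in>B. ennreal \<bar>U x - average B\<bar> \<partial>lborel)"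
    unfolding oscillation_def set_lebesgue_integral_def
    using set_integrable_U_diff[OF B(1) \<open>bounded B\<close>, of "average B"]
    by (subst nn_integral_eq_integral[symmetric])
      (auto simp: set_integrable_def indicator_def intro!: nn_integral_cong)
  have grad: "(\<integral>\<^sup>+y\<in>B'. ennreal (norm (V y)) \<partial>lborel) = ennreal (LINT y:B'|lborel. norm (V y))"
    unfolding set_lebesgue_integral_def
    using set_integrable_norm_V[OF B(2)]
    by (subst nn_integral_eq_integral[symmetric])
      (auto simp: set_integrable_def indicator_def intro!: nn_integral_cong)
  have grad0: "0 \<le> (LINT y:B'|lborel. norm (V y))"
    unfolding set_lebesgue_integral_def by (rule Bochner_Integration.integral_nonneg) simp
  have "ennreal b * ennreal (oscillation B (average B)) = (\<integral>\<^sup>+x\<in>B. ennreal b * ennreal \<bar>U x - average B\<bar> \<partial>lborel)"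
    unfolding osc by (subst nn_integral_cmult[symmetric]) (auto simp: mult_ac)
  also have "\<dots> \<le> (\<integral>\<^sup>+x\<in>B. \<integral>\<^sup>+z\<in>B. ennreal \<bar>U x - U z\<bar> \<partial>lborel \<partial>lborel)"
    by (intro nn_integral_mono mult_right_mono pt) simp
  also have "\<dots> \<le> ennreal D * (2 ^ CARD('n) * emeasure lborel B) * (\<integral>\<^sup>+y\<in>B'. ennreal (norm (V y)) \<partial>lborel)"
    by (rule poincare_inequality) fact+
  also have "\<dots> = ennreal b * ennreal (D * 2 ^ CARD('n) * (LINT y:B'|lborel. norm (V y)))"
    using b \<open>D \<ge> 0\<close> grad0 unfolding grad B_fin
    by (simp add: mult_ac ennreal_mult flip: ennreal_power)
  finally show ?thesis
    using b \<open>D \<ge> 0\<close> grad0 by (subst (asm) ennreal_mult_le_mult_iff) (auto simp: ennreal_le_iff)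
qed

text \<open>Up to a constant, the bound of the Poincare inequality on \<open>cball x r\<close>
  divided by the volume: diameter over volume gives the power 1 - n of r. The doubled radius
  provides the margin consumed by mollification.\<close>

definition scaled_gradient :: "real \<Rightarrow> real ^ 'n \<Rightarrow> real" where
  "scaled_gradient r x = r powr (1 - real CARD('n)) * (LINT y:cball x (2 * r)|lborel. norm (V y))"

lemma scaled_gradient_nonneg: "0 \<le> scaled_gradient r x"
  unfolding scaled_gradient_def set_lebesgue_integral_def
  by (intro mult_nonneg_nonneg Bochner_Integration.integral_nonneg) simp_all

lemma measure_cball: "r \<ge> 0 \<Longrightarrow> measure lborel (cball x r) = unit_ball_vol (real CARD('n)) * r ^ CARD('n)"
  for x :: "real ^ 'n"
  using content_cball[of r x] by simp

lemma poincare_cball: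
  assumes r: "r > 0" and W: "cball x (2 * r) \<subseteq> W"
  shows "oscillation (cball x r) (average (cball x r))
    \<le> 2 ^ Suc CARD('n) / unit_ball_vol (real CARD('n)) * measure lborel (cball x r) * scaled_gradient r x"
proof -
  have "oscillation (cball x r) (average (cball x r))
      \<le> (2 * r) * 2 ^ CARD('n) * (LINT y:cball x (2 * r)|lborel. norm (V y))"
  proof (rule poincare_average)
    show "norm (y - z) \<le> 2 * r" if "y \<in> cball x r" "z \<in> cball x r" for y z
      using that norm_triangle_ineq4[of "x - z" "x - y"] by (simp add: dist_norm)
    show "cball y r \<subseteq> cball x (2 * r)" if "y \<in> cball x r" for y
    proof
      fix z assume "z \<in> cball y r"
      then show "z \<in> cball x (2 * r)"
        using that dist_triangle[of x z y] by simp
    qed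
    show "measure lborel (cball x r) > 0"
      using r by (simp add: measure_cball)
  qed (use r W in auto)
  also have "\<dots> = 2 ^ Suc CARD('n) * (r ^ CARD('n) * r powr (1 - real CARD('n))) * (LINT y:cball x (2 * r)|lborel. norm (V y))"
    using r by (simp flip: powr_realpow powr_add)
  also have "\<dots> = 2 ^ Suc CARD('n) / unit_ball_vol (real CARD('n)) * measure lborel (cball x r) * scaled_gradient r x"
  proof -
    have "unit_ball_vol (real CARD('n)) \<noteq> 0"
      using unit_ball_vol_pos[of "real CARD('n)"] by linarith
    then show ?thesis
      using r by (simp add: measure_cball scaled_gradient_def)
  qed
  finally show ?thesis .
qed

text \<open>Halving the radius divides the volume by a fixed factor, so consecutive averages differ
  by a multiple of the scaled gradient and telescope to a limit c. The mean oscillation about c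
  tends to 0 as well, which is the Lebesgue point property along dyadic radii.\<close>

lemma average_telescoping:
  assumes R: "R > 0" and W: "cball x (2 * R) \<subseteq> W"
    and sum: "summable (\<lambda>k. scaled_gradient (R / 2 ^ k) x)"
  obtains c where "(\<lambda>k. oscillation (cball x (R / 2 ^ k)) c / measure lborel (cball x (R / 2 ^ k))) \<longlonglongrightarrow> 0"
    "\<bar>c - average (cball x R)\<bar>
      \<le> 2 ^ (2 * CARD('n) + 1) / unit_ball_vol (real CARD('n)) * (\<Sum>k. scaled_gradient (R / 2 ^ k) x)"
proof -
  define r where "r k = R / 2 ^ k" for k :: nat
  define B where "B k = cball x (r k)" for k
  define a where "a k = average (B k)" for k
  define \<theta> where "\<theta> k = scaled_gradient (r k) x" for k
  define C where "C = 2 ^ Suc CARD('n) / unit_ball_vol (real CARD('n))"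
  define \<mu> where "\<mu> k = measure lborel (B k)" for k
  have r: "r k > 0" "r (Suc k) = r k / 2" "r k \<le> R" for k
    using R by (auto simp: r_def field_simps)
  have \<mu>: "\<mu> k > 0" "\<mu> k = 2 ^ CARD('n) * \<mu> (Suc k)" for k
    using r(1)[of k] by (simp_all add: \<mu>_def B_def measure_cball r(2) power_divide)
  have \<theta>: "summable \<theta>" "\<And>k. \<theta> k \<ge> 0"
    using sum by (auto simp: \<theta>_def[abs_def] r_def scaled_gradient_nonneg)
  have C: "C > 0"
    by (simp add: C_def)
  have osc: "oscillation (B k) (a k) \<le> C * \<mu> k * \<theta> k" for k
  proof -
    have "cball x (2 * r k) \<subseteq> cball x (2 * R)"
      using r(3)[of k] by (intro subset_cball) simp
    then show ?thesis
      unfolding C_def \<mu>_def B_def \<theta>_def a_def using W r(1) by (intro poincare_cball) auto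
  qed
  have step: "\<bar>a (Suc k) - a k\<bar> \<le> 2 ^ CARD('n) * C * \<theta> k" for k
  proof -
    have "\<mu> (Suc k) * \<bar>a (Suc k) - a k\<bar> \<le> oscillation (B (Suc k)) (a k)"
      unfolding \<mu>_def a_def using \<mu>(1)[of "Suc k"]
      by (intro average_diff_le) (auto simp: B_def \<mu>_def)
    also have "\<dots> \<le> oscillation (B k) (a k)"
      using r(1,2)[of k] by (intro oscillation_mono) (auto simp: B_def)
    also have "\<dots> \<le> C * \<mu> k * \<theta> k"
      by (rule osc)
    also have "\<dots> = \<mu> (Suc k) * (2 ^ CARD('n) * C * \<theta> k)"
      by (subst \<mu>(2)) simp
    finally show ?thesis
      using \<mu>(1)[of "Suc k"] by simp
  qed
  have abs_sum: "summable (\<lambda>k. \<bar>a (Suc k) - a k\<bar>)"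
    by (rule summable_comparison_test'[where g = "\<lambda>k. 2 ^ CARD('n) * C * \<theta> k" and N = 0])
      (use step \<theta> in \<open>auto intro: summable_mult\<close>)
  then have "summable (\<lambda>k. a (Suc k) - a k)"
    by (rule summable_rabs_cancel)
  then have "(\<lambda>n. \<Sum>k<n. a (Suc k) - a k) \<longlonglongrightarrow> (\<Sum>k. a (Suc k) - a k)"
    by (rule summable_LIMSEQ)
  then have lim: "(\<lambda>n. a n - a 0) \<longlonglongrightarrow> (\<Sum>k. a (Suc k) - a k)"
    by (simp add: sum_lessThan_telescope)
  define c where "c = a 0 + (\<Sum>k. a (Suc k) - a k)"
  have "a \<longlonglongrightarrow> c"
    using tendsto_add[OF tendsto_const[of "a 0"] lim] by (simp add: c_def)
  then have "(\<lambda>k. \<bar>a k - c\<bar>) \<longlonglongrightarrow> 0"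
    by (intro tendsto_rabs_zero) (simp add: LIM_zero)
  moreover have "(\<lambda>k. C * \<theta> k) \<longlonglongrightarrow> 0"
    using tendsto_mult_right_zero[OF summable_LIMSEQ_zero[OF \<theta>(1)]] .
  ultimately have "(\<lambda>k. C * \<theta> k + \<bar>a k - c\<bar>) \<longlonglongrightarrow> 0"
    using tendsto_add by fastforce
  moreover have "oscillation (B k) c / \<mu> k \<le> C * \<theta> k + \<bar>a k - c\<bar>" for k
  proof -
    have "oscillation (B k) c \<le> oscillation (B k) (a k) + \<mu> k * \<bar>a k - c\<bar>"
      unfolding \<mu>_def by (rule oscillation_triangle) (auto simp: B_def)
    also have "\<dots> \<le> C * \<mu> k * \<theta> k + \<mu> k * \<bar>a k - c\<bar>"
      using osc by simp
    finally show ?thesis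
      using \<mu>(1)[of k] by (simp add: field_simps)
  qed
  moreover have "0 \<le> oscillation (B k) c / \<mu> k" for k
    using oscillation_nonneg \<mu>(1)[of k] by (simp add: less_imp_le)
  ultimately have lim0: "(\<lambda>k. oscillation (B k) c / \<mu> k) \<longlonglongrightarrow> 0"
    by (rule_tac tendsto_sandwich[OF always_eventually always_eventually tendsto_const]) simp_all
  have bound: "\<bar>c - a 0\<bar> \<le> 2 ^ CARD('n) * C * (\<Sum>k. \<theta> k)"
  proof -
    have "\<bar>c - a 0\<bar> \<le> (\<Sum>k. \<bar>a (Suc k) - a k\<bar>)"
      using summable_rabs[OF abs_sum] by (simp add: c_def)
    also have "\<dots> \<le> (\<Sum>k. 2 ^ CARD('n) * C * \<theta> k)"
      using step abs_sum \<theta> by (intro suminf_le summable_mult) auto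
    also have "\<dots> = 2 ^ CARD('n) * C * (\<Sum>k. \<theta> k)"
      using \<theta>(1) by (rule suminf_mult)
    finally show ?thesis .
  qed
  \<comment> \<open>The exponent n is the volume ratio of consecutive balls, the exponent n + 1
    comes from \<open>poincare_cball\<close>.\<close>
  have "CARD('n) + Suc CARD('n) = 2 * CARD('n) + 1"
    by simp
  then have C_eq: "2 ^ CARD('n) * C = 2 ^ (2 * CARD('n) + 1) / unit_ball_vol (real CARD('n))"
    unfolding C_def times_divide_eq_right power_add[symmetric] by (rule arg_cong)
  show ?thesis
  proof (rule that)
    show "(\<lambda>k. oscillation (cball x (R / 2 ^ k)) c / measure lborel (cball x (R / 2 ^ k))) \<longlonglongrightarrow> 0"
      using lim0 unfolding \<mu>_def B_def r_def .
    show "\<bar>c - average (cball x R)\<bar>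
        \<le> 2 ^ (2 * CARD('n) + 1) / unit_ball_vol (real CARD('n)) * (\<Sum>k. scaled_gradient (R / 2 ^ k) x)"
      using bound unfolding C_eq a_def B_def \<theta>_def r_def power_0 div_by_1 .
  qed
qed

end

section \<open>The bad set\<close>

lemma cube_eq_cbox: "cube a l = cbox (\<chi> i. a $ i - l / 2) (\<chi> i. a $ i + l / 2)"
proof -
  have *: "\<bar>s - t\<bar> \<le> l / 2 \<longleftrightarrow> t - l / 2 \<le> s \<and> s \<le> t + l / 2" for s t :: real
    by linarith
  show ?thesis
    unfolding cube_def set_eq_iff mem_Collect_eq mem_box_cart * by simp
qed

lemma compact_cube: "compact (cube a l)"
  by (simp add: cube_eq_cbox)

lemma convex_cube: "convex (cube a l)"
  by (simp add: cube_eq_cbox)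

lemma cube_borel [measurable]: "cube a l \<in> sets borel"
  by (simp add: cube_eq_cbox)

lemma measure_cube:
  fixes a :: "real ^ 'n"
  assumes "l \<ge> 0"
  shows "measure lborel (cube a l) = l ^ CARD('n)"
  using assms content_cbox_cart[of "\<chi> i. a $ i - l / 2" "\<chi> i. a $ i + l / 2"]
  by (simp add: cube_eq_cbox interval_eq_empty_cart not_less)

lemma emeasure_cube:
  fixes a :: "real ^ 'n"
  assumes "l \<ge> 0"
  shows "emeasure lborel (cube a l) = ennreal (l ^ CARD('n))"
  using measure_cube[OF assms, of a] emeasure_bounded_finite[of "cube a l"] compact_imp_bounded[OF compact_cube[of a l]]
  by (simp add: emeasure_eq_ennreal_measure)

lemma cube_mono: "l \<le> l' \<Longrightarrow> cube a l \<subseteq> cube a l'"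
  unfolding cube_def subset_iff mem_Collect_eq
  by (metis divide_right_mono order.trans zero_le_numeral)

lemma cball_subset_cube:
  assumes "x \<in> cube a l"
  shows "cball x r \<subseteq> cube a (l + 2 * r)"
proof
  fix y assume "y \<in> cball x r"
  then have "norm (y - x) \<le> r"
    by (simp add: dist_norm norm_minus_commute)
  then have "\<bar>y $ i - x $ i\<bar> \<le> r" for i
    using component_le_norm_cart[of "y - x" i] by simp
  note yx = this
  have "\<bar>y $ i - a $ i\<bar> \<le> (l + 2 * r) / 2" for i
  proof -
    have "\<bar>x $ i - a $ i\<bar> \<le> l / 2"
      using assms by (simp add: cube_def)
    moreover have "\<bar>y $ i - a $ i\<bar> \<le> \<bar>y $ i - x $ i\<bar> + \<bar>x $ i - a $ i\<bar>"
      using abs_triangle_ineq[of "y $ i - x $ i" "x $ i - a $ i"] by simp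
    ultimately show ?thesis
      using yx[of i] by (simp add: field_simps)
  qed
  then show "y \<in> cube a (l + 2 * r)"
    by (simp add: cube_def)
qed

lemma norm_diff_cube_le:
  fixes x :: "real ^ 'n"
  assumes "x \<in> cube a l" "z \<in> cube a l"
  shows "norm (x - z) \<le> real CARD('n) * l"
proof -
  have "norm (x - z) \<le> (\<Sum>i\<in>UNIV. \<bar>(x - z) $ i\<bar>)"
    by (rule norm_le_l1_cart)
  also have "\<dots> \<le> (\<Sum>i\<in>(UNIV :: 'n set). l)"
  proof (rule sum_mono)
    fix i
    have "\<bar>x $ i - a $ i\<bar> \<le> l / 2" "\<bar>z $ i - a $ i\<bar> \<le> l / 2"
      using assms by (auto simp: cube_def)
    then show "\<bar>(x - z) $ i\<bar> \<le> l"
      using abs_triangle_ineq4[of "x $ i - a $ i" "z $ i - a $ i"] by simp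
  qed
  finally show ?thesis by simp
qed

section \<open>Constants and estimates for the bad set\<close>

definition weak_Lp_const :: "real \<Rightarrow> real \<Rightarrow> real \<Rightarrow> real" where
  "weak_Lp_const \<kappa> p q = \<kappa> + 2 powr p / (1 - 2 powr (p - q))"

lemma weak_Lp_const_nonneg: "\<kappa> \<ge> 0 \<Longrightarrow> p < q \<Longrightarrow> 0 \<le> weak_Lp_const \<kappa> p q"
  using powr_less_one[of 2 "p - q"] unfolding weak_Lp_const_def
  by (intro add_nonneg_nonneg divide_nonneg_nonneg) auto

text \<open>The first argument is the volume of a ball of radius 2r divided by r^n.\<close>

definition gradient_const :: "nat \<Rightarrow> real" where
  "gradient_const n = weak_Lp_const (unit_ball_vol (real n) * 2 ^ n) 1 (real n)"

text \<open>After the normalisation of the content, the factors come from the Vitali enlargement,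
  the covering radius \<open>2 * r\<close>, Hoelder's inequality on one ball, and the embedding into
  L^p on the cube of side \<open>16 * R\<close>.\<close>

definition content_const :: "nat \<Rightarrow> real \<Rightarrow> real" where
  "content_const n \<beta> = (let p = real n - \<beta> / 2 in
     unit_ball_vol \<beta> * 5 powr \<beta> * (2 powr \<beta> * (2 * (2 ^ Suc n * unit_ball_vol (real n)) powr (p - 1))
       * weak_Lp_const (16 ^ n) p (real n)))"

text \<open>\<open>A\<close> bounds the weak norm of \<open>V\<close>, and \<open>cube a (8 * R)\<close> is the cube over which the oscillation is
  measured.\<close>

locale weak_gradient_pair_in_cube = weak_gradient_pair U V W
  for U :: "real ^ 'n \<Rightarrow> real" and V W +
  fixes a :: "real ^ 'n" and A R \<beta> p q :: real
  assumes A_pos: "A > 0" and R_pos: "R > 0" and two_le_n: "2 \<le> CARD('n)"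
    and \<beta>_pos: "0 < \<beta>" and \<beta>_le: "\<beta> \<le> real CARD('n)"
    and tail: "\<And>t. t > 0 \<Longrightarrow> emeasure lborel {x. norm (V x) > t} \<le> ennreal ((A / t) powr real CARD('n))"
    and cube_W: "cube a (12 * R) \<subseteq> W"
    and V_outside: "\<And>y. y \<notin> cube a (16 * R) \<Longrightarrow> V y = 0"
    and p_eq: "p = real CARD('n) - \<beta> / 2" and q_eq: "q = 2 powr (- (\<beta> / (2 * p)))"
begin

text \<open>As \<beta> is at most n, \<open>p\<close> is at least n/2, hence at least 1 once the
  dimension is at least 2.\<close>

lemma p_bounds: "1 \<le> p" "p < real CARD('n)" "real CARD('n) - p = \<beta> / 2"
  using two_le_n \<beta>_pos \<beta>_le by (auto simp: p_eq)

lemma q_bounds: "0 < q" "q < 1" "q powr p = 2 powr (- (\<beta> / 2))"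
  using p_bounds \<beta>_pos by (auto simp: q_eq powr_powr powr_less_one)

lemma emeasure_cball_le:
  "r > 0 \<Longrightarrow> emeasure lborel (cball x (2 * r)) \<le> ennreal ((unit_ball_vol (real CARD('n)) * 2 ^ CARD('n)) * r powr real CARD('n))"
  for x :: "real ^ 'n"
  by (simp add: emeasure_cball powr_realpow power_mult_distrib mult_ac)

text \<open>\<open>weak_Lp_bound\<close> with exponent 1, which lies below the weak exponent n
  because of \<open>two_le_n\<close>.\<close>

lemma set_integral_norm_V_le:
  assumes S[measurable]: "S \<in> sets borel" and "r > 0" "\<kappa> \<ge> 0" "emeasure lborel S \<le> ennreal (\<kappa> * r powr real CARD('n))"
  shows "(LINT y:S|lborel. norm (V y)) \<le> weak_Lp_const \<kappa> 1 (real CARD('n)) * (A * r powr (real CARD('n) - 1))"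
proof -
  have "ennreal (LINT y:S|lborel. norm (V y)) = (\<integral>\<^sup>+y\<in>S. ennreal (norm (V y) powr 1) \<partial>lborel)"
    unfolding set_lebesgue_integral_def
    using set_integrable_norm_V[OF S]
    by (subst nn_integral_eq_integral[symmetric])
      (auto simp: set_integrable_def indicator_def intro!: nn_integral_cong)
  also have "\<dots> \<le> ennreal (weak_Lp_const \<kappa> 1 (real CARD('n)) * (A powr 1 * r powr (real CARD('n) - 1)))"
    unfolding weak_Lp_const_def
    by (rule weak_Lp_bound) (use assms A_pos two_le_n tail in auto)
  finally show ?thesis
    using A_pos assms two_le_n weak_Lp_const_nonneg[of \<kappa> 1 "real CARD('n)"] by (simp add: ennreal_le_iff)
qed

lemma scaled_gradient_le:
  assumes "r > 0"
  shows "scaled_gradient r x \<le> gradient_const CARD('n) * A"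
proof -
  have "(LINT y:cball x (2 * r)|lborel. norm (V y)) \<le> gradient_const CARD('n) * (A * r powr (real CARD('n) - 1))"
    unfolding gradient_const_def
    using assms emeasure_cball_le by (intro set_integral_norm_V_le) auto
  then have "scaled_gradient r x \<le> r powr (1 - real CARD('n)) * (gradient_const CARD('n) * (A * r powr (real CARD('n) - 1)))"
    unfolding scaled_gradient_def by (rule mult_left_mono) simp
  also have "\<dots> = gradient_const CARD('n) * A"
    using assms by (simp add: mult_ac flip: powr_add)
  finally show ?thesis .
qed

definition bad_set :: "nat \<Rightarrow> (real ^ 'n) set" where
  "bad_set K = {x \<in> cube a (8 * R). \<exists>k\<ge>K. scaled_gradient (R / 2 ^ k) x > A * q ^ (k - K)}"

text \<open>\<open>power_integral_lower_bound\<close> on \<open>cball x (2 * r)\<close>, with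
  \<open>\<tau>\<close> the unscaled form of s and m the volume. The powers of r combine to (n - 1)
  - (p - 1) = \<beta>/2.\<close>

lemma scaled_gradient_lower_bound:
  assumes r: "r > 0" and s: "s > 0" and large: "scaled_gradient r x > s"
  shows "ennreal (s powr p * r powr (\<beta> / 2))
    \<le> ennreal (2 * (2 ^ Suc CARD('n) * unit_ball_vol (real CARD('n))) powr (p - 1)) * (\<integral>\<^sup>+y\<in>cball x (2 * r). ennreal (norm (V y) powr p) \<partial>lborel)"
proof -
  define c where "c = 2 ^ Suc CARD('n) * unit_ball_vol (real CARD('n))"
  have c: "c > 0" by (simp add: c_def)
  define \<tau> where "\<tau> = s * r powr (real CARD('n) - 1)"
  define m where "m = unit_ball_vol (real CARD('n)) * 2 ^ CARD('n) * r powr real CARD('n)"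
  have \<tau>: "\<tau> > 0" and m: "m > 0"
    using r s by (simp_all add: \<tau>_def m_def)
  have int: "(LINT y:cball x (2 * r)|lborel. norm (V y)) > \<tau>"
  proof -
    have "r powr (real CARD('n) - 1) * s < r powr (real CARD('n) - 1) * scaled_gradient r x"
      using r large by simp
    also have "\<dots> = (LINT y:cball x (2 * r)|lborel. norm (V y))"
      using r by (simp add: scaled_gradient_def mult.assoc[symmetric] flip: powr_add)
    finally show ?thesis by (simp add: \<tau>_def mult.commute)
  qed
  have "ennreal (LINT y:cball x (2 * r)|lborel. norm (V y)) = (\<integral>\<^sup>+y\<in>cball x (2 * r). ennreal (norm (V y)) \<partial>lborel)"
    unfolding set_lebesgue_integral_def
    using set_integrable_norm_V[of "cball x (2 * r)"]
    by (subst nn_integral_eq_integral[symmetric])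
      (auto simp: set_integrable_def indicator_def intro!: nn_integral_cong)
  then have "ennreal \<tau> < (\<integral>\<^sup>+y\<in>cball x (2 * r). ennreal (norm (V y)) \<partial>lborel)"
    using int \<tau> by (metis ennreal_lessI less_trans)
  then have *: "ennreal (\<tau> / 2 * (\<tau> / (2 * m)) powr (p - 1)) \<le> (\<integral>\<^sup>+y\<in>cball x (2 * r). ennreal (norm (V y) powr p) \<partial>lborel)"
    using p_bounds \<tau> m emeasure_cball_le[OF r, of x]
    by (intro power_integral_lower_bound) (auto simp: m_def)
  have "\<tau> / (2 * m) = s / (c * r)"
    using r s by (simp add: \<tau>_def m_def c_def powr_diff field_simps)
  then have "\<tau> / 2 * (\<tau> / (2 * m)) powr (p - 1) = s * s powr (p - 1) * (r powr (real CARD('n) - 1) / r powr (p - 1)) / (2 * c powr (p - 1))"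
    using r s c by (simp add: \<tau>_def powr_divide powr_mult mult_ac)
  also have "s * s powr (p - 1) = s powr p"
    using s by (simp add: powr_mult_base)
  also have "r powr (real CARD('n) - 1) / r powr (p - 1) = r powr (\<beta> / 2)"
  proof -
    have "real CARD('n) - 1 - (p - 1) = \<beta> / 2"
      using p_bounds(3) by linarith
    then show ?thesis
      by (simp only: powr_diff[symmetric])
  qed
  finally have "s powr p * r powr (\<beta> / 2) = 2 * c powr (p - 1) * (\<tau> / 2 * (\<tau> / (2 * m)) powr (p - 1))"
    using c by (simp add: field_simps)
  then have "ennreal (s powr p * r powr (\<beta> / 2)) = ennreal (2 * c powr (p - 1)) * ennreal (\<tau> / 2 * (\<tau> / (2 * m)) powr (p - 1))"
    using \<tau> by (simp flip: ennreal_mult)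
  also have "\<dots> \<le> ennreal (2 * c powr (p - 1)) * (\<integral>\<^sup>+y\<in>cball x (2 * r). ennreal (norm (V y) powr p) \<partial>lborel)"
    by (intro mult_left_mono *) simp
  finally show ?thesis
    by (simp add: c_def)
qed

lemma nn_integral_V_powr_le:
  "(\<integral>\<^sup>+y. ennreal (norm (V y) powr p) \<partial>lborel)
    \<le> ennreal (weak_Lp_const (16 ^ CARD('n)) p (real CARD('n)) * (A powr p * R powr (\<beta> / 2)))"
proof -
  have "(\<integral>\<^sup>+y. ennreal (norm (V y) powr p) \<partial>lborel) = (\<integral>\<^sup>+y\<in>cube a (16 * R). ennreal (norm (V y) powr p) \<partial>lborel)"
    using V_outside by (intro nn_integral_cong) (auto simp: indicator_def)
  also have "\<dots> \<le> ennreal (weak_Lp_const (16 ^ CARD('n)) p (real CARD('n)) * (A powr p * R powr (real CARD('n) - p)))"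
    unfolding weak_Lp_const_def
    using p_bounds A_pos R_pos tail
    by (intro weak_Lp_bound) (auto simp: emeasure_cube powr_realpow power_mult_distrib)
  finally show ?thesis
    using p_bounds(3) by simp
qed

text \<open>The density criterion is applied with radius \<open>2 * r\<close>, where
  \<open>r = R / 2 ^ k\<close> and k witnesses membership in the bad set. The factor
  \<open>M\<close> must not depend on k, and the choice of \<open>q\<close> achieves this.\<close>

lemma hausdorff_content_bad_set:
  "hausdorff_content \<beta> (bad_set K) \<le> ennreal (content_const CARD('n) \<beta> * R powr \<beta> * (2 powr (- (\<beta> / 2))) ^ K)"
proof -
  define c where "c = 2 * (2 ^ Suc CARD('n) * unit_ball_vol (real CARD('n))) powr (p - 1)"
  define \<rho> :: real where "\<rho> = 2 powr (- (\<beta> / 2))"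
  define M where "M = 2 powr \<beta> * R powr (\<beta> / 2) * \<rho> ^ K / A powr p"
  define w where "w = weak_Lp_const (16 ^ CARD('n)) p (real CARD('n))"
  have c: "c \<ge> 0" by (simp add: c_def)
  have \<rho>: "\<rho> > 0" by (simp add: \<rho>_def)
  have M: "M \<ge> 0" using \<rho> by (simp add: M_def)
  have w: "w \<ge> 0"
    unfolding w_def using p_bounds by (intro weak_Lp_const_nonneg) auto
  have "hausdorff_content \<beta> (bad_set K)
    \<le> ennreal (unit_ball_vol \<beta> * 5 powr \<beta>) * (ennreal (M * c) * (\<integral>\<^sup>+y. ennreal (norm (V y) powr p) \<partial>lborel))"
  proof (rule hausdorff_content_le_density)
    fix x assume "x \<in> bad_set K"
    then obtain k where k: "k \<ge> K" "scaled_gradient (R / 2 ^ k) x > A * q ^ (k - K)"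
      by (auto simp: bad_set_def)
    define r where "r = R / 2 ^ k"
    have r: "r > 0" "2 * r \<le> 2 * R"
      using R_pos by (auto simp: r_def field_simps)
    have s: "A * q ^ (k - K) > 0"
      using A_pos q_bounds by simp
    have sp: "(A * q ^ (k - K)) powr p = A powr p * \<rho> ^ (k - K)"
    proof -
      have "(q ^ (k - K)) powr p = (q powr p) ^ (k - K)"
        using q_bounds(1) by (simp add: powr_power powr_powr mult.commute flip: powr_realpow)
      then show ?thesis
        using A_pos q_bounds(1,3) by (simp add: powr_mult \<rho>_def)
    qed
    have rb: "r powr (\<beta> / 2) = R powr (\<beta> / 2) * \<rho> ^ k"
    proof -
      have "(2 ^ k :: real) powr (\<beta> / 2) = (2 powr (\<beta> / 2)) ^ k"
        by (simp add: powr_power powr_powr mult.commute flip: powr_realpow)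
      moreover have "\<rho> ^ k = inverse ((2 powr (\<beta> / 2)) ^ k)"
        by (simp only: \<rho>_def powr_minus power_inverse)
      moreover have "r powr (\<beta> / 2) = R powr (\<beta> / 2) / (2 ^ k) powr (\<beta> / 2)"
        unfolding r_def by (rule powr_divide)
      ultimately show ?thesis
        by (simp only: divide_inverse)
    qed
    \<comment> \<open>One factor \<open>r powr (\<beta> / 2)\<close> is kept for Hoelder's bound,
      the other is expanded as \<open>R powr (\<beta> / 2) * \<rho> ^ k\<close>; of this,
      \<open>\<rho> ^ (k - K)\<close> is absorbed by the p-th power of the threshold.\<close>
    have "(2 * r) powr \<beta> = 2 powr \<beta> * (r powr (\<beta> / 2) * r powr (\<beta> / 2))"
      using r by (simp add: powr_mult flip: powr_add)
    also have "\<dots> = 2 powr \<beta> * (R powr (\<beta> / 2) * \<rho> ^ k * r powr (\<beta> / 2))"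
      by (simp add: rb)
    also have "\<rho> ^ k = \<rho> ^ K * \<rho> ^ (k - K)"
      using k(1) by (simp flip: power_add)
    also have "2 powr \<beta> * (R powr (\<beta> / 2) * (\<rho> ^ K * \<rho> ^ (k - K)) * r powr (\<beta> / 2))
        = M * ((A * q ^ (k - K)) powr p * r powr (\<beta> / 2))"
      using A_pos by (simp add: M_def sp)
    finally have "ennreal ((2 * r) powr \<beta>) = ennreal M * ennreal ((A * q ^ (k - K)) powr p * r powr (\<beta> / 2))"
      using M by (simp flip: ennreal_mult)
    also have "\<dots> \<le> ennreal M * (ennreal c * (\<integral>\<^sup>+y\<in>cball x (2 * r). ennreal (norm (V y) powr p) \<partial>lborel))"
      unfolding c_def using k(2) r(1) s
      by (intro mult_left_mono scaled_gradient_lower_bound) (auto simp: r_def)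
    finally show "\<exists>\<rho>>0. \<rho> \<le> 2 * R \<and> ennreal (\<rho> powr \<beta>)
        \<le> ennreal (M * c) * (\<integral>\<^sup>+y\<in>cball x \<rho>. ennreal (norm (V y) powr p) \<partial>lborel)"
      using r M c by (intro exI[of _ "2 * r"]) (simp add: ennreal_mult mult.assoc)
  qed (use \<beta>_pos in auto)
  also have "\<dots> \<le> ennreal (unit_ball_vol \<beta> * 5 powr \<beta>) * (ennreal (M * c) * ennreal (w * (A powr p * R powr (\<beta> / 2))))"
    unfolding w_def by (intro mult_left_mono nn_integral_V_powr_le) auto
  also have "\<dots> = ennreal (unit_ball_vol \<beta> * 5 powr \<beta> * (M * c * (w * (A powr p * R powr (\<beta> / 2)))))"
    using M c w \<beta>_pos by (simp flip: ennreal_mult)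
  also have "unit_ball_vol \<beta> * 5 powr \<beta> * (M * c * (w * (A powr p * R powr (\<beta> / 2))))
      = content_const CARD('n) \<beta> * (R powr (\<beta> / 2) * R powr (\<beta> / 2)) * \<rho> ^ K"
    using A_pos by (simp add: content_const_def Let_def M_def c_def w_def p_eq)
  also have "R powr (\<beta> / 2) * R powr (\<beta> / 2) = R powr \<beta>"
    by (simp flip: powr_add)
  finally show ?thesis
    by (simp add: \<rho>_def)
qed

text \<open>The terms before K obey only the uniform bound \<open>scaled_gradient_le\<close>; from K
  on, avoiding the bad set puts them under a geometric series.\<close>

lemma scaled_gradient_sum_le:
  assumes "x \<in> cube a (8 * R) - bad_set K"
  shows "summable (\<lambda>k. scaled_gradient (R / 2 ^ k) x)"
    and "(\<Sum>k. scaled_gradient (R / 2 ^ k) x) \<le> (gradient_const CARD('n) + 1 / (1 - q)) * A * (real K + 1)"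
proof -
  define \<theta> where "\<theta> k = scaled_gradient (R / 2 ^ k) x" for k
  have bd: "\<theta> (k + K) \<le> A * q ^ k" for k
  proof -
    have "\<not> scaled_gradient (R / 2 ^ (k + K)) x > A * q ^ (k + K - K)"
      using assms unfolding bad_set_def by (metis (mono_tags, lifting) Diff_iff le_add2 mem_Collect_eq)
    then show ?thesis
      by (simp add: \<theta>_def)
  qed
  have \<theta>0: "0 \<le> \<theta> k" for k
    by (simp add: \<theta>_def scaled_gradient_nonneg)
  have geo: "summable (\<lambda>k. q ^ k)"
    using q_bounds by (intro summable_geometric) auto
  have tail_sum: "summable (\<lambda>k. \<theta> (k + K))"
    by (rule summable_comparison_test'[OF summable_mult[OF geo], where N = 0])
      (use bd \<theta>0 in simp)
  have "(\<Sum>k. \<theta> (k + K)) \<le> (\<Sum>k. A * q ^ k)"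
    by (rule suminf_le[OF bd tail_sum summable_mult[OF geo]])
  also have "\<dots> = A / (1 - q)"
    using q_bounds by (subst suminf_mult[OF geo]) (simp add: suminf_geometric)
  finally have tail_le: "(\<Sum>k. \<theta> (k + K)) \<le> A / (1 - q)" .
  show summable: "summable (\<lambda>k. scaled_gradient (R / 2 ^ k) x)"
    using tail_sum summable_iff_shift[of \<theta> K] unfolding \<theta>_def by blast
  have "0 \<le> gradient_const CARD('n)"
    unfolding gradient_const_def using two_le_n by (intro weak_Lp_const_nonneg) auto
  then have g: "0 \<le> gradient_const CARD('n) * A" "0 \<le> A / (1 - q)"
    using A_pos q_bounds by auto
  have "(\<Sum>k. \<theta> k) = (\<Sum>k. \<theta> (k + K)) + (\<Sum>k<K. \<theta> k)"
    using summable by (intro suminf_split_initial_segment) (simp add: \<theta>_def)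
  also have "\<dots> \<le> A / (1 - q) + (\<Sum>k<K. gradient_const CARD('n) * A)"
    using R_pos by (intro add_mono tail_le sum_mono) (auto simp: \<theta>_def intro: scaled_gradient_le)
  \<comment> \<open>Both parts are enlarged to multiples of \<open>real K + 1\<close>, a factor that
    is positive also for K = 0.\<close>
  also have "\<dots> \<le> (A / (1 - q)) * (real K + 1) + gradient_const CARD('n) * A * (real K + 1)"
  proof (rule add_mono)
    show "A / (1 - q) \<le> A / (1 - q) * (real K + 1)"
      using mult_left_mono[OF _ g(2), of 1 "real K + 1"] by simp
    show "(\<Sum>k<K. gradient_const CARD('n) * A) \<le> gradient_const CARD('n) * A * (real K + 1)"
      using mult_left_mono[OF _ g(1), of "real K" "real K + 1"] by (simp add: mult_ac)
  qed
  also have "\<dots> = (gradient_const CARD('n) + 1 / (1 - q)) * A * (real K + 1)"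
    by (simp add: algebra_simps)
  finally show "(\<Sum>k. scaled_gradient (R / 2 ^ k) x) \<le> (gradient_const CARD('n) + 1 / (1 - q)) * A * (real K + 1)"
    by (simp add: \<theta>_def)
qed

text \<open>Trades an average that depends on x for one number valid on the whole cube:
  \<open>cball x R\<close> lies in \<open>cube a (10 * R)\<close>, has comparable volume, and the
  Poincare inequality on that cube has margin R inside \<open>cube a (12 * R)\<close>.\<close>

lemma average_cball_cube_le:
  assumes "x \<in> cube a (8 * R)"
  shows "\<bar>average (cball x R) - average (cube a (10 * R))\<bar>
    \<le> 10 * real CARD('n) * 2 ^ CARD('n) * weak_Lp_const (12 ^ CARD('n)) 1 (real CARD('n)) / unit_ball_vol (real CARD('n)) * A"
proof -
  define w where "w = weak_Lp_const (12 ^ CARD('n)) 1 (real CARD('n))"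
  have \<mu>: "measure lborel (cball x R) = unit_ball_vol (real CARD('n)) * R ^ CARD('n)"
    using R_pos by (simp add: measure_cball)
  have sub: "cball y R \<subseteq> cube a (l * R + 2 * R)" if "y \<in> cube a (l * R)" for y l
    by (rule cball_subset_cube[OF that])
  have "measure lborel (cball x R) * \<bar>average (cball x R) - average (cube a (10 * R))\<bar>
      \<le> oscillation (cball x R) (average (cube a (10 * R)))"
    using R_pos by (intro average_diff_le) (auto simp: \<mu>)
  also have "\<dots> \<le> oscillation (cube a (10 * R)) (average (cube a (10 * R)))"
    using sub[OF assms] compact_cube[of a "10 * R"] by (intro oscillation_mono) (auto intro: compact_imp_bounded)
  also have "\<dots> \<le> real CARD('n) * (10 * R) * 2 ^ CARD('n) * (LINT y:cube a (12 * R)|lborel. norm (V y))"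
  proof (rule poincare_average[where d = R])
    show "cball y R \<subseteq> cube a (12 * R)" if "y \<in> cube a (10 * R)" for y
      using sub[OF that] by simp
  qed (use R_pos cube_W compact_cube[of a "10 * R"] in
      \<open>auto intro: compact_imp_bounded convex_cube norm_diff_cube_le simp: measure_cube\<close>)
  also have "\<dots> \<le> real CARD('n) * (10 * R) * 2 ^ CARD('n) * (w * (A * R powr (real CARD('n) - 1)))"
    unfolding w_def using R_pos
    by (intro mult_left_mono set_integral_norm_V_le) (auto simp: emeasure_cube powr_realpow power_mult_distrib)
  also have "\<dots> = 10 * real CARD('n) * 2 ^ CARD('n) * w * A * (R * R powr (real CARD('n) - 1))"
    by simp
  also have "R * R powr (real CARD('n) - 1) = R ^ CARD('n)"
    using R_pos by (simp add: powr_mult_base powr_realpow)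
  also have "10 * real CARD('n) * 2 ^ CARD('n) * w * A * R ^ CARD('n)
      = measure lborel (cball x R) * (10 * real CARD('n) * 2 ^ CARD('n) * w / unit_ball_vol (real CARD('n)) * A)"
  proof -
    have "unit_ball_vol (real CARD('n)) \<noteq> 0"
      using unit_ball_vol_pos[of "real CARD('n)"] by linarith
    then show ?thesis
      by (simp add: \<mu>)
  qed
  finally show ?thesis
    using R_pos unfolding w_def by (subst (asm) mult_le_cancel_left_pos) (simp_all add: \<mu>)
qed

end

section \<open>Truncation and the precise representative\<close>

lemma test_function_Ck: "\<phi> \<in> test_functions \<Omega> \<Longrightarrow> Ck k \<phi>"
  by (simp add: test_functions_def)

lemma test_function_borel:
  assumes "\<phi> \<in> test_functions \<Omega>"
  shows "\<phi> \<in> borel_measurable borel" "partial_deriv i \<phi> \<in> borel_measurable borel"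
  using test_function_Ck[OF assms, of 0] test_function_Ck[OF assms, of 1]
  by (auto intro!: borel_measurable_continuous_onI)

text \<open>Off its closed support a test function is locally zero, hence so is its derivative. This
  is what allows integration domains to be changed in
  \<open>weak_gradient_truncation\<close>.\<close>

lemma test_function_outside:
  assumes \<phi>: "\<phi> \<in> test_functions \<Omega>" and x: "x \<notin> \<Omega>"
  shows "\<phi> x = 0" "partial_deriv i \<phi> x = 0"
proof -
  have x': "x \<in> - closure {x. \<phi> x \<noteq> 0}"
    using assms by (auto simp: test_functions_def)
  then show "\<phi> x = 0"
    using closure_subset[of "{x. \<phi> x \<noteq> 0}"] by auto
  have "(\<phi> has_derivative (\<lambda>h. 0)) (at x)"
  proof (rule has_derivative_transform_within_open)
    show "((\<lambda>y. 0) has_derivative (\<lambda>h. 0)) (at x)"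
      by simp
    show "0 = \<phi> y" if "y \<in> - closure {x. \<phi> x \<noteq> 0}" for y
      using that closure_subset[of "{x. \<phi> x \<noteq> 0}"] by auto
  qed (use x' in auto)
  then have "(\<phi> has_derivative (\<lambda>h. \<Sum>i\<in>UNIV. 0 * h $ i)) (at x)"
    by simp
  from partial_deriv_eq[OF this] show "partial_deriv i \<phi> x = 0" .
qed

text \<open>Compactness of \<open>K\<close> turns local integrability into integrability, and
  Lebesgue measurable functions are replaced by Borel functions equal almost everywhere. The weak
  gradient relation survives because a test function on \<open>K\<close> is one on
  \<open>\<Omega>\<close> and vanishes, with its partial derivatives, off \<open>K\<close>.\<close>

lemma weak_gradient_truncation:
  fixes u :: "real ^ 'n \<Rightarrow> real" and G :: "real ^ 'n \<Rightarrow> real ^ 'n"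
  assumes u: "u \<in> W11_loc \<Omega>" and G: "has_weak_gradient u G \<Omega>" and K: "compact K" "K \<subseteq> \<Omega>"
  obtains U V where "weak_gradient_pair U V K" "(\<lambda>x. indicator K x * u x) \<in> borel_measurable lebesgue"
    "AE x in lebesgue. indicator K x * u x = U x" "AE x in lebesgue. x \<in> K \<longrightarrow> V x = G x"
    "\<And>x. x \<notin> K \<Longrightarrow> V x = 0"
proof -
  have K_borel[measurable]: "K \<in> sets borel"
    using K by (simp add: borel_compact)
  have uK: "integrable lebesgue (\<lambda>x. indicator K x * u x)"
    using u K by (simp add: W11_loc_def locally_integrable_on_def set_integrable_def)
  then have uK_meas[measurable]: "(\<lambda>x. indicator K x * u x) \<in> borel_measurable lebesgue"
    by (rule borel_measurable_integrable)
  have GK: "integrable lebesgue (\<lambda>x. indicator K x *\<^sub>R G x)"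
    using G K by (simp add: has_weak_gradient_def locally_integrable_on_def set_integrable_def)
  obtain U where U[measurable]: "U \<in> borel_measurable lborel" "AE x in lborel. indicator K x * u x = U x"
    using completion_ex_borel_measurable_real[OF uK_meas] by blast
  have U_ae: "AE x in lebesgue. indicator K x * u x = U x"
    using U(2) by (rule AE_completion)
  have [measurable]: "U \<in> borel_measurable lebesgue"
    using U(1) by (rule measurable_completion)
  have "\<exists>g\<in>borel_measurable lborel. AE x in lborel. indicator K x * G x $ i = g x" for i
  proof (rule completion_ex_borel_measurable_real)
    have "integrable lebesgue (\<lambda>x. (indicator K x *\<^sub>R G x) $ i)"
      by (rule integrable_bounded_linear[OF bounded_linear_vec_nth GK])
    from borel_measurable_integrable[OF this]
    show "(\<lambda>x. indicator K x * G x $ i) \<in> borel_measurable lebesgue"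
      by (simp only: vector_scaleR_component real_scaleR_def)
  qed
  then have "\<forall>i. \<exists>g. g \<in> borel_measurable lborel \<and> (AE x in lborel. indicator K x * G x $ i = g x)"
    by blast
  from choice[OF this] obtain g where g[measurable]: "\<And>i. g i \<in> borel_measurable lborel"
    and g_ae: "\<And>i. AE x in lborel. indicator K x * G x $ i = g i x"
    by auto
  \<comment> \<open>The outer indicator makes \<open>V\<close> vanish everywhere off
    \<open>K\<close>, not just almost everywhere.\<close>
  define V where "V x = indicat_real K x *\<^sub>R (\<Sum>i\<in>UNIV. g i x *\<^sub>R axis i (1 :: real))" for x
  have V_nth: "V x $ j = indicator K x * g j x" for x j
    by (simp add: V_def axis_def if_distrib cong: if_cong)
  have V_meas: "V \<in> borel_measurable lborel"
    unfolding V_def by measurable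
  have [measurable]: "V \<in> borel_measurable lebesgue"
    using V_meas by (rule measurable_completion)
  have V_ae: "AE x in lebesgue. indicator K x *\<^sub>R G x = V x"
  proof (rule AE_completion)
    have "AE x in lborel. \<forall>i\<in>UNIV. indicator K x * G x $ i = g i x"
      using g_ae by (subst AE_ball_countable) auto
    then show "AE x in lborel. indicator K x *\<^sub>R G x = V x"
      by (rule AE_mp) (auto intro!: AE_I2 simp: vec_eq_iff V_nth indicator_def split: if_splits)
  qed
  have U_int: "integrable lborel U"
  proof -
    have "integrable lebesgue U"
      by (rule integrable_cong_AE_imp[OF uK]) (use U_ae in auto)
    then show ?thesis
      using integrable_completion[OF U(1)] by simp
  qed
  have V_int: "integrable lborel V"
  proof -
    have "integrable lebesgue V"
      by (rule integrable_cong_AE_imp[OF GK]) (use V_ae in auto)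
    then show ?thesis
      using integrable_completion[OF V_meas] by simp
  qed
  have "weak_gradient_pair U V K"
  proof
    fix \<phi> i assume \<phi>: "\<phi> \<in> test_functions K"
    then have \<phi>\<Omega>: "\<phi> \<in> test_functions \<Omega>"
      using K by (auto simp: test_functions_def)
    note [measurable] = test_function_borel[OF \<phi>]
    have [measurable]: "\<phi> \<in> borel_measurable lebesgue" "partial_deriv i \<phi> \<in> borel_measurable lebesgue"
      using test_function_borel[OF \<phi>] by (auto intro: measurable_completion)
    have "(\<integral>y. U y * partial_deriv i \<phi> y \<partial>lborel) = (\<integral>y. U y * partial_deriv i \<phi> y \<partial>lebesgue)"
      by (rule integral_completion[symmetric]) (use U(1) in measurable)
    also have "\<dots> = (\<integral>y. indicator K y * u y * partial_deriv i \<phi> y \<partial>lebesgue)"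
      by (rule integral_cong_AE) (use U_ae in auto)
    also have "\<dots> = (LINT x:\<Omega>|lebesgue. u x * partial_deriv i \<phi> x)"
      unfolding set_lebesgue_integral_def
    proof (rule Bochner_Integration.integral_cong[OF refl])
      fix x
      show "indicator K x * u x * partial_deriv i \<phi> x = indicat_real \<Omega> x *\<^sub>R (u x * partial_deriv i \<phi> x)"
        using test_function_outside(2)[OF \<phi>, of x i] K(2) by (auto simp: indicator_def)
    qed
    also have "\<dots> = - (LINT x:\<Omega>|lebesgue. G x $ i * \<phi> x)"
      using G \<phi>\<Omega> by (simp add: has_weak_gradient_def)
    also have "(LINT x:\<Omega>|lebesgue. G x $ i * \<phi> x) = (\<integral>y. (indicator K y *\<^sub>R G y) $ i * \<phi> y \<partial>lebesgue)"
      unfolding set_lebesgue_integral_def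
    proof (rule Bochner_Integration.integral_cong[OF refl])
      fix x
      show "indicat_real \<Omega> x *\<^sub>R (G x $ i * \<phi> x) = (indicator K x *\<^sub>R G x) $ i * \<phi> x"
        using test_function_outside(1)[OF \<phi>, of x] K(2) by (auto simp: indicator_def)
    qed
    also have "\<dots> = (\<integral>y. V y $ i * \<phi> y \<partial>lebesgue)"
    proof (rule integral_cong_AE)
      have "(\<lambda>y. (indicat_real K y *\<^sub>R G y) $ i) \<in> borel_measurable lebesgue"
        by (rule borel_measurable_integrable, rule integrable_bounded_linear[OF bounded_linear_vec_nth GK])
      then show "(\<lambda>y. (indicat_real K y *\<^sub>R G y) $ i * \<phi> y) \<in> borel_measurable lebesgue"
        by measurable
      show "(\<lambda>y. V y $ i * \<phi> y) \<in> borel_measurable lebesgue"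
        unfolding V_nth using g by (intro measurable_completion) measurable
      show "AE x in lebesgue. (indicat_real K x *\<^sub>R G x) $ i * \<phi> x = V x $ i * \<phi> x"
        using V_ae by eventually_elim simp
    qed
    also have "\<dots> = (\<integral>y. V y $ i * \<phi> y \<partial>lborel)"
      unfolding V_nth by (rule integral_completion) (use g in measurable)
    finally show "(\<integral>y. U y * partial_deriv i \<phi> y \<partial>lborel) = - (\<integral>y. V y $ i * \<phi> y \<partial>lborel)" .
  qed (fact U_int V_int)+
  moreover have "AE x in lebesgue. x \<in> K \<longrightarrow> V x = G x"
    using V_ae by eventually_elim (auto simp: indicator_def)
  moreover have "V x = 0" if "x \<notin> K" for x
    using that by (simp add: V_def)
  ultimately show ?thesis
    using that uK_meas U_ae by blast
qed

lemma weak_gradient_tail: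
  fixes V G :: "real ^ 'n \<Rightarrow> real ^ 'n"
  assumes G: "G \<in> weak_L r \<Omega>" "weak_L_norm r \<Omega> G \<le> ennreal A" and "r > 0" "A \<ge> 0" "t > 0" "K \<subseteq> \<Omega>"
    and V[measurable]: "V \<in> borel_measurable borel"
    and ae: "AE x in lebesgue. x \<in> K \<longrightarrow> V x = G x" and V0: "\<And>x. x \<notin> K \<Longrightarrow> V x = 0"
  shows "emeasure lborel {x. norm (V x) > t} \<le> ennreal ((A / t) powr r)"
proof -
  have G\<Omega>[measurable]: "(\<lambda>x. indicat_real \<Omega> x *\<^sub>R G x) \<in> borel_measurable lebesgue"
    using G(1) by (simp add: weak_L_def set_borel_measurable_def)
  have eq: "{x \<in> \<Omega>. norm (G x) > t} = {x \<in> space lebesgue. norm (indicat_real \<Omega> x *\<^sub>R G x) > t}"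
    using \<open>t > 0\<close> by (auto simp: indicator_def split: if_splits)
  have "emeasure lborel {x. norm (V x) > t} = emeasure lebesgue {x. norm (V x) > t}"
    by simp
  also have "\<dots> \<le> emeasure lebesgue {x \<in> \<Omega>. norm (G x) > t}"
  proof (rule emeasure_mono_AE)
    show "AE x in lebesgue. x \<in> {x. norm (V x) > t} \<longrightarrow> x \<in> {x \<in> \<Omega>. norm (G x) > t}"
      using ae
    proof eventually_elim
      case (elim x)
      then show ?case
        using V0[of x] \<open>K \<subseteq> \<Omega>\<close> \<open>t > 0\<close> by (cases "x \<in> K") auto
    qed
    show "{x \<in> \<Omega>. norm (G x) > t} \<in> sets lebesgue"
      unfolding eq by measurable
  qed
  also have "\<dots> \<le> ennreal ((A / t) powr r)"
    by (rule weak_L_norm_tail[OF G(2) \<open>r > 0\<close> \<open>A \<ge> 0\<close> \<open>t > 0\<close>])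
  finally show ?thesis .
qed

text \<open>The parameter g is the identity for averages of u and the distance to c for
  oscillations.\<close>

lemma (in weak_gradient_pair) ball_average_eq:
  assumes meas: "(\<lambda>x. indicator K x * u x) \<in> borel_measurable lebesgue" "g \<in> borel_measurable borel"
    and ae: "AE x in lebesgue. indicator K x * u x = U x" and K: "ball x r \<subseteq> K"
  shows "ball_average (\<lambda>y. g (u y)) x r = (LINT y:ball x r|lborel. g (U y)) / measure lborel (ball x r)"
proof -
  have gU: "(\<lambda>y. indicator (ball x r) y * g (U y)) \<in> borel_measurable lborel"
    using measurable_compose[OF borel_measurable_U meas(2)]
    by (auto intro!: borel_measurable_times borel_measurable_indicator)
  have "(\<lambda>y. indicator (ball x r) y * g (indicator K y * u y)) \<in> borel_measurable lebesgue"
    using measurable_compose[OF meas] by (intro borel_measurable_times borel_measurable_indicator) auto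
  note measurable = this measurable_completion[OF gU]
  have "(LINT y:ball x r|lebesgue. g (u y)) = (\<integral>y. indicator (ball x r) y * g (indicator K y * u y) \<partial>lebesgue)"
    unfolding set_lebesgue_integral_def
    by (rule Bochner_Integration.integral_cong) (use K in \<open>auto simp: indicator_def\<close>)
  also have "\<dots> = (\<integral>y. indicator (ball x r) y * g (U y) \<partial>lebesgue)"
    using measurable by (rule integral_cong_AE) (use ae in auto)
  also have "\<dots> = (\<integral>y. indicator (ball x r) y * g (U y) \<partial>lborel)"
    by (rule integral_completion[OF gU])
  finally show ?thesis
    by (simp add: ball_average_def set_lebesgue_integral_def measure_completion)
qed

section \<open>From dyadic radii to the precise representative\<close>

lemma dyadic_radius:
  fixes r R :: real
  assumes "0 < r" "r \<le> R"
  obtains k where "R / 2 ^ Suc k < r" "r \<le> R / 2 ^ k"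
proof -
  obtain n where "R / r < 2 ^ n"
    using real_arch_pow[of 2 "R / r"] by auto
  then have ex: "R / 2 ^ n < r"
    using assms by (simp add: field_simps)
  define m where "m = (LEAST m. R / 2 ^ m < r)"
  have m: "R / 2 ^ m < r"
    unfolding m_def by (rule LeastI, rule ex)
  then obtain k where k: "m = Suc k"
    using assms by (cases m) auto
  have "\<not> R / 2 ^ k < r"
    using not_less_Least[of k "\<lambda>m. R / 2 ^ m < r"] k by (simp add: m_def)
  then show ?thesis
    using m k that by force
qed

text \<open>A ball of radius r sits in a dyadic closed ball of radius less than 2r, which costs a
  factor \<open>2 ^ CARD('n)\<close> in volume. So the mean oscillation about c tends to 0 along all
  radii, and this yields both the Lebesgue point and the limit c of the averages.\<close>

lemma (in weak_gradient_pair) precise_rep_eq: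
  assumes meas: "(\<lambda>x. indicator K x * u x) \<in> borel_measurable lebesgue"
    and ae: "AE x in lebesgue. indicator K x * u x = U x" and R: "R > 0" "cball x R \<subseteq> K"
    and lim: "(\<lambda>k. oscillation (cball x (R / 2 ^ k)) c / measure lborel (cball x (R / 2 ^ k))) \<longlonglongrightarrow> 0"
  shows "precise_rep u x = c"
proof -
  define h where "h r = ball_average (\<lambda>y. \<bar>u y - c\<bar>) x r" for r
  define s where "s k = oscillation (cball x (R / 2 ^ k)) c / measure lborel (cball x (R / 2 ^ k))" for k
  have ball_pos: "measure lborel (ball x r) > 0" if "r > 0" for r
    using content_ball_pos[OF that, of x] by simp
  have ball_K: "ball x r \<subseteq> K" if "r \<le> R" for r
    using R(2) that by (auto simp: subset_iff)
  have h: "h r = oscillation (ball x r) c / measure lborel (ball x r)" if "r \<le> R" for r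
    unfolding h_def oscillation_def by (rule ball_average_eq[OF meas _ ae ball_K[OF that]]) measurable
  have h_le: "h r \<le> 2 ^ CARD('n) * s k" if k: "0 < r" "r \<le> R" "R / 2 ^ Suc k < r" "r \<le> R / 2 ^ k" for r k
  proof -
    let ?\<rho> = "R / 2 ^ k"
    have \<rho>: "?\<rho> > 0" "?\<rho> < 2 * r"
      using R(1) k(3) by (auto simp: field_simps)
    have "?\<rho> ^ CARD('n) \<le> (2 * r) ^ CARD('n)"
      using \<rho> by (intro power_mono) linarith+
    then have "measure lborel (cball x ?\<rho>) \<le> unit_ball_vol (real CARD('n)) * (2 * r) ^ CARD('n)"
      unfolding measure_cball[OF less_imp_le[OF \<rho>(1)]] by (rule mult_left_mono) simp
    also have "\<dots> = 2 ^ CARD('n) * measure lborel (ball x r)"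
      using k(1) content_ball[of r x] by (simp add: power_mult_distrib)
    finally have vol: "measure lborel (cball x ?\<rho>) \<le> 2 ^ CARD('n) * measure lborel (ball x r)" .
    have cpos: "measure lborel (cball x ?\<rho>) > 0"
      using \<rho>(1) by (simp add: measure_cball)
    have "h r = oscillation (ball x r) c / measure lborel (ball x r)"
      by (rule h[OF k(2)])
    also have "\<dots> \<le> oscillation (cball x ?\<rho>) c / measure lborel (ball x r)"
      using k ball_pos by (intro divide_right_mono oscillation_mono) (auto simp: less_imp_le)
    also have "\<dots> \<le> oscillation (cball x ?\<rho>) c * (2 ^ CARD('n) / measure lborel (cball x ?\<rho>))"
    proof -
      have "1 / measure lborel (ball x r) \<le> 2 ^ CARD('n) / measure lborel (cball x ?\<rho>)"
        using vol cpos ball_pos[OF k(1)] by (simp add: divide_simps mult.commute)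
      from mult_left_mono[OF this oscillation_nonneg] show ?thesis
        by simp
    qed
    finally show ?thesis
      by (simp add: s_def mult.commute)
  qed
  have h0: "(h \<longlongrightarrow> 0) (at_right 0)"
  proof (rule tendstoI)
    fix e :: real assume "e > 0"
    have "(\<lambda>k. 2 ^ CARD('n) * s k) \<longlonglongrightarrow> 2 ^ CARD('n) * 0"
      using lim unfolding s_def by (intro tendsto_mult tendsto_const)
    then have "\<forall>\<^sub>F k in sequentially. 2 ^ CARD('n) * s k < e"
      using \<open>e > 0\<close> by (intro order_tendstoD) auto
    then obtain n where n: "\<And>k. k \<ge> n \<Longrightarrow> 2 ^ CARD('n) * s k < e"
      by (auto simp: eventually_sequentially)
    have "dist (h r) 0 < e" if r: "0 < r" "r < R / 2 ^ n" for r
    proof -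
      have "R / 2 ^ n \<le> R / 1"
        using R(1) by (intro divide_left_mono) auto
      then have rR: "r \<le> R" using r by simp
      obtain k where k: "R / 2 ^ Suc k < r" "r \<le> R / 2 ^ k"
        using dyadic_radius[OF r(1) rR] by blast
      have "n \<le> k"
      proof (rule ccontr)
        assume "\<not> n \<le> k"
        then have "R / 2 ^ n \<le> R / 2 ^ Suc k"
          using R(1) by (intro divide_left_mono power_increasing) auto
        then show False using k r by linarith
      qed
      have "h r < e"
        using h_le[OF r(1) rR k] n[OF \<open>n \<le> k\<close>] by linarith
      moreover have "0 \<le> h r"
        unfolding h[OF rR] by (intro divide_nonneg_nonneg oscillation_nonneg) simp
      ultimately show ?thesis by simp
    qed
    then show "\<forall>\<^sub>F r in at_right 0. dist (h r) 0 < e"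
      using R(1) by (intro eventually_at_rightI[of 0 "R / 2 ^ n"]) auto
  qed
  then have "lebesgue_point u x"
    unfolding lebesgue_point_def h_def by blast
  moreover have "(ball_average u x \<longlongrightarrow> c) (at_right 0)"
  proof (rule Lim_null_comparison[of "\<lambda>r. ball_average u x r - c" h, THEN LIM_zero_cancel])
    show "\<forall>\<^sub>F r in at_right 0. norm (ball_average u x r - c) \<le> h r"
    proof (rule eventually_at_rightI[of 0 R])
      fix r assume r: "r \<in> {0<..<R}"
      then have "ball_average u x r = average (ball x r)"
        using ball_average_eq[OF meas _ ae ball_K, of "\<lambda>y. y" r] by (simp add: average_def)
      then show "norm (ball_average u x r - c) \<le> h r"
        using average_diff_le[of "ball x r" c] ball_pos[of r] r by (simp add: h field_simps)
    qed fact
  qed (fact h0)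
  then have "Lim (at_right 0) (ball_average u x) = c"
    by (intro tendsto_Lim) auto
  ultimately show ?thesis
    by (simp add: precise_rep_def)
qed

section \<open>The oscillation estimate\<close>

text \<open>The first summand is the telescoping constant times the bound for the sum of scaled
  gradients; the second compares the ball of radius R with the cube.\<close>

definition deviation_const :: "nat \<Rightarrow> real \<Rightarrow> real" where
  "deviation_const n \<beta> = (let q = 2 powr (- (\<beta> / (2 * (real n - \<beta> / 2)))) in
     2 ^ (2 * n + 1) / unit_ball_vol (real n) * (gradient_const n + 1 / (1 - q))
     + 10 * real n * 2 ^ n * weak_Lp_const (12 ^ n) 1 (real n) / unit_ball_vol (real n))"

lemma (in weak_gradient_pair_in_cube) precise_rep_deviation_le:
  assumes meas: "(\<lambda>x. indicator (cube a (16 * R)) x * u x) \<in> borel_measurable lebesgue"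
    and ae: "AE x in lebesgue. indicator (cube a (16 * R)) x * u x = U x"
    and x: "x \<in> cube a (8 * R) - bad_set k"
  shows "\<bar>precise_rep u x - average (cube a (10 * R))\<bar> \<le> deviation_const CARD('n) \<beta> * A * (real k + 1)"
proof -
  define C1 where "C1 = 2 ^ (2 * CARD('n) + 1) / unit_ball_vol (real CARD('n))"
  define C2 where "C2 = gradient_const CARD('n) + 1 / (1 - q)"
  define C3 where "C3 = 10 * real CARD('n) * 2 ^ CARD('n) * weak_Lp_const (12 ^ CARD('n)) 1 (real CARD('n)) / unit_ball_vol (real CARD('n))"
  have C1: "C1 \<ge> 0" by (simp add: C1_def)
  have "0 \<le> weak_Lp_const (12 ^ CARD('n)) 1 (real CARD('n))"
    using two_le_n by (intro weak_Lp_const_nonneg) auto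
  then have C3: "C3 \<ge> 0"
    unfolding C3_def by (intro divide_nonneg_nonneg mult_nonneg_nonneg) auto
  have "cball x (2 * R) \<subseteq> cube a (8 * R + 2 * (2 * R))"
    using x by (intro cball_subset_cube) auto
  then have xW: "cball x (2 * R) \<subseteq> cube a (12 * R)"
    by simp
  obtain c where c: "(\<lambda>k. oscillation (cball x (R / 2 ^ k)) c / measure lborel (cball x (R / 2 ^ k))) \<longlonglongrightarrow> 0"
    "\<bar>c - average (cball x R)\<bar> \<le> C1 * (\<Sum>k. scaled_gradient (R / 2 ^ k) x)"
    using average_telescoping[OF R_pos order.trans[OF xW cube_W] scaled_gradient_sum_le(1)[OF x]]
    unfolding C1_def by blast
  have "cball x R \<subseteq> cube a (16 * R)"
    using xW R_pos cube_mono[of "12 * R" "16 * R" a] subset_cball[of R "2 * R" x] by auto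
  then have rep: "precise_rep u x = c"
    by (rule precise_rep_eq[OF meas ae R_pos _ c(1)])
  have "\<bar>c - average (cball x R)\<bar> \<le> C1 * (C2 * A * (real k + 1))"
    by (rule order.trans[OF c(2)]) (use C1 scaled_gradient_sum_le(2)[OF x] in \<open>auto simp: C2_def intro: mult_left_mono\<close>)
  moreover have "\<bar>average (cball x R) - average (cube a (10 * R))\<bar> \<le> C3 * A"
    using average_cball_cube_le[of x] x unfolding C3_def by simp
  moreover have "C3 * A \<le> C3 * A * (real k + 1)"
    using mult_left_mono[of 1 "real k + 1" "C3 * A"] C3 A_pos by simp
  ultimately have "\<bar>c - average (cube a (10 * R))\<bar> \<le> C1 * (C2 * A * (real k + 1)) + C3 * A * (real k + 1)"
    by linarith
  also have "\<dots> = (C1 * C2 + C3) * A * (real k + 1)"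
    by (simp add: algebra_simps)
  also have "C1 * C2 + C3 = deviation_const CARD('n) \<beta>"
    by (simp add: deviation_const_def Let_def C1_def C2_def C3_def q_eq p_eq)
  finally show ?thesis
    by (simp add: rep)
qed

lemma hausdorff_content_cube_le:
  fixes a :: "real ^ 'n"
  assumes "l > 0" "\<beta> > 0"
  shows "hausdorff_content \<beta> (cube a l) \<le> ennreal (unit_ball_vol \<beta> * (2 * real CARD('n) * l) powr \<beta>)"
proof -
  \<comment> \<open>The diameter bound \<open>real CARD('n) * l\<close> is doubled to fit the cube
    into an open ball; radius 0 fills up the sequence.\<close>
  define r where "r i = (if i = 0 then 2 * real CARD('n) * l else 0)" for i :: nat
  have "cube a l \<subseteq> ball a (2 * real CARD('n) * l)"
  proof
    fix x assume "x \<in> cube a l"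
    moreover have "a \<in> cube a l"
      using \<open>l > 0\<close> by (simp add: cube_def)
    ultimately have "norm (x - a) \<le> real CARD('n) * l"
      by (rule norm_diff_cube_le)
    also have "\<dots> < 2 * real CARD('n) * l"
      using \<open>l > 0\<close> by simp
    finally show "x \<in> ball a (2 * real CARD('n) * l)"
      by (simp add: dist_norm norm_minus_commute)
  qed
  also have "\<dots> = ball a (r 0)"
    by (simp add: r_def)
  also have "\<dots> \<subseteq> (\<Union>i. ball a (r i))"
    by blast
  finally have "hausdorff_content \<beta> (cube a l) \<le> (\<Sum>i. ennreal (unit_ball_vol \<beta> * r i powr \<beta>))"
    unfolding hausdorff_content_def using \<open>l > 0\<close>
    by (intro INF_lower2[of "(\<lambda>_. a, r)"]) (auto simp: r_def)
  also have "\<dots> = (\<Sum>i\<in>{0}. ennreal (unit_ball_vol \<beta> * r i powr \<beta>))"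
    by (rule suminf_finite) (auto simp: r_def)
  finally show ?thesis
    by (simp add: r_def)
qed

text \<open>The levels are cut into half-open slabs of length L. By monotonicity the content on a
  slab is at most its value at the lower end, and these bounds form a geometric series.\<close>

lemma choquet_integral_le_geometric:
  assumes L: "L > 0" and H: "H \<ge> 0" and \<rho>: "0 < \<rho>" "\<rho> < 1"
    and content: "\<And>k. hausdorff_content \<beta> {x \<in> Q. f x > ennreal (L * real k)} \<le> ennreal (H * \<rho> ^ k)"
  shows "choquet_integral \<beta> Q f \<le> ennreal (L * H / (1 - \<rho>))"
proof -
  define J where "J k = {L * real k..<L * real k + L}" for k
  have "choquet_integral \<beta> Q f \<le> (\<integral>\<^sup>+t. (\<Sum>k. ennreal (H * \<rho> ^ k) * indicator (J k) t) \<partial>lborel)"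
    unfolding choquet_integral_def
  proof (rule nn_integral_mono)
    fix t :: real
    show "hausdorff_content \<beta> {x \<in> Q. f x > ennreal t} * indicator {0<..} t
        \<le> (\<Sum>k. ennreal (H * \<rho> ^ k) * indicator (J k) t)"
    proof (cases "t > 0")
      case True
      define k where "k = nat \<lfloor>t / L\<rfloor>"
      have "real k \<le> t / L" "t / L < real k + 1"
        unfolding k_def using True L by (auto simp: of_nat_nat)
      then have k: "L * real k \<le> t" "t < L * real k + L"
        using L by (auto simp: field_simps)
      have "hausdorff_content \<beta> {x \<in> Q. f x > ennreal t} \<le> hausdorff_content \<beta> {x \<in> Q. f x > ennreal (L * real k)}"
        using ennreal_leI[OF k(1)] by (intro hausdorff_content_mono) (auto intro: le_less_trans)
      also have "\<dots> \<le> ennreal (H * \<rho> ^ k)"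
        by (rule content)
      also have "\<dots> = (\<Sum>j\<in>{k}. ennreal (H * \<rho> ^ j) * indicator (J j) t)"
        using k by (simp add: J_def)
      also have "\<dots> \<le> (\<Sum>k. ennreal (H * \<rho> ^ k) * indicator (J k) t)"
        by (rule sum_le_suminf) auto
      finally show ?thesis
        using True by simp
    qed simp
  qed
  also have "\<dots> = (\<Sum>k. ennreal (H * \<rho> ^ k) * ennreal L)"
  proof -
    have "emeasure lborel (J k) = ennreal L" for k
      using L by (simp add: J_def)
    then show ?thesis
      by (subst nn_integral_suminf) (auto simp: nn_integral_cmult_indicator J_def)
  qed
  also have "\<dots> = (\<Sum>k. ennreal (L * H * \<rho> ^ k))"
    using L H \<rho> by (simp add: mult_ac flip: ennreal_mult)
  also have "\<dots> = ennreal (\<Sum>k. L * H * \<rho> ^ k)"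
    using L H \<rho> by (intro suminf_ennreal2) (auto intro: summable_mult summable_geometric)
  also have "(\<Sum>k. L * H * \<rho> ^ k) = L * H / (1 - \<rho>)"
    using \<rho> by (subst suminf_mult) (auto simp: suminf_geometric intro: summable_geometric)
  finally show ?thesis .
qed

text \<open>The second summand covers level 0, where the whole cube is the superlevel set to be
  bounded; \<open>16 * real n\<close> is the radius of one covering ball divided by R.\<close>

definition cube_content_const :: "nat \<Rightarrow> real \<Rightarrow> real" where
  "cube_content_const n \<beta> = content_const n \<beta> + unit_ball_vol \<beta> * (16 * real n) powr \<beta>"

text \<open>The factor \<open>\<rho>\<close> in the denominator pays for the shift between level k +
  1 and the bad set of index k, \<open>1 - \<rho>\<close> comes from the geometric series, and
  \<open>8 powr \<beta>\<close> from \<open>l = 8 * R\<close>.\<close>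

definition bmo_const :: "nat \<Rightarrow> real \<Rightarrow> real" where
  "bmo_const n \<beta> = (let \<rho> = 2 powr (- (\<beta> / 2)) in
     deviation_const n \<beta> * cube_content_const n \<beta> / (\<rho> * (1 - \<rho>) * 8 powr \<beta>))"

lemma constants_nonneg:
  assumes "2 \<le> n" "0 < \<beta>" "\<beta> \<le> real n"
  shows "0 < deviation_const n \<beta>" "0 \<le> content_const n \<beta>" "0 \<le> cube_content_const n \<beta>" "0 \<le> bmo_const n \<beta>"
proof -
  have vol: "unit_ball_vol (real n) > 0" "unit_ball_vol \<beta> > 0"
    using assms by auto
  define q :: real where "q = 2 powr (- (\<beta> / (2 * (real n - \<beta> / 2))))"
  have "q < 1"
    unfolding q_def using assms by (intro powr_less_one) auto
  have "0 \<le> gradient_const n"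
    unfolding gradient_const_def using assms vol by (intro weak_Lp_const_nonneg) auto
  then have "0 < gradient_const n + 1 / (1 - q)"
    using \<open>q < 1\<close> by (intro add_nonneg_pos) auto
  then have 1: "0 < 2 ^ (2 * n + 1) / unit_ball_vol (real n) * (gradient_const n + 1 / (1 - q))"
    using vol by (intro mult_pos_pos divide_pos_pos) auto
  have "0 \<le> weak_Lp_const (12 ^ n) 1 (real n)"
    using assms by (intro weak_Lp_const_nonneg) auto
  then have "0 \<le> 10 * real n * 2 ^ n * weak_Lp_const (12 ^ n) 1 (real n) / unit_ball_vol (real n)"
    using vol by (intro divide_nonneg_nonneg mult_nonneg_nonneg) auto
  with 1 show dev: "0 < deviation_const n \<beta>"
    unfolding deviation_const_def Let_def q_def[symmetric] by (rule add_pos_nonneg)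
  have "0 \<le> weak_Lp_const (16 ^ n) (real n - \<beta> / 2) (real n)"
    using assms by (intro weak_Lp_const_nonneg) auto
  then show c: "0 \<le> content_const n \<beta>"
    unfolding content_const_def Let_def using vol by (intro mult_nonneg_nonneg) auto
  then show cc: "0 \<le> cube_content_const n \<beta>"
    unfolding cube_content_const_def using vol by (intro add_nonneg_nonneg mult_nonneg_nonneg) auto
  have "(2 :: real) powr (- (\<beta> / 2)) < 1"
    using assms by (intro powr_less_one) auto
  then show "0 \<le> bmo_const n \<beta>"
    unfolding bmo_const_def Let_def using dev cc
    by (intro divide_nonneg_nonneg mult_nonneg_nonneg) auto
qed

lemma (in weak_gradient_pair_in_cube) choquet_integral_deviation_le:
  assumes meas: "(\<lambda>x. indicator (cube a (16 * R)) x * u x) \<in> borel_measurable lebesgue"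
    and ae: "AE x in lebesgue. indicator (cube a (16 * R)) x * u x = U x"
  shows "choquet_integral \<beta> (cube a (8 * R)) (\<lambda>x. ennreal \<bar>precise_rep u x - average (cube a (10 * R))\<bar>)
    \<le> ennreal (bmo_const CARD('n) \<beta> * A * (8 * R) powr \<beta>)"
proof -
  define f where "f x = ennreal \<bar>precise_rep u x - average (cube a (10 * R))\<bar>" for x
  define \<rho> :: real where "\<rho> = 2 powr (- (\<beta> / 2))"
  have \<rho>: "0 < \<rho>" "\<rho> < 1"
    using \<beta>_pos by (auto simp: \<rho>_def intro: powr_less_one)
  define L where "L = deviation_const CARD('n) \<beta> * A"
  define H where "H = cube_content_const CARD('n) \<beta> * R powr \<beta>"
  note const = constants_nonneg[OF two_le_n \<beta>_pos \<beta>_le]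
  have L: "L > 0" using const A_pos by (simp add: L_def)
  have H: "H \<ge> 0" using const by (simp add: H_def)
  have "choquet_integral \<beta> (cube a (8 * R)) f \<le> ennreal (L * (H / \<rho>) / (1 - \<rho>))"
  proof (rule choquet_integral_le_geometric[OF L _ \<rho>])
    fix k
    have vol: "unit_ball_vol \<beta> \<ge> 0"
      using \<beta>_pos by simp
    show "hausdorff_content \<beta> {x \<in> cube a (8 * R). f x > ennreal (L * real k)} \<le> ennreal (H / \<rho> * \<rho> ^ k)"
    proof (cases k)
      case 0
      have "hausdorff_content \<beta> {x \<in> cube a (8 * R). f x > ennreal (L * real k)} \<le> hausdorff_content \<beta> (cube a (8 * R))"
        by (rule hausdorff_content_mono) auto
      also have "\<dots> \<le> ennreal (unit_ball_vol \<beta> * (2 * real CARD('n) * (8 * R)) powr \<beta>)"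
        using R_pos \<beta>_pos by (intro hausdorff_content_cube_le) auto
      also have "(2 * real CARD('n) * (8 * R)) powr \<beta> = (16 * real CARD('n)) powr \<beta> * R powr \<beta>"
        using R_pos by (simp add: powr_mult[symmetric] mult_ac)
      also have "ennreal (unit_ball_vol \<beta> * ((16 * real CARD('n)) powr \<beta> * R powr \<beta>)) \<le> ennreal H"
        unfolding H_def cube_content_const_def using const
        by (intro ennreal_leI) (simp add: distrib_right mult.assoc)
      also have "\<dots> \<le> ennreal (H / \<rho> * \<rho> ^ k)"
        using 0 \<rho> H by (intro ennreal_leI) (simp add: field_simps mult_left_le)
      finally show ?thesis .
    next
      case (Suc j)
      \<comment> \<open>Off \<open>bad_set j\<close> the deviation is at most
        \<open>L * (real j + 1)\<close>, which is exactly the level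
        \<open>L * real k\<close>.\<close>
      have "{x \<in> cube a (8 * R). f x > ennreal (L * real k)} \<subseteq> bad_set j"
      proof
        fix x assume x: "x \<in> {x \<in> cube a (8 * R). f x > ennreal (L * real k)}"
        show "x \<in> bad_set j"
        proof (rule ccontr)
          assume "x \<notin> bad_set j"
          then have "f x \<le> ennreal (L * real k)"
            unfolding f_def L_def Suc using precise_rep_deviation_le[OF meas ae, of x j] x
            by (intro ennreal_leI) (simp add: add.commute)
          then show False using x by auto
        qed
      qed
      then have "hausdorff_content \<beta> {x \<in> cube a (8 * R). f x > ennreal (L * real k)} \<le> hausdorff_content \<beta> (bad_set j)"
        by (rule hausdorff_content_mono)
      also have "\<dots> \<le> ennreal (content_const CARD('n) \<beta> * R powr \<beta> * \<rho> ^ j)"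
        unfolding \<rho>_def by (rule hausdorff_content_bad_set)
      also have "\<dots> \<le> ennreal (H * \<rho> ^ j)"
        unfolding H_def cube_content_const_def using vol \<rho>
        by (intro ennreal_leI mult_right_mono) auto
      also have "H * \<rho> ^ j = H / \<rho> * \<rho> ^ k"
        using \<rho> Suc by simp
      finally show ?thesis .
    qed
  qed (use H \<rho> in auto)
  also have "L * (H / \<rho>) / (1 - \<rho>) = bmo_const CARD('n) \<beta> * A * (8 * R) powr \<beta>"
    using R_pos by (simp add: L_def H_def bmo_const_def Let_def powr_mult flip: \<rho>_def)
  finally show ?thesis
    by (simp add: f_def[abs_def])
qed

text \<open>A strictly positive upper bound \<open>A\<close> replaces the weak norm because
  \<open>A\<close> sets the thresholds and appears as a divisor.\<close>

lemma bmo_estimate: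
  fixes \<Omega> :: "(real ^ 'n) set"
  assumes n: "2 \<le> CARD('n)" and \<beta>: "0 < \<beta>" "\<beta> \<le> real CARD('n)"
    and u: "u \<in> W11_loc \<Omega>" and G: "has_weak_gradient u G \<Omega>" "G \<in> weak_L (real CARD('n)) \<Omega>"
    and A: "A > 0" "weak_L_norm (real CARD('n)) \<Omega> G \<le> ennreal A"
  shows "BMO_norm \<beta> \<Omega> (precise_rep u) \<le> ennreal (bmo_const CARD('n) \<beta> * A)"
  unfolding BMO_norm_def
proof (rule SUP_least)
  fix al :: "(real ^ 'n) \<times> real"
  assume "al \<in> {(a, l). 0 < l \<and> cube a (2 * l) \<subseteq> \<Omega>}"
  then obtain a l where al: "al = (a, l)" "l > 0" "cube a (2 * l) \<subseteq> \<Omega>"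
    by blast
  \<comment> \<open>The scale fits all sets into the concentric cube of side
    \<open>2 * l = 16 * R\<close>: for x in \<open>cube a (8 * R)\<close>, \<open>cball x R\<close>
    lies in \<open>cube a (10 * R)\<close> and \<open>cball x (2 * R)\<close> in
    \<open>cube a (12 * R)\<close>.\<close>
  define R where "R = l / 8"
  have R: "R > 0" "l = 8 * R" "2 * l = 16 * R"
    using al(2) by (auto simp: R_def)
  have \<Omega>: "cube a (16 * R) \<subseteq> \<Omega>"
    using al(3) by (simp add: R(3)[symmetric])
  obtain U V where UV: "weak_gradient_pair U V (cube a (16 * R))"
    and meas: "(\<lambda>x. indicator (cube a (16 * R)) x * u x) \<in> borel_measurable lebesgue"
    and aeU: "AE x in lebesgue. indicator (cube a (16 * R)) x * u x = U x"
    and aeV: "AE x in lebesgue. x \<in> cube a (16 * R) \<longrightarrow> V x = G x"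
    and V0: "\<And>x. x \<notin> cube a (16 * R) \<Longrightarrow> V x = 0"
    using weak_gradient_truncation[OF u G(1) compact_cube \<Omega>] by blast
  interpret weak_gradient_pair U V "cube a (16 * R)"
    by (rule UV)
  define p where "p = real CARD('n) - \<beta> / 2"
  interpret weak_gradient_pair_in_cube U V "cube a (16 * R)" a A R \<beta> p "2 powr (- (\<beta> / (2 * p)))"
  proof
    show "emeasure lborel {x. norm (V x) > t} \<le> ennreal ((A / t) powr real CARD('n))" if "t > 0" for t
      using A n that \<Omega> by (intro weak_gradient_tail[OF G(2) A(2) _ _ _ \<Omega> _ aeV V0]) auto
    show "cube a (12 * R) \<subseteq> cube a (16 * R)"
      using R by (intro cube_mono) auto
  qed (use A R n \<beta> V0 p_def in auto)
  \<comment> \<open>The competitor in the infimum: the cube of side \<open>10 * R\<close> contains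
    every ball \<open>cball x R\<close> with x in the given cube.\<close>
  let ?c = "average (cube a (10 * R))"
  have "choquet_integral \<beta> (cube a l) (\<lambda>x. ennreal \<bar>precise_rep u x - ?c\<bar>) / ennreal (l powr \<beta>)
      \<le> ennreal (bmo_const CARD('n) \<beta> * A * l powr \<beta>) / ennreal (l powr \<beta>)"
    unfolding R(2) by (intro divide_right_mono_ennreal choquet_integral_deviation_le[OF meas aeU])
  also have "\<dots> = ennreal (bmo_const CARD('n) \<beta> * A)"
    using al(2) constants_nonneg(4)[OF n \<beta>] A(1) by (subst divide_ennreal) auto
  finally show "(case al of (a, l) \<Rightarrow> INF c. choquet_integral \<beta> (cube a l) (\<lambda>x. ennreal \<bar>precise_rep u x - c\<bar>) / ennreal (l powr \<beta>))
      \<le> ennreal (bmo_const CARD('n) \<beta> * A)"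
    unfolding al(1) prod.case by (rule INF_lower2[OF UNIV_I])
qed

text \<open>The dimension is at least 2 because weak L^1 does not embed locally into L^1. On a line
  the inequality fails: a derivative of weak norm 1 can average about log N over all but tiny
  intervals, and then u is close to a function of slope log N.\<close>

theorem theorem1p2:
  fixes \<beta> :: real
  assumes "CARD('n::finite) \<ge> 2"
    and "0 < \<beta>" and "\<beta> \<le> real CARD('n)"
  shows "\<exists>C>0. \<forall>\<Omega> :: (real ^ 'n) set. open \<Omega> \<longrightarrow>
           (\<forall>u\<in>W11_loc \<Omega>. \<forall>G.
              has_weak_gradient u G \<Omega> \<and> G \<in> weak_L (real CARD('n)) \<Omega> \<longrightarrow>
              BMO_norm \<beta> \<Omega> (precise_rep u) \<le> ennreal C * weak_L_norm (real CARD('n)) \<Omega> G)"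
proof (intro exI conjI allI impI ballI)
  \<comment> \<open>The summand 1 makes the constant positive and permits the division in
    \<open>d = e / C\<close>.\<close>
  define C where "C = bmo_const CARD('n) \<beta> + 1"
  have B: "bmo_const CARD('n) \<beta> \<ge> 0"
    by (rule constants_nonneg[OF assms])
  then show "0 < bmo_const CARD('n) \<beta> + 1"
    by simp
  fix \<Omega> :: "(real ^ 'n) set" and u G
  assume u: "u \<in> W11_loc \<Omega>" and G: "has_weak_gradient u G \<Omega> \<and> G \<in> weak_L (real CARD('n)) \<Omega>"
  define w where "w = enn2real (weak_L_norm (real CARD('n)) \<Omega> G)"
  have w: "weak_L_norm (real CARD('n)) \<Omega> G = ennreal w" "w \<ge> 0"
    using G by (auto simp: w_def weak_L_def)
  show "BMO_norm \<beta> \<Omega> (precise_rep u) \<le> ennreal (bmo_const CARD('n) \<beta> + 1) * weak_L_norm (real CARD('n)) \<Omega> G"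
  \<comment> \<open>The weak norm w may be 0 while \<open>bmo_estimate\<close> asks for a positive
    bound, so it is applied to \<open>w + d\<close> with d proportional to e.\<close>
  proof (rule ennreal_le_epsilon)
    fix e :: real assume "e > 0"
    define d where "d = e / C"
    have C: "C > 0" "bmo_const CARD('n) \<beta> \<le> C" using B by (auto simp: C_def)
    have d: "d > 0" using \<open>e > 0\<close> C by (simp add: d_def)
    have "BMO_norm \<beta> \<Omega> (precise_rep u) \<le> ennreal (bmo_const CARD('n) \<beta> * (w + d))"
      using assms u G w d by (intro bmo_estimate[where G = G]) (auto intro: ennreal_leI)
    also have "\<dots> \<le> ennreal (C * (w + d))"
      using C w d by (intro ennreal_leI mult_right_mono) auto
    also have "C * (w + d) = C * w + e"
      using C by (simp add: d_def distrib_left)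
    also have "ennreal (C * w + e) = ennreal C * ennreal w + ennreal e"
      using C w \<open>e > 0\<close> by (simp add: ennreal_mult)
    finally show "BMO_norm \<beta> \<Omega> (precise_rep u)
        \<le> ennreal (bmo_const CARD('n) \<beta> + 1) * weak_L_norm (real CARD('n)) \<Omega> G + ennreal e"
      by (simp add: w(1) C_def)
  qed
qed

end
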